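(* Consider the system $$\dot x_2=y_2-(\mu+1)z_2+r_2F_2(x_2,y_2,z_2,r_2,\mu),\quad \dot y_2=\tfrac12\mu+r_2a_1y_2+r_2a_2z_2+r_2^2\overline G_2(x_2,y_2,z_2,r_2,\mu),\quad \dot z_2=x_2+z_2^2+r_2z_2H_2(x_2,y_2,z_2,r_2,\mu),$$ with $\mu=r_2\mu_2$, where $a_1,a_2\in\mathbb R$, $\lambda:=a_1+a_2\ne0$, and $F_2,\overline G_2,H_2$ are smooth functions, specifically analytic in $x_2,y_2,z_2$. Write $u:=(x_2,z_2)$. Fix $k\in\mathbb N$. Then there are constants $\delta>0$ and $\nu>0$, both sufficiently small, such that the following holds: there exists a locally invariant one-dimensional manifold $Z_{2,r_2}$ of the system, of the graph form $$u=m(y_2,r_2,\mu_2),$$ where $(r_2,\mu_2)\mapsto m(\cdot,r_2,\mu_2)\in\Omega^2(\nu)$ is $C^k$ for $0\le r_2\ll1$, $\mu_2\in[-\delta,\delta]$, and satisfies $m(y_2,0,\mu_2)=(-y_2^2,y_2)$; in particular $Z_{2,0}$ is a submanifold of the curve $C_2=\{(x_2,y_2,z_2): x_2=-y_2^2,\ z_2=y_2,\ y_2\in\mathbb R\}$.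
   Context: For $\nu>0$ and $j\in\mathbb N$, $\Omega^j(\nu)$ is the space of power series $h=\sum_{n\ge0}h_n(\cdot)^n:\overline{B_\nu}\to\mathbb C^j$ with $h_n\in\mathbb R^j$ and $\|h\|_{\Omega^j}:=\sum_{n\ge0}|h_n|\nu^n<\infty$, where $\overline{B_\nu}\subset\mathbb C$ is the closed disc of radius $\nu$ centered at the origin; it is a Banach space with this norm. The system is considered for $r_2\ge0$ near $0$. It arises from the slow-fast system $\dot x=\epsilon(y-(\mu+1)z+F)$, $\dot y=\epsilon(\frac12\mu+G)$, $\dot z=x+z^2+zH$ (with $F=\mathcal O(x,\epsilon,(|y|+|z|)^2)$, $G=\mathcal O(x,y,z,\epsilon)$, $H=\mathcal O(xz,xy,z^2,\epsilon)$ smooth in $(x,y,z,\epsilon,\mu)$ and analytic in $x,y,z$) by setting $x=r_2^2x_2$, $y=r_2y_2$, $z=r_2z_2$, $\epsilon=r_2^2$ and dividing the vector field by $r_2$; here $a_1=\partial_yG(\mathbf 0)$, $a_2=\partial_zG(\mathbf 0)$. $0\le r_2\ll1$ means for all sufficiently small $r_2\ge0$. *)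

theory Defs
  imports "HOL-Analysis.Analysis"
begin

text \<open>The sets \<open>S\<close> below are convex with nonempty interior but need not be open (one-sided
  parameter \<open>r \<ge> 0\<close>, closed parameter rectangles), so all derivatives are taken within \<open>S\<close>.
  As the domain is finite-dimensional, continuity of \<open>p \<mapsto> D p v\<close> for each \<open>v\<close> is the same as
  continuity of \<open>p \<mapsto> D p\<close> in operator norm.\<close>

primrec Ck_on :: "nat \<Rightarrow> ('a::euclidean_space \<Rightarrow> 'b::real_normed_vector) \<Rightarrow> 'a set \<Rightarrow> bool" where
  "Ck_on 0 f S \<longleftrightarrow> continuous_on S f"
| "Ck_on (Suc k) f S \<longleftrightarrow>
     (\<exists>D. (\<forall>p\<in>S. (f has_derivative D p) (at p within S)) \<and> (\<forall>v. Ck_on k (\<lambda>p. D p v) S))"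

definition smooth_on :: "('a::euclidean_space \<Rightarrow> 'b::real_normed_vector) \<Rightarrow> 'a set \<Rightarrow> bool" where
  "smooth_on f S \<longleftrightarrow> (\<forall>k. Ck_on k f S)"

definition complex_box :: "real \<Rightarrow> (complex \<times> complex \<times> complex \<times> real \<times> real) set" where
  "complex_box \<rho> =
     {(x, y, z, r, \<mu>). norm x < \<rho> \<and> norm y < \<rho> \<and> norm z < \<rho> \<and> 0 \<le> r \<and> r < \<rho> \<and> \<bar>\<mu>\<bar> < \<rho>}"

text \<open>A real function of \<open>(x, y, z, r, \<mu>)\<close>, \<open>r \<ge> 0\<close>, that is smooth near the origin and analytic in
  \<open>x, y, z\<close>. Analyticity is locally uniform in the parameters: there is a complex
  extension in \<open>x, y, z\<close> to a polydisc that does not depend on \<open>(r, \<mu>)\<close>, and it is jointly smooth.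
  (Joint continuity and holomorphy in each variable give holomorphy in \<open>(x, y, z)\<close>.)\<close>

definition smooth_analytic :: "(real \<Rightarrow> real \<Rightarrow> real \<Rightarrow> real \<Rightarrow> real \<Rightarrow> real) \<Rightarrow> bool" where
  "smooth_analytic F \<longleftrightarrow>
     (\<exists>\<rho>>0. \<exists>\<Phi> :: complex \<times> complex \<times> complex \<times> real \<times> real \<Rightarrow> complex.
        smooth_on \<Phi> (complex_box \<rho>) \<and>
        (\<forall>x y z r \<mu>. (x, y, z, r, \<mu>) \<in> complex_box \<rho> \<longrightarrow>
           (\<lambda>\<zeta>. \<Phi> (\<zeta>, y, z, r, \<mu>)) holomorphic_on ball 0 \<rho> \<and>
           (\<lambda>\<zeta>. \<Phi> (x, \<zeta>, z, r, \<mu>)) holomorphic_on ball 0 \<rho> \<and>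
           (\<lambda>\<zeta>. \<Phi> (x, y, \<zeta>, r, \<mu>)) holomorphic_on ball 0 \<rho>) \<and>
        (\<forall>x y z r \<mu>. (of_real x, of_real y, of_real z, r, \<mu>) \<in> complex_box \<rho> \<longrightarrow>
           \<Phi> (of_real x, of_real y, of_real z, r, \<mu>) = of_real (F x y z r \<mu>)))"

text \<open>An element of \<open>\<Omega>\<^sup>j(\<nu>)\<close> is represented by its sequence of coefficients \<open>h\<^sub>n \<in> \<real>\<^sup>j\<close>.
  \<open>Omega_fun\<close> is the sum of the series, used at complex arguments (the function on the closed
  disc of radius \<open>\<nu>\<close>) and at real arguments (its restriction to the real axis, with values in
  \<open>\<real>\<^sup>j\<close>).\<close>

definition Omega :: "real \<Rightarrow> (nat \<Rightarrow> real ^ 'j) set" where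
  "Omega \<nu> = {h. summable (\<lambda>n. norm (h n) * \<nu> ^ n)}"

definition Omega_norm :: "real \<Rightarrow> (nat \<Rightarrow> real ^ 'j) \<Rightarrow> real" where
  "Omega_norm \<nu> h = (\<Sum>n. norm (h n) * \<nu> ^ n)"

definition Omega_fun :: "(nat \<Rightarrow> real ^ 'j) \<Rightarrow> 'a::{real_normed_field, banach} \<Rightarrow> 'a ^ 'j" where
  "Omega_fun h \<zeta> = (\<chi> i. \<Sum>n. of_real (h n $ i) * \<zeta> ^ n)"

text \<open>The analogue of \<^const>\<open>Ck_on\<close> for maps into the Banach space \<open>\<Omega>\<^sup>j(\<nu>)\<close>: limits and Frechet
  derivatives are with respect to \<^const>\<open>Omega_norm\<close>. In the second clause, \<open>D p v \<in> Omega \<nu>\<close> for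
  \<open>p \<in> S\<close> is part of the recursive condition, and the linear map \<open>D p\<close> is bounded because its
  domain is finite-dimensional.\<close>

primrec Ck_Omega_on ::
    "nat \<Rightarrow> real \<Rightarrow> ('a::euclidean_space \<Rightarrow> nat \<Rightarrow> real ^ 'j) \<Rightarrow> 'a set \<Rightarrow> bool" where
  "Ck_Omega_on 0 \<nu> f S \<longleftrightarrow>
     (\<forall>p\<in>S. f p \<in> Omega \<nu>) \<and>
     (\<forall>p\<in>S. ((\<lambda>q. Omega_norm \<nu> (\<lambda>n. f q n - f p n)) \<longlongrightarrow> 0) (at p within S))"
| "Ck_Omega_on (Suc k) \<nu> f S \<longleftrightarrow>
     (\<forall>p\<in>S. f p \<in> Omega \<nu>) \<and>
     (\<exists>D. (\<forall>p\<in>S. (\<forall>n. linear (\<lambda>v. D p v n)) \<and>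
             ((\<lambda>q. Omega_norm \<nu> (\<lambda>n. f q n - f p n - D p (q - p) n) / norm (q - p)) \<longlongrightarrow> 0)
               (at p within S)) \<and>
          (\<forall>v. Ck_Omega_on k \<nu> (\<lambda>p. D p v) S))"

definition solution_on :: "('a::real_normed_vector \<Rightarrow> 'a) \<Rightarrow> (real \<Rightarrow> 'a) \<Rightarrow> real set \<Rightarrow> bool" where
  "solution_on f \<gamma> T \<longleftrightarrow> (\<forall>t\<in>T. (\<gamma> has_vector_derivative f (\<gamma> t)) (at t within T))"

text \<open>\<open>M\<close> is locally invariant if it has a neighbourhood \<open>V\<close> such that no solution can leave \<open>M\<close>,
  forwards or backwards in time, without also leaving \<open>V\<close>.\<close>

definition locally_invariant :: "('a::real_normed_vector \<Rightarrow> 'a) \<Rightarrow> 'a set \<Rightarrow> bool" where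
  "locally_invariant f M \<longleftrightarrow>
     (\<exists>V. open V \<and> M \<subseteq> V \<and>
        (\<forall>\<gamma> T t0. is_interval T \<and> t0 \<in> T \<and> solution_on f \<gamma> T \<and> \<gamma> t0 \<in> M \<and> \<gamma> ` T \<subseteq> V
                   \<longrightarrow> \<gamma> ` T \<subseteq> M))"

text \<open>The right-hand side of the system on \<open>(x\<^sub>2, y\<^sub>2, z\<^sub>2)\<close>-space, with \<open>\<mu> = r \<mu>\<^sub>2\<close> substituted.\<close>

definition system_field ::
    "real \<Rightarrow> real \<Rightarrow>
     (real \<Rightarrow> real \<Rightarrow> real \<Rightarrow> real \<Rightarrow> real \<Rightarrow> real) \<Rightarrow>
     (real \<Rightarrow> real \<Rightarrow> real \<Rightarrow> real \<Rightarrow> real \<Rightarrow> real) \<Rightarrow>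
     (real \<Rightarrow> real \<Rightarrow> real \<Rightarrow> real \<Rightarrow> real \<Rightarrow> real) \<Rightarrow>
     real \<Rightarrow> real \<Rightarrow> real \<times> real \<times> real \<Rightarrow> real \<times> real \<times> real" where
  "system_field a1 a2 F G H r \<mu>2 =
     (\<lambda>(x, y, z). let \<mu> = r * \<mu>2 in
        (y - (\<mu> + 1) * z + r * F x y z r \<mu>,
         1/2 * \<mu> + r * a1 * y + r * a2 * z + r\<^sup>2 * G x y z r \<mu>,
         x + z\<^sup>2 + r * z * H x y z r \<mu>))"

text \<open>The graph \<open>(x, z) = h(y)\<close>, taken over the open interval \<open>\<bar>y\<bar> < \<nu>\<close> so that it is a
  manifold without boundary.\<close>

definition graph_manifold :: "real \<Rightarrow> (nat \<Rightarrow> real ^ 2) \<Rightarrow> (real \<times> real \<times> real) set" where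
  "graph_manifold \<nu> h = {(x, y, z). \<bar>y\<bar> < \<nu> \<and> vector [x, z] = Omega_fun h y}"

definition C2 :: "(real \<times> real \<times> real) set" where
  "C2 = {(x, y, z). x = - (y\<^sup>2) \<and> z = y}"

end

(* With x = -y^2 + X and z = y + Z the invariance equation of a graph over y becomes, for the
   coefficients of y^n and with sigma = r (a1 + a2) n,
     sigma X_n + Z_n = f_n,   sigma Z_n - X_n = g_n,
   where f and g contain, besides small terms, the derivative terms -r q X' and -r q Z' with q small.
   The matrix on the left has determinant 1 + sigma^2 for every r >= 0 and n, and as r -> 0 it is the
   resolvent of the elliptic fast directions. Its inverse also absorbs the factor r n that comes from
   r q X', so the equation is a contraction for power series.
   Each parameter derivative of the inverse costs a factor n, hence a fixed loss of radius. To obtain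
   C^k dependence in one stroke, the coefficients are replaced by their k-jets in (r, mu2), and the
   jets are measured with a norm whose weight 2^(-n m) on derivatives of order m pays for this loss:
   it still gives a Banach algebra, in which the contraction argument applies verbatim. The entries of
   the resulting jets are true derivatives because this holds along the Picard iteration, which
   converges uniformly in the parameters. *)

theory Submission
  imports Defs "HOL-Complex_Analysis.Cauchy_Integral_Formula"
begin

section \<open>A Banach algebra of power series with jet coefficients\<close>

text \<open>A small parameter does not have a small jet: the derivative of r is 1. Derivatives are
  therefore counted in a unit e, the entry (i, j) being e^(i+j)/(i! j!) times a partial derivative,
  so that the jets of r and mu2 have size |r| + e and |mu2| + e. The same unit, kept below 1/(2 |a1
  + a2|), makes the jets of the inverse matrix summable. Not every nonlinear term carries a factor
  r. The terms 2 y Z + Z^2 are small through the radius rho of y and the size beta of (X, Z); q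
  contains a2 Z, of size beta, and differentiating in y = rho t costs 1/rho. Hence beta has to be
  small against rho, and the bound kappa for r, mu2 and e small against both. That a1 + a2 is
  nonzero makes r n a fixed multiple of sigma. Substituting jets into F, G, H requires Taylor
  coefficients in x, y, z that decay geometrically together with their parameter derivatives. They
  are written as Cauchy integrals over a fixed torus: parameter derivatives act on the function
  alone, and one bound serves all coefficients.\<close>

definition jco :: "real fps fps \<Rightarrow> nat \<Rightarrow> nat \<Rightarrow> real" where
  "jco g i j = fps_nth (fps_nth g i) j"

lemma jco_simps [simp]:
  "jco 0 i j = 0" "jco (g + h) i j = jco g i j + jco h i j" "jco (g - h) i j = jco g i j - jco h i j"
  "jco (- g) i j = - jco g i j"
  by (auto simp: jco_def)

lemma jco_sum: "jco (sum f A) i j = (\<Sum>x\<in>A. jco (f x) i j)"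
  by (simp add: jco_def fps_sum_nth)

lemma jco_mult: "jco (g * h) i j = (\<Sum>i'\<le>i. \<Sum>j'\<le>j. jco g i' j' * jco h (i - i') (j - j'))"
  by (simp add: jco_def fps_mult_nth fps_sum_nth atLeast0AtMost)

lemma jet_eqI: "(\<And>i j. jco g i j = jco h i j) \<Longrightarrow> g = h"
  by (simp add: jco_def fps_eq_iff)

abbreviation co3 :: "real fps fps fps \<Rightarrow> nat \<Rightarrow> nat \<Rightarrow> nat \<Rightarrow> real" where
  "co3 a n \<equiv> jco (fps_nth a n)"

lemma co3_mult: "co3 (a * b) n i j =
   (\<Sum>n'\<le>n. \<Sum>i'\<le>i. \<Sum>j'\<le>j. co3 a n' i' j' * co3 b (n - n') (i - i') (j - j'))"
  by (simp add: fps_mult_nth jco_sum jco_mult atLeast0AtMost)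

abbreviation wt :: "nat \<Rightarrow> nat \<Rightarrow> real" where "wt n m \<equiv> (1/2) ^ (n * m)"

text \<open>Partial sums over a cube of indices. The norm is later their supremum, so that all
  product estimates concern finite sums of nonnegative terms.\<close>

definition wS :: "nat \<Rightarrow> (nat \<Rightarrow> nat \<Rightarrow> nat \<Rightarrow> real) \<Rightarrow> real" where
  "wS N c = (\<Sum>n\<le>N. \<Sum>i\<le>N. \<Sum>j\<le>N. \<bar>c n i j\<bar> * wt n (i + j))"

lemma wS_nonneg: "0 \<le> wS N c"
  unfolding wS_def by (intro sum_nonneg) auto

text \<open>The index pairs with sum at most \<open>N\<close> form a triangle inside a square, and
  the terms outside the triangle are nonnegative.\<close>

lemma sum_convolution_le:
  fixes f g :: "nat \<Rightarrow> real"
  assumes "\<And>i. 0 \<le> f i" "\<And>i. 0 \<le> g i"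
  shows "(\<Sum>n\<le>N. \<Sum>k\<le>n. f k * g (n - k)) \<le> (\<Sum>n\<le>N. f n) * (\<Sum>n\<le>N. g n)"
proof -
  have "(\<Sum>n\<le>N. \<Sum>k\<le>n. f k * g (n - k)) = (\<Sum>(k,l)\<in>{(k,l). k + l \<le> N}. f k * g l)"
    by (rule sum.triangle_reindex_eq [symmetric])
  also have "\<dots> \<le> (\<Sum>(k,l)\<in>{..N} \<times> {..N}. f k * g l)"
    by (rule sum_mono2) (use assms in auto)
  finally show ?thesis
    by (simp add: sum_product sum.cartesian_product)
qed

lemma sum_convolution_le2:
  fixes f g :: "nat \<Rightarrow> nat \<Rightarrow> real"
  assumes f: "\<And>i j. 0 \<le> f i j" and g: "\<And>i j. 0 \<le> g i j"
  shows "(\<Sum>i\<le>N. \<Sum>j\<le>N. \<Sum>i'\<le>i. \<Sum>j'\<le>j. f i' j' * g (i - i') (j - j'))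
     \<le> (\<Sum>i\<le>N. \<Sum>j\<le>N. f i j) * (\<Sum>i\<le>N. \<Sum>j\<le>N. g i j)"
proof -
  have "(\<Sum>i\<le>N. \<Sum>j\<le>N. \<Sum>i'\<le>i. \<Sum>j'\<le>j. f i' j' * g (i - i') (j - j'))
      = (\<Sum>i\<le>N. \<Sum>i'\<le>i. \<Sum>j\<le>N. \<Sum>j'\<le>j. f i' j' * g (i - i') (j - j'))"
    by (intro sum.cong refl sum.swap)
  also have "\<dots> \<le> (\<Sum>i\<le>N. \<Sum>i'\<le>i. (\<Sum>j\<le>N. f i' j) * (\<Sum>j\<le>N. g (i - i') j))"
    by (intro sum_mono sum_convolution_le f g)
  also have "\<dots> \<le> (\<Sum>i\<le>N. \<Sum>j\<le>N. f i j) * (\<Sum>i\<le>N. \<Sum>j\<le>N. g i j)"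
    by (intro sum_convolution_le sum_nonneg f g)
  finally show ?thesis .
qed

lemma sum_convolution_le3:
  fixes f g :: "nat \<Rightarrow> nat \<Rightarrow> nat \<Rightarrow> real"
  assumes f: "\<And>n i j. 0 \<le> f n i j" and g: "\<And>n i j. 0 \<le> g n i j"
  shows "(\<Sum>n\<le>N. \<Sum>i\<le>N. \<Sum>j\<le>N. \<Sum>n'\<le>n. \<Sum>i'\<le>i. \<Sum>j'\<le>j. f n' i' j' * g (n - n') (i - i') (j - j'))
     \<le> (\<Sum>n\<le>N. \<Sum>i\<le>N. \<Sum>j\<le>N. f n i j) * (\<Sum>n\<le>N. \<Sum>i\<le>N. \<Sum>j\<le>N. g n i j)"
proof -
  have "(\<Sum>i\<le>N. \<Sum>j\<le>N. \<Sum>n'\<le>n. \<Sum>i'\<le>i. \<Sum>j'\<le>j. f n' i' j' * g (n - n') (i - i') (j - j'))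
      = (\<Sum>n'\<le>n. \<Sum>i\<le>N. \<Sum>j\<le>N. \<Sum>i'\<le>i. \<Sum>j'\<le>j. f n' i' j' * g (n - n') (i - i') (j - j'))" for n
  proof -
    have "(\<Sum>i\<le>N. \<Sum>j\<le>N. \<Sum>n'\<le>n. \<Sum>i'\<le>i. \<Sum>j'\<le>j. f n' i' j' * g (n - n') (i - i') (j - j'))
      = (\<Sum>i\<le>N. \<Sum>n'\<le>n. \<Sum>j\<le>N. \<Sum>i'\<le>i. \<Sum>j'\<le>j. f n' i' j' * g (n - n') (i - i') (j - j'))"
      by (intro sum.cong refl sum.swap)
    also have "\<dots> = (\<Sum>n'\<le>n. \<Sum>i\<le>N. \<Sum>j\<le>N. \<Sum>i'\<le>i. \<Sum>j'\<le>j. f n' i' j' * g (n - n') (i - i') (j - j'))"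
      by (rule sum.swap)
    finally show ?thesis .
  qed
  then have "(\<Sum>n\<le>N. \<Sum>i\<le>N. \<Sum>j\<le>N. \<Sum>n'\<le>n. \<Sum>i'\<le>i. \<Sum>j'\<le>j. f n' i' j' * g (n - n') (i - i') (j - j'))
      = (\<Sum>n\<le>N. \<Sum>n'\<le>n. \<Sum>i\<le>N. \<Sum>j\<le>N. \<Sum>i'\<le>i. \<Sum>j'\<le>j. f n' i' j' * g (n - n') (i - i') (j - j'))"
    by simp
  also have "\<dots> \<le> (\<Sum>n\<le>N. \<Sum>n'\<le>n. (\<Sum>i\<le>N. \<Sum>j\<le>N. f n' i j) * (\<Sum>i\<le>N. \<Sum>j\<le>N. g (n - n') i j))"
    by (intro sum_mono sum_convolution_le2 f g)
  also have "\<dots> \<le> (\<Sum>n\<le>N. \<Sum>i\<le>N. \<Sum>j\<le>N. f n i j) * (\<Sum>n\<le>N. \<Sum>i\<le>N. \<Sum>j\<le>N. g n i j)"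
    by (intro sum_convolution_le sum_nonneg f g)
  finally show ?thesis .
qed

text \<open>The exponent n m is superadditive: splitting both n and m into two parts only drops the
  mixed products. So the weight of a product is at most the product of the weights. Only domination
  by a convolution is assumed of \<open>c\<close>, which covers \<open>wmc\<close> as well as the
  ring product.\<close>

lemma wS_convolution:
  assumes "\<And>n i j. \<bar>c n i j\<bar> \<le> (\<Sum>n'\<le>n. \<Sum>i'\<le>i. \<Sum>j'\<le>j. \<bar>a n' i' j'\<bar> * \<bar>b (n - n') (i - i') (j - j')\<bar>)"
  shows "wS N c \<le> wS N a * wS N b"
proof -
  have w: "wt n (i + j) \<le> wt n' (i' + j') * wt (n - n') ((i - i') + (j - j'))"
    if "n' \<le> n" "i' \<le> i" "j' \<le> j" for n i j n' i' j' :: nat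
  proof -
    have "n' * (i' + j') + (n - n') * ((i - i') + (j - j')) \<le> n' * (i + j) + (n - n') * (i + j)"
      using that by (intro add_mono mult_le_mono) auto
    also have "\<dots> = n * (i + j)" using that by (metis add_mult_distrib le_add_diff_inverse)
    finally show ?thesis
      by (subst power_add [symmetric]) (rule power_decreasing, auto)
  qed
  have "wS N c \<le> (\<Sum>n\<le>N. \<Sum>i\<le>N. \<Sum>j\<le>N. \<Sum>n'\<le>n. \<Sum>i'\<le>i. \<Sum>j'\<le>j. 
     (\<bar>a n' i' j'\<bar> * wt n' (i' + j')) * (\<bar>b (n - n') (i - i') (j - j')\<bar> * wt (n - n') ((i - i') + (j - j'))))"
    unfolding wS_def
  proof (intro sum_mono)
    fix n i j
    have "\<bar>c n i j\<bar> * wt n (i + j) \<le> (\<Sum>n'\<le>n. \<Sum>i'\<le>i. \<Sum>j'\<le>j. \<bar>a n' i' j'\<bar> * \<bar>b (n - n') (i - i') (j - j')\<bar>) * wt n (i + j)"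
      by (intro mult_right_mono assms) auto
    also have "\<dots> = (\<Sum>n'\<le>n. \<Sum>i'\<le>i. \<Sum>j'\<le>j. (\<bar>a n' i' j'\<bar> * \<bar>b (n - n') (i - i') (j - j')\<bar>) * wt n (i + j))"
      by (simp add: sum_distrib_right)
    also have "\<dots> \<le> (\<Sum>n'\<le>n. \<Sum>i'\<le>i. \<Sum>j'\<le>j. (\<bar>a n' i' j'\<bar> * \<bar>b (n - n') (i - i') (j - j')\<bar>) *
         (wt n' (i' + j') * wt (n - n') ((i - i') + (j - j'))))"
      by (intro sum_mono mult_left_mono w) auto
    also have "\<dots> = (\<Sum>n'\<le>n. \<Sum>i'\<le>i. \<Sum>j'\<le>j. 
     (\<bar>a n' i' j'\<bar> * wt n' (i' + j')) * (\<bar>b (n - n') (i - i') (j - j')\<bar> * wt (n - n') ((i - i') + (j - j'))))"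
      by (intro sum.cong refl) (simp only: mult_ac)
    finally show "\<bar>c n i j\<bar> * wt n (i + j) \<le> \<dots>" .
  qed
  also have "\<dots> \<le> wS N a * wS N b"
    unfolding wS_def by (intro sum_convolution_le3) auto
  finally show ?thesis .
qed

lemma wS_add: "wS N (\<lambda>n i j. a n i j + b n i j) \<le> wS N a + wS N b"
  unfolding wS_def sum.distrib [symmetric]
  by (intro sum_mono) (simp add: distrib_right [symmetric] mult_right_mono abs_triangle_ineq)

lemma wS_diff: "wS N (\<lambda>n i j. a n i j - b n i j) \<le> wS N a + wS N b"
  unfolding wS_def sum.distrib [symmetric]
  by (intro sum_mono) (simp add: distrib_right [symmetric] mult_right_mono abs_triangle_ineq4)

lemma wS_monomial:
  "wS N (\<lambda>n i j. if n = m \<and> i = p \<and> j = q then x else 0) \<le> \<bar>x\<bar> * wt m (p + q)"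
proof -
  let ?x = "\<bar>x\<bar> * wt m (p + q)"
  have "(\<Sum>j\<le>N. \<bar>if n = m \<and> i = p \<and> j = q then x else 0\<bar> * wt n (i + j)) =
      (\<Sum>j\<le>N. if j = q then (if n = m \<and> i = p then ?x else 0) else 0)" for n i
    by (intro sum.cong) auto
  then have 1: "(\<Sum>j\<le>N. \<bar>if n = m \<and> i = p \<and> j = q then x else 0\<bar> * wt n (i + j)) =
      (if i = p then (if n = m \<and> q \<le> N then ?x else 0) else 0)" for n i
    by (simp add: sum.delta)
  have 2: "(\<Sum>i\<le>N. \<Sum>j\<le>N. \<bar>if n = m \<and> i = p \<and> j = q then x else 0\<bar> * wt n (i + j)) =
      (if n = m then (if p \<le> N \<and> q \<le> N then ?x else 0) else 0)" for n
    unfolding 1 by (simp add: sum.delta)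
  have "wS N (\<lambda>n i j. if n = m \<and> i = p \<and> j = q then x else 0) =
      (if m \<le> N then (if p \<le> N \<and> q \<le> N then ?x else 0) else 0)"
    unfolding wS_def 2 by (simp add: sum.delta)
  also have "\<dots> \<le> \<bar>x\<bar> * wt m (p + q)" by simp
  finally show ?thesis .
qed

lemma wS_scale: "wS N (\<lambda>n i j. c * a n i j) = \<bar>c\<bar> * wS N a"
  by (simp add: wS_def sum_distrib_left abs_mult mult.assoc)

text \<open>Undoing the weight at order m = i + j costs the factor (2^m)^n, that is, a radius
  smaller by the fixed factor 2^m. This is the loss of radius that reappears in
  \<open>CG_mj\<close>.\<close>

lemma coeff_le_wS:
  assumes "n \<le> N" "i \<le> N" "j \<le> N"
  shows "\<bar>c n i j\<bar> \<le> wS N c * 2 ^ (n * (i + j))"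
proof -
  have "\<bar>c n i j\<bar> * wt n (i + j) \<le> (\<Sum>j\<le>N. \<bar>c n i j\<bar> * wt n (i + j))"
    by (rule member_le_sum) (use assms in auto)
  also have "\<dots> \<le> (\<Sum>i\<le>N. \<Sum>j\<le>N. \<bar>c n i j\<bar> * wt n (i + j))"
    by (rule member_le_sum [where f = "\<lambda>i. \<Sum>j\<le>N. \<bar>c n i j\<bar> * wt n (i + j)"])
       (use assms in \<open>auto intro!: sum_nonneg\<close>)
  also have "\<dots> \<le> wS N c"
    unfolding wS_def
    by (rule member_le_sum [where f = "\<lambda>n. \<Sum>i\<le>N. \<Sum>j\<le>N. \<bar>c n i j\<bar> * wt n (i + j)"])
       (use assms in \<open>auto intro!: sum_nonneg\<close>)
  finally show ?thesis
    by (simp add: power_one_over field_simps)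
qed

text \<open>The coefficient of \<open>y^n\<close> is a Taylor jet in two parameter increments, which are the two inner
  power series variables.\<close>

typedef jalg = "{a :: real fps fps fps. \<exists>C. \<forall>N. wS N (co3 a) \<le> C}"
  by (rule exI [of _ 0]) (auto simp: wS_def intro!: exI [of _ 0])

setup_lifting type_definition_jalg

instantiation jalg :: "{comm_ring_1, real_vector}"
begin

lift_definition zero_jalg :: jalg is 0
  by (auto simp: wS_def intro!: exI [of _ 0])

lift_definition one_jalg :: jalg is 1
proof -
  have "co3 1 n i j = (if n = 0 \<and> i = 0 \<and> j = 0 then 1 else 0)" for n i j
    by (auto simp: jco_def)
  then show "\<exists>C. \<forall>N. wS N (co3 1) \<le> C"
    using wS_monomial [of _ 0 0 0 1] by (auto simp: wS_def intro!: exI [of _ 1])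
qed

lift_definition plus_jalg :: "jalg \<Rightarrow> jalg \<Rightarrow> jalg" is "(+)"
proof clarify
  fix a b :: "real fps fps fps" and C D
  assume *: "\<forall>N. wS N (co3 a) \<le> C" "\<forall>N. wS N (co3 b) \<le> D"
  have "wS N (co3 (a + b)) \<le> C + D" for N
  proof -
    have "wS N (co3 (a + b)) = wS N (\<lambda>n i j. co3 a n i j + co3 b n i j)"
      by (simp add: wS_def)
    also have "\<dots> \<le> wS N (co3 a) + wS N (co3 b)" by (rule wS_add)
    also have "\<dots> \<le> C + D" using * by (intro add_mono) auto
    finally show ?thesis .
  qed
  then show "\<exists>C. \<forall>N. wS N (co3 (a + b)) \<le> C" by blast
qed

lift_definition uminus_jalg :: "jalg \<Rightarrow> jalg" is uminus
  by (auto simp: wS_def)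

lift_definition minus_jalg :: "jalg \<Rightarrow> jalg \<Rightarrow> jalg" is "(-)"
proof clarify
  fix a b :: "real fps fps fps" and C D
  assume *: "\<forall>N. wS N (co3 a) \<le> C" "\<forall>N. wS N (co3 b) \<le> D"
  have "wS N (co3 (a - b)) \<le> C + D" for N
  proof -
    have "wS N (co3 (a - b)) = wS N (\<lambda>n i j. co3 a n i j - co3 b n i j)"
      by (simp add: wS_def)
    also have "\<dots> \<le> wS N (co3 a) + wS N (co3 b)" by (rule wS_diff)
    also have "\<dots> \<le> C + D" using * by (intro add_mono) auto
    finally show ?thesis .
  qed
  then show "\<exists>C. \<forall>N. wS N (co3 (a - b)) \<le> C" by blast
qed

lift_definition times_jalg :: "jalg \<Rightarrow> jalg \<Rightarrow> jalg" is "(*)"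
proof clarify
  fix a b :: "real fps fps fps" and C D
  assume ab: "\<forall>N. wS N (co3 a) \<le> C" "\<forall>N. wS N (co3 b) \<le> D"
  have "wS N (co3 (a * b)) \<le> C * D" for N
  proof -
    have "wS N (co3 (a * b)) \<le> wS N (co3 a) * wS N (co3 b)"
    proof (rule wS_convolution)
      fix n i j
      show "\<bar>co3 (a * b) n i j\<bar> \<le> (\<Sum>n'\<le>n. \<Sum>i'\<le>i. \<Sum>j'\<le>j. \<bar>co3 a n' i' j'\<bar> * \<bar>co3 b (n - n') (i - i') (j - j')\<bar>)"
        unfolding co3_mult abs_mult [symmetric]
        by (intro order_trans [OF sum_abs] sum_mono order_refl)
    qed
    also have "\<dots> \<le> C * D"
      using ab by (intro mult_mono) (auto simp: wS_nonneg intro: order_trans [OF wS_nonneg])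
    finally show ?thesis .
  qed
  then show "\<exists>C. \<forall>N. wS N (co3 (a * b)) \<le> C" by blast
qed

lift_definition scaleR_jalg :: "real \<Rightarrow> jalg \<Rightarrow> jalg" is
  "\<lambda>c a. fps_const (fps_const (fps_const c)) * a"
proof clarify
  fix c C and a :: "real fps fps fps"
  assume a: "\<forall>N. wS N (co3 a) \<le> C"
  have "co3 (fps_const (fps_const (fps_const c)) * a) n i j = c * co3 a n i j" for n i j
    by (simp add: jco_def)
  then have "wS N (co3 (fps_const (fps_const (fps_const c)) * a)) \<le> \<bar>c\<bar> * C" for N
    using a wS_scale [of N c "co3 a"] by (simp add: wS_def mult_left_mono)
  then show "\<exists>C. \<forall>N. wS N (co3 (fps_const (fps_const (fps_const c)) * a)) \<le> C" by blast
qed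

instance
proof
  fix a b c :: jalg and x y :: real
  show "a * b * c = a * (b * c)" "a * b = b * a" "1 * a = a" "a + b + c = a + (b + c)" "a + b = b + a"
    "0 + a = a" "- a + a = 0" "a - b = a + - b" "(a + b) * c = a * c + b * c" "(0::jalg) \<noteq> 1"
    by (transfer; simp add: algebra_simps)+
  show "x *\<^sub>R (a + b) = x *\<^sub>R a + x *\<^sub>R b" "(x + y) *\<^sub>R a = x *\<^sub>R a + y *\<^sub>R a"
    "x *\<^sub>R y *\<^sub>R a = (x * y) *\<^sub>R a" "1 *\<^sub>R a = a"
    by (transfer, simp add: distrib_left, transfer, simp add: distrib_right flip: fps_const_add,
        transfer, simp add: mult.assoc flip: fps_const_mult, transfer, simp)
qed

end

lift_definition co :: "jalg \<Rightarrow> nat \<Rightarrow> real fps fps" is fps_nth .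

abbreviation cf :: "jalg \<Rightarrow> nat \<Rightarrow> nat \<Rightarrow> nat \<Rightarrow> real" where
  "cf a n \<equiv> jco (co a n)"

lemma co_simps [simp]:
  "co 0 n = 0" "co (a + b) n = co a n + co b n" "co (a - b) n = co a n - co b n" "co (- a) n = - co a n"
  "co 1 n = (if n = 0 then 1 else 0)"
  by (transfer; simp)+

lemma co_mult: "co (a * b) n = (\<Sum>n'\<le>n. co a n' * co b (n - n'))"
  by transfer (simp add: fps_mult_nth atLeast0AtMost)

lemma cf_scaleR [simp]: "cf (c *\<^sub>R a) n i j = c * cf a n i j"
  by transfer (simp add: jco_def)

lemma cf_mult: "cf (a * b) n i j =
   (\<Sum>n'\<le>n. \<Sum>i'\<le>i. \<Sum>j'\<le>j. cf a n' i' j' * cf b (n - n') (i - i') (j - j'))"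
  by (simp add: co_mult jco_sum jco_mult)

lemma jalg_eqI: "(\<And>n i j. cf a n i j = cf b n i j) \<Longrightarrow> a = b"
  by transfer (simp add: jco_def fps_eq_iff)

instantiation jalg :: real_normed_algebra_1
begin

definition norm_jalg :: "jalg \<Rightarrow> real" where "norm a = (SUP N. wS N (cf a))"
definition dist_jalg :: "jalg \<Rightarrow> jalg \<Rightarrow> real" where "dist a b = norm (a - b :: jalg)"
definition sgn_jalg :: "jalg \<Rightarrow> jalg" where "sgn a = inverse (norm a) *\<^sub>R (a :: jalg)"
definition uniformity_jalg :: "(jalg \<times> jalg) filter" where
  "uniformity = (INF e\<in>{0 <..}. principal {(x, y :: jalg). dist x y < e})"
definition open_jalg :: "jalg set \<Rightarrow> bool" where
  "open U = (\<forall>x\<in>(U :: jalg set). eventually (\<lambda>(x', y). x' = x \<longrightarrow> y \<in> U) uniformity)"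

lemma bdd_wS: "bdd_above (range (\<lambda>N. wS N (cf a)))"
  by transfer (auto simp: bdd_above_def)

lemma wS_le_norm: "wS N (cf a) \<le> norm a"
  unfolding norm_jalg_def by (intro cSUP_upper bdd_wS) auto

lemma norm_jalg_leI: "(\<And>N. wS N (cf a) \<le> C) \<Longrightarrow> norm a \<le> C"
  unfolding norm_jalg_def by (intro cSUP_least) auto

lemma cf_le_norm: "\<bar>cf a n i j\<bar> \<le> norm a * 2 ^ (n * (i + j))"
proof -
  have "\<bar>cf a n i j\<bar> \<le> wS (n + i + j) (cf a) * 2 ^ (n * (i + j))"
    by (rule coeff_le_wS) auto
  also have "\<dots> \<le> norm a * 2 ^ (n * (i + j))"
    by (intro mult_right_mono wS_le_norm) auto
  finally show ?thesis .
qed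

instance
proof
  fix a b :: jalg and x :: real
  have nn: "0 \<le> norm a" for a :: jalg
    by (rule order_trans [OF wS_nonneg wS_le_norm [of 0]])
  show "(norm a = 0) = (a = 0)"
  proof
    assume "norm a = 0"
    then have "cf a n i j = 0" for n i j using cf_le_norm [of a n i j] by simp
    then show "a = 0" by (intro jalg_eqI) simp
  next
    assume "a = 0"
    moreover have "norm (0::jalg) \<le> 0" by (rule norm_jalg_leI) (simp add: wS_def)
    ultimately show "norm a = 0" using nn [of 0] by simp
  qed
  show "norm (a + b) \<le> norm a + norm b"
  proof (rule norm_jalg_leI)
    fix N
    have "wS N (cf (a + b)) \<le> wS N (cf a) + wS N (cf b)"
      using wS_add [of N "cf a" "cf b"] by (simp add: wS_def)
    then show "wS N (cf (a + b)) \<le> norm a + norm b"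
      using wS_le_norm [of N a] wS_le_norm [of N b] by linarith
  qed
  have sc: "norm (x *\<^sub>R a) \<le> \<bar>x\<bar> * norm a" for x and a :: jalg
  proof (rule norm_jalg_leI)
    fix N
    have "wS N (cf (x *\<^sub>R a)) = \<bar>x\<bar> * wS N (cf a)"
      using wS_scale [of N x "cf a"] by (simp add: wS_def)
    then show "wS N (cf (x *\<^sub>R a)) \<le> \<bar>x\<bar> * norm a"
      using wS_le_norm [of N a] by (simp add: mult_left_mono)
  qed
  show "norm (x *\<^sub>R a) = \<bar>x\<bar> * norm a"
  proof (cases "x = 0")
    case True
    then show ?thesis using sc [of 0 a] nn [of "0 *\<^sub>R a"] by simp
  next
    case False
    have "norm a \<le> \<bar>1 / x\<bar> * norm (x *\<^sub>R a)" using sc [of "1/x" "x *\<^sub>R a"] False by simp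
    then show ?thesis using sc [of x a] False by (simp add: field_simps)
  qed
  show "norm (a * b) \<le> norm a * norm b"
  proof (rule norm_jalg_leI)
    fix N
    have "wS N (cf (a * b)) \<le> wS N (cf a) * wS N (cf b)"
    proof (rule wS_convolution)
      fix n i j
      show "\<bar>cf (a * b) n i j\<bar> \<le> (\<Sum>n'\<le>n. \<Sum>i'\<le>i. \<Sum>j'\<le>j. \<bar>cf a n' i' j'\<bar> * \<bar>cf b (n - n') (i - i') (j - j')\<bar>)"
        unfolding cf_mult abs_mult [symmetric]
        by (intro order_trans [OF sum_abs] sum_mono order_refl)
    qed
    also have "\<dots> \<le> norm a * norm b"
      by (intro mult_mono wS_le_norm wS_nonneg nn)
    finally show "wS N (cf (a * b)) \<le> norm a * norm b" .
  qed
  have cf1: "cf 1 n i j = (if n = 0 \<and> i = 0 \<and> j = 0 then 1 else 0)" for n i j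
    by (auto simp: jco_def)
  show "norm (1::jalg) = 1"
  proof (rule antisym)
    show "norm (1::jalg) \<le> 1"
    proof (rule norm_jalg_leI)
      fix N
      have "wS N (cf 1) = wS N (\<lambda>n i j. if n = 0 \<and> i = 0 \<and> j = 0 then 1 else 0)"
        by (rule arg_cong [where f = "wS N"]) (intro ext cf1)
      then show "wS N (cf 1) \<le> 1" using wS_monomial [of N 0 0 0 1] by simp
    qed
    show "1 \<le> norm (1::jalg)" using cf_le_norm [of 1 0 0 0] unfolding cf1 by simp
  qed
  show "dist a b = norm (a - b)" by (simp add: dist_jalg_def)
  show "sgn a = inverse (norm a) *\<^sub>R a" by (simp add: sgn_jalg_def)
  show "x *\<^sub>R a * b = x *\<^sub>R (a * b)" "a * x *\<^sub>R b = x *\<^sub>R (a * b)"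
    by (transfer, simp only: mult.assoc, transfer, simp only: mult.left_commute)
qed (auto simp: uniformity_jalg_def open_jalg_def)

end

text \<open>\<open>Abs_jalg\<close> is meaningful only on its carrier, so each use comes with a
  bound on the partial sums. One such bound gives both the coefficients (\<open>co_mk\<close>) and
  the norm (\<open>norm_mk\<close>).\<close>

definition mk :: "(nat \<Rightarrow> real fps fps) \<Rightarrow> jalg" where
  "mk c = Abs_jalg (Abs_fps c)"

lemma co_mk:
  assumes "\<And>N. wS N (\<lambda>n. jco (c n)) \<le> C"
  shows "co (mk c) n = c n"
proof -
  have "Abs_fps c \<in> {a. \<exists>C. \<forall>N. wS N (co3 a) \<le> C}"
    using assms by auto
  then show ?thesis by (simp add: mk_def co.rep_eq Abs_jalg_inverse)
qed

lemma norm_mk: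
  assumes "\<And>N. wS N (\<lambda>n. jco (c n)) \<le> C"
  shows "norm (mk c) \<le> C"
  by (intro norm_jalg_leI) (simp add: co_mk [OF assms] assms)

text \<open>Completeness as for a weighted l1 space: the entries converge because each is controlled
  by the norm, and for fixed \<open>N\<close> the partial sum of a difference is a finite sum, so
  the Cauchy estimate passes to the limit with a bound independent of \<open>N\<close>.\<close>

instance jalg :: banach
proof
  fix X :: "nat \<Rightarrow> jalg"
  assume X: "Cauchy X"
  have "Cauchy (\<lambda>m. cf (X m) n i j)" for n i j
  proof (rule metric_CauchyI)
    fix e :: real assume "0 < e"
    then have "0 < e / 2 ^ (n * (i + j))" by simp
    then obtain M where M: "\<And>p q. p \<ge> M \<Longrightarrow> q \<ge> M \<Longrightarrow> dist (X p) (X q) < e / 2 ^ (n * (i + j))"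
      using X by (meson metric_CauchyD)
    show "\<exists>M. \<forall>p\<ge>M. \<forall>q\<ge>M. dist (cf (X p) n i j) (cf (X q) n i j) < e"
    proof (intro exI [of _ M] allI impI)
      fix p q assume "M \<le> p" "M \<le> q"
      then have "norm (X p - X q) * 2 ^ (n * (i + j)) < e"
        using M [of p q] by (simp add: dist_norm field_simps)
      then show "dist (cf (X p) n i j) (cf (X q) n i j) < e"
        using cf_le_norm [of "X p - X q" n i j] by (simp add: dist_norm)
    qed
  qed
  then have "\<forall>n i j. \<exists>L. (\<lambda>m. cf (X m) n i j) \<longlonglongrightarrow> L"
    using Cauchy_convergent convergent_def by blast
  then obtain L where L: "\<And>n i j. (\<lambda>m. cf (X m) n i j) \<longlonglongrightarrow> L n i j" by metis
  define l where "l n = Abs_fps (\<lambda>i. Abs_fps (L n i))" for n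
  have jl: "jco (l n) i j = L n i j" for n i j by (simp add: l_def jco_def)
  have lim: "wS N (\<lambda>n i j. cf (X p) n i j - L n i j) \<le> e"
    if "\<And>q. q \<ge> M \<Longrightarrow> norm (X p - X q) \<le> e" for p M N e
  proof (rule tendsto_upperbound)
    show "(\<lambda>q. wS N (cf (X p - X q))) \<longlonglongrightarrow> wS N (\<lambda>n i j. cf (X p) n i j - L n i j)"
      unfolding wS_def by (simp, intro tendsto_intros L)
    show "\<forall>\<^sub>F q in sequentially. wS N (cf (X p - X q)) \<le> e"
      using that wS_le_norm order_trans unfolding eventually_sequentially by blast
  qed auto
  have C: "\<exists>M. \<forall>p\<ge>M. \<forall>q\<ge>M. norm (X p - X q) \<le> e" if "0 < e" for e
    using X that unfolding Cauchy_def dist_norm by (meson less_imp_le)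
  obtain M1 where M1: "\<And>p q. p \<ge> M1 \<Longrightarrow> q \<ge> M1 \<Longrightarrow> norm (X p - X q) \<le> 1"
    using C [of 1] by auto
  have bd: "wS N (\<lambda>n. jco (l n)) \<le> norm (X M1) + 1" for N
  proof -
    have "wS N (\<lambda>n. jco (l n)) = wS N (\<lambda>n i j. cf (X M1) n i j + (-1) * (cf (X M1) n i j - L n i j))"
      by (simp add: wS_def jl)
    also have "\<dots> \<le> wS N (cf (X M1)) + wS N (\<lambda>n i j. (-1) * (cf (X M1) n i j - L n i j))"
      by (rule wS_add)
    also have "wS N (\<lambda>n i j. (-1) * (cf (X M1) n i j - L n i j)) = wS N (\<lambda>n i j. (cf (X M1) n i j - L n i j))"
      by (subst wS_scale) simp
    finally show ?thesis
      using wS_le_norm [of N "X M1"] lim [of M1 M1 1 N] M1 by auto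
  qed
  show "convergent X"
  proof (rule convergentI, rule LIMSEQ_I)
    fix e :: real assume "0 < e"
    then obtain M where M: "\<And>p q. p \<ge> M \<Longrightarrow> q \<ge> M \<Longrightarrow> norm (X p - X q) \<le> e/2"
      using C [of "e/2"] by auto
    show "\<exists>no. \<forall>p\<ge>no. norm (X p - mk l) < e"
    proof (intro exI [of _ M] allI impI)
      fix p assume "M \<le> p"
      have "norm (X p - mk l) \<le> e/2"
      proof (rule norm_jalg_leI)
        fix N
        show "wS N (cf (X p - mk l)) \<le> e/2"
        proof -
          have "cf (X p - mk l) = (\<lambda>n i j. cf (X p) n i j - L n i j)"
            by (intro ext) (simp add: co_mk [OF bd] jl)
          then show ?thesis using lim [of M p "e/2" N] M \<open>M \<le> p\<close> by simp
        qed
      qed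
      then show "norm (X p - mk l) < e" using \<open>0 < e\<close> by simp
    qed
  qed
qed

section \<open>Bounded operators on the algebra\<close>

lemma bounded_linear_cf: "bounded_linear (\<lambda>a. cf a n i j)"
  by (rule bounded_linear_intro [of _ "2 ^ (n * (i + j))"]) (auto simp: cf_le_norm)

section \<open>Evaluation of the order-zero entries at real points\<close>

lemma sum_cf_le_norm: "(\<Sum>n\<le>N. \<bar>cf a n 0 0\<bar>) \<le> norm a"
proof -
  have "(\<Sum>n\<le>N. \<bar>cf a n 0 0\<bar>) \<le> wS N (cf a)"
    unfolding wS_def
  proof (rule sum_mono)
    fix n
    have "\<bar>cf a n 0 0\<bar> = \<bar>cf a n 0 0\<bar> * wt n (0 + 0)" by simp
    also have "\<dots> \<le> (\<Sum>j\<le>N. \<bar>cf a n 0 j\<bar> * wt n (0 + j))"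
      by (rule member_le_sum) auto
    also have "\<dots> \<le> (\<Sum>i\<le>N. \<Sum>j\<le>N. \<bar>cf a n i j\<bar> * wt n (i + j))"
      by (rule member_le_sum [where f = "\<lambda>i. \<Sum>j\<le>N. \<bar>cf a n i j\<bar> * wt n (i + j)"])
         (auto intro!: sum_nonneg)
    finally show "\<bar>cf a n 0 0\<bar> \<le> (\<Sum>i\<le>N. \<Sum>j\<le>N. \<bar>cf a n i j\<bar> * wt n (i + j))" .
  qed
  then show ?thesis using wS_le_norm order_trans by blast
qed

text \<open>The entry (0, 0) of a jet is the value of the function itself. Its weight is 1 and the
  (0, 0) entry of a product involves only (0, 0) entries, so on [-1, 1] evaluation is a contractive
  ring homomorphism and carries identities of the algebra to real functions.\<close>

definition ev :: "real \<Rightarrow> jalg \<Rightarrow> real" where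
  "ev t a = (\<Sum>n. cf a n 0 0 * t ^ n)"

lemma summable_abs_cf: "summable (\<lambda>n. \<bar>cf a n 0 0\<bar>)"
proof (rule bounded_imp_summable)
  show "(\<Sum>k\<le>n. \<bar>cf a k 0 0\<bar>) \<le> norm a" for n
    by (rule sum_cf_le_norm)
qed auto

lemma summable_ev_norm:
  assumes "\<bar>t\<bar> \<le> 1" shows "summable (\<lambda>n. norm (cf a n 0 0 * t ^ n))"
proof (rule summable_comparison_test' [OF summable_abs_cf [of a], of 0])
  show "norm (norm (cf a n 0 0 * t ^ n)) \<le> \<bar>cf a n 0 0\<bar>" for n
    using assms by (simp add: abs_mult power_abs mult_left_le power_le_one)
qed

lemma summable_ev: "\<bar>t\<bar> \<le> 1 \<Longrightarrow> summable (\<lambda>n. cf a n 0 0 * t ^ n)"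
  by (rule summable_norm_cancel) (rule summable_ev_norm)

lemma cf_mult00: "cf (a * b) n 0 0 = (\<Sum>k\<le>n. cf a k 0 0 * cf b (n - k) 0 0)"
  by (simp add: cf_mult)

lemma ev_mult:
  assumes "\<bar>t\<bar> \<le> 1" shows "ev t (a * b) = ev t a * ev t b"
proof -
  have "ev t a * ev t b = (\<Sum>n. \<Sum>k\<le>n. (cf a k 0 0 * t ^ k) * (cf b (n - k) 0 0 * t ^ (n - k)))"
    unfolding ev_def by (intro Cauchy_product summable_ev_norm assms)
  also have "\<dots> = ev t (a * b)"
    unfolding ev_def cf_mult00 sum_distrib_right
    by (intro arg_cong [where f = suminf] ext sum.cong refl)
       (simp add: power_add [symmetric] mult_ac)
  finally show ?thesis by simp
qed

lemma abs_ev_le: "\<bar>t\<bar> \<le> 1 \<Longrightarrow> \<bar>ev t a\<bar> \<le> norm a"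
proof -
  assume t: "\<bar>t\<bar> \<le> 1"
  have "\<bar>ev t a\<bar> \<le> (\<Sum>n. norm (cf a n 0 0 * t ^ n))"
    unfolding ev_def using summable_norm [OF summable_ev_norm [OF t]] by simp
  also have "\<dots> \<le> (\<Sum>n. \<bar>cf a n 0 0\<bar>)"
    using t by (intro suminf_le summable_ev_norm summable_abs_cf)
      (auto simp: abs_mult power_abs mult_left_le power_le_one)
  also have "\<dots> \<le> norm a"
  proof (intro suminf_le_const summable_abs_cf)
    fix N
    have "(\<Sum>n<N. \<bar>cf a n 0 0\<bar>) \<le> (\<Sum>n\<le>N. \<bar>cf a n 0 0\<bar>)" by (rule sum_mono2) auto
    then show "(\<Sum>n<N. \<bar>cf a n 0 0\<bar>) \<le> norm a" using sum_cf_le_norm [of a N] by linarith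
  qed
  finally show ?thesis .
qed

lemma bounded_linear_ev:
  assumes "\<bar>t\<bar> \<le> 1" shows "bounded_linear (ev t)"
proof (rule bounded_linear_intro [of _ 1])
  fix a b :: jalg and c :: real
  show "ev t (a + b) = ev t a + ev t b"
    unfolding ev_def by (simp add: distrib_right suminf_add summable_ev assms)
  show "ev t (c *\<^sub>R a) = c *\<^sub>R ev t a"
    unfolding ev_def by (simp add: mult.assoc suminf_mult summable_ev assms)
  show "norm (ev t a) \<le> norm a * 1" using abs_ev_le [OF assms] by simp
qed

lemma ev_simps:
  assumes "\<bar>t\<bar> \<le> 1"
  shows "ev t 0 = 0" "ev t (a + b) = ev t a + ev t b" "ev t (a - b) = ev t a - ev t b"
    "ev t (c *\<^sub>R a) = c * ev t a" "ev t (- a) = - ev t a" "ev t (a * b) = ev t a * ev t b"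
    "ev t 1 = 1" "ev t (a ^ m) = ev t a ^ m"
proof -
  interpret bounded_linear "ev t" by (rule bounded_linear_ev [OF assms])
  show "ev t 0 = 0" "ev t (a + b) = ev t a + ev t b" "ev t (a - b) = ev t a - ev t b"
    "ev t (c *\<^sub>R a) = c * ev t a" "ev t (- a) = - ev t a"
    by (simp_all add: add diff scaleR neg zero)
  show *: "ev t (a * b) = ev t a * ev t b" for a b by (rule ev_mult [OF assms])
  have "(\<lambda>n. cf 1 n 0 0 * t ^ n) = (\<lambda>n. if n = 0 then 1 else 0)"
    by (auto simp: fun_eq_iff jco_def)
  then show 1: "ev t 1 = 1" unfolding ev_def using suminf_finite [of "{0}" "\<lambda>n. if n = (0::nat) then 1 else (0::real)"] by simp
  show "ev t (a ^ m) = ev t a ^ m"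
    by (induction m) (simp_all add: 1 *)
qed

section \<open>Truncated jets, the variable y, division by y, and coefficient multipliers\<close>

definition tr :: "nat \<Rightarrow> real fps fps \<Rightarrow> real fps fps" where
  "tr k g = Abs_fps (\<lambda>i. Abs_fps (\<lambda>j. if i + j \<le> k then jco g i j else 0))"

lemma jco_tr [simp]: "jco (tr k g) i j = (if i + j \<le> k then jco g i j else 0)"
  by (simp add: tr_def jco_def)

definition jets :: "(nat \<Rightarrow> nat \<Rightarrow> real) \<Rightarrow> real fps fps" where
  "jets J = Abs_fps (\<lambda>i. Abs_fps (J i))"

lemma jco_jets [simp]: "jco (jets J) i j = J i j"
  by (simp add: jets_def jco_def)

definition cj :: "nat \<Rightarrow> (nat \<Rightarrow> nat \<Rightarrow> real) \<Rightarrow> jalg" where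
  "cj k J = mk (\<lambda>n. if n = 0 then tr k (jets J) else 0)"

text \<open>All weights at \<open>n = 0\<close> equal 1, so for functions of the parameters alone
  the weight gives no gain; their smallness must come from the entries.\<close>

lemma wS_cj: "wS N (\<lambda>n. jco (if n = 0 then tr k (jets J) else 0)) \<le> (\<Sum>i\<le>k. \<Sum>j\<le>k. \<bar>J i j\<bar>)"
proof -
  have "wS N (\<lambda>n. jco (if n = 0 then tr k (jets J) else 0)) =
     (\<Sum>n\<le>N. if n = 0 then (\<Sum>i\<le>N. \<Sum>j\<le>N. \<bar>jco (tr k (jets J)) i j\<bar>) else 0)"
    unfolding wS_def by (intro sum.cong) auto
  also have "\<dots> = (\<Sum>i\<le>N. \<Sum>j\<le>N. \<bar>jco (tr k (jets J)) i j\<bar>)"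
    by simp
  also have "\<dots> = (\<Sum>(i,j)\<in>{..N}\<times>{..N}. \<bar>jco (tr k (jets J)) i j\<bar>)"
    by (rule sum.cartesian_product)
  also have "\<dots> = (\<Sum>(i,j)\<in>({..N}\<times>{..N}) \<inter> ({..k}\<times>{..k}). \<bar>jco (tr k (jets J)) i j\<bar>)"
    by (rule sum.mono_neutral_right) (auto split: if_splits)
  also have "\<dots> \<le> (\<Sum>(i,j)\<in>({..N}\<times>{..N}) \<inter> ({..k}\<times>{..k}). \<bar>J i j\<bar>)"
    by (rule sum_mono) auto
  also have "\<dots> \<le> (\<Sum>(i,j)\<in>{..k}\<times>{..k}. \<bar>J i j\<bar>)"
    by (rule sum_mono2) auto
  also have "\<dots> = (\<Sum>i\<le>k. \<Sum>j\<le>k. \<bar>J i j\<bar>)"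
    by (rule sum.cartesian_product [symmetric])
  finally show ?thesis .
qed

lemma co_cj: "co (cj k J) n = (if n = 0 then tr k (jets J) else 0)"
  unfolding cj_def by (rule co_mk [OF wS_cj])

lemma norm_cj: "norm (cj k J) \<le> (\<Sum>i\<le>k. \<Sum>j\<le>k. \<bar>J i j\<bar>)"
  unfolding cj_def by (rule norm_mk [OF wS_cj])

lemma ev_cj: "ev t (cj k J) = J 0 0"
proof -
  have "(\<lambda>n. cf (cj k J) n 0 0 * t ^ n) = (\<lambda>n. if n = 0 then J 0 0 else 0)"
    by (auto simp: fun_eq_iff co_cj)
  then show ?thesis
    unfolding ev_def using suminf_finite [of "{0}" "\<lambda>n. if n = (0::nat) then J 0 0 else (0::real)"] by simp
qed

definition yv :: jalg where "yv = mk (\<lambda>n. if n = 1 then 1 else 0)"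

lemma wS_yv: "wS N (\<lambda>n. jco (if n = 1 then 1 else 0)) \<le> 1"
proof -
  have "(\<lambda>n. jco (if n = Suc 0 then 1 else 0)) = (\<lambda>n i j. if n = Suc 0 \<and> i = 0 \<and> j = 0 then 1 else 0)"
    by (auto simp: fun_eq_iff jco_def)
  then show ?thesis using wS_monomial [of N 1 0 0 1] by simp
qed

lemma co_yv: "co yv n = (if n = 1 then 1 else 0)"
  unfolding yv_def by (rule co_mk [OF wS_yv])

lemma norm_yv: "norm yv \<le> 1"
  unfolding yv_def by (rule norm_mk [OF wS_yv])

lemma ev_yv: "ev t yv = t"
proof -
  have "(\<lambda>n. cf yv n 0 0 * t ^ n) = (\<lambda>n. if n = 1 then t else 0)"
    by (auto simp: fun_eq_iff co_yv jco_def)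
  then show ?thesis
    unfolding ev_def using suminf_finite [of "{1}" "\<lambda>n. if n = (1::nat) then t else (0::real)"] by simp
qed

text \<open>Dropping the constant term and dividing by \<open>y\<close> is bounded only on jets of bounded order, because
  the weights of neighbouring powers of \<open>y\<close> differ by the factor \<open>2^m\<close> at order \<open>m\<close>.\<close>

definition sh :: "nat \<Rightarrow> jalg \<Rightarrow> jalg" where
  "sh k a = mk (\<lambda>n. tr k (co a (Suc n)))"

lemma wS_sh: "wS N (\<lambda>n. jco (tr k (co a (Suc n)))) \<le> 2 ^ k * norm a"
proof -
  \<comment> \<open>Shifting the index by one leaves the cube of size \<open>N\<close>; the
    comparison is therefore made with the cube of size \<open>Suc N\<close>.\<close>
  define G where "G n = (\<Sum>i\<le>Suc N. \<Sum>j\<le>Suc N. \<bar>cf a n i j\<bar> * wt n (i + j))" for n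
  have G: "0 \<le> G n" for n unfolding G_def by (intro sum_nonneg) auto
  have w: "\<bar>jco (tr k (co a (Suc n))) i j\<bar> * wt n (i + j) \<le> 2 ^ k * (\<bar>cf a (Suc n) i j\<bar> * wt (Suc n) (i + j))" for n i j
  proof (cases "i + j \<le> k")
    case True
    then have "(2::real) ^ (i + j) \<le> 2 ^ k" by (intro power_increasing) auto
    then have "wt n (i + j) \<le> 2 ^ k * wt (Suc n) (i + j)"
      by (simp add: power_add power_one_over field_simps)
    then have "\<bar>cf a (Suc n) i j\<bar> * wt n (i + j) \<le> \<bar>cf a (Suc n) i j\<bar> * (2 ^ k * wt (Suc n) (i + j))"
      by (rule mult_left_mono) auto
    then show ?thesis using True by (simp only: jco_tr if_True mult.left_commute)
  qed auto
  have "wS N (\<lambda>n. jco (tr k (co a (Suc n)))) \<le> (\<Sum>n\<le>N. \<Sum>i\<le>N. \<Sum>j\<le>N. 2 ^ k * (\<bar>cf a (Suc n) i j\<bar> * wt (Suc n) (i + j)))"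
    unfolding wS_def by (intro sum_mono w)
  also have "\<dots> = (\<Sum>n\<le>N. 2 ^ k * (\<Sum>i\<le>N. \<Sum>j\<le>N. \<bar>cf a (Suc n) i j\<bar> * wt (Suc n) (i + j)))"
    by (simp add: sum_distrib_left)
  also have "\<dots> \<le> (\<Sum>n\<le>N. 2 ^ k * G (Suc n))"
  proof (intro sum_mono mult_left_mono)
    fix n
    have "(\<Sum>i\<le>N. \<Sum>j\<le>N. \<bar>cf a (Suc n) i j\<bar> * wt (Suc n) (i + j)) \<le>
      (\<Sum>i\<le>N. \<Sum>j\<le>Suc N. \<bar>cf a (Suc n) i j\<bar> * wt (Suc n) (i + j))"
      by (intro sum_mono) simp
    also have "\<dots> \<le> G (Suc n)" unfolding G_def by (rule sum_mono2) (auto intro!: add_nonneg_nonneg sum_nonneg)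
    finally show "(\<Sum>i\<le>N. \<Sum>j\<le>N. \<bar>cf a (Suc n) i j\<bar> * wt (Suc n) (i + j)) \<le> G (Suc n)" .
  qed auto
  also have "\<dots> = 2 ^ k * (\<Sum>n\<le>N. G (Suc n))" by (simp add: sum_distrib_left)
  also have "\<dots> \<le> 2 ^ k * (\<Sum>n\<le>Suc N. G n)"
    by (intro mult_left_mono) (auto simp only: sum.atMost_Suc_shift G, use G [of 0] in auto)
  also have "(\<Sum>n\<le>Suc N. G n) = wS (Suc N) (cf a)"
    by (simp only: wS_def G_def)
  also have "2 ^ k * wS (Suc N) (cf a) \<le> 2 ^ k * norm a"
    by (intro mult_left_mono wS_le_norm) auto
  finally show ?thesis .
qed

lemma co_sh: "co (sh k a) n = tr k (co a (Suc n))"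
  unfolding sh_def by (rule co_mk [OF wS_sh])

lemma bounded_linear_sh: "bounded_linear (sh k)"
proof (rule bounded_linear_intro [of _ "2 ^ k"])
  show "norm (sh k a) \<le> norm a * 2 ^ k" for a
    unfolding sh_def using norm_mk [OF wS_sh] by (simp add: mult.commute)
qed (auto intro!: jalg_eqI simp: co_sh)

lemma norm_sh: "norm (sh k a) \<le> 2 ^ k * norm a"
  unfolding sh_def by (rule norm_mk [OF wS_sh])

text \<open>The series \<open>q a'\<close> with its \<open>n\<close>-th coefficient divided by \<open>n + 1\<close> is \<open>wm q (sh k a)\<close>. The factor \<open>n + 1\<close>
  is given back to the resolvent in \<open>mU\<close> and \<open>mV\<close> below.\<close>

definition wmc :: "jalg \<Rightarrow> jalg \<Rightarrow> nat \<Rightarrow> real fps fps" where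
  "wmc q b n = (\<Sum>m\<le>n. fps_const (fps_const (real (Suc (n - m)) / real (Suc n))) * (co q m * co b (n - m)))"

definition wm :: "jalg \<Rightarrow> jalg \<Rightarrow> jalg" where "wm q b = mk (wmc q b)"

lemma jco_const_mult [simp]: "jco (fps_const (fps_const c) * g) i j = c * jco g i j"
  by (simp add: jco_def)

lemma jco_wmc: "jco (wmc q b n) i j =
    (\<Sum>m\<le>n. real (Suc (n - m)) / real (Suc n) * (\<Sum>i'\<le>i. \<Sum>j'\<le>j. cf q m i' j' * cf b (n - m) (i - i') (j - j')))"
  by (simp only: wmc_def jco_sum jco_const_mult) (simp only: jco_mult)

text \<open>The quotients (n - m + 1)/(n + 1) lie between 0 and 1, so the series is dominated by the
  ordinary convolution.\<close>

lemma wS_wmc: "wS N (\<lambda>n. jco (wmc q b n)) \<le> norm q * norm b"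
proof -
  have "wS N (\<lambda>n. jco (wmc q b n)) \<le> wS N (cf q) * wS N (cf b)"
  proof (rule wS_convolution)
    fix n i j
    have "\<bar>jco (wmc q b n) i j\<bar> \<le> (\<Sum>m\<le>n. \<bar>real (Suc (n - m)) / real (Suc n) * (\<Sum>i'\<le>i. \<Sum>j'\<le>j. cf q m i' j' * cf b (n - m) (i - i') (j - j'))\<bar>)"
      unfolding jco_wmc by (rule sum_abs)
    also have "\<dots> \<le> (\<Sum>m\<le>n. 1 * \<bar>\<Sum>i'\<le>i. \<Sum>j'\<le>j. cf q m i' j' * cf b (n - m) (i - i') (j - j')\<bar>)"
      unfolding abs_mult by (intro sum_mono mult_right_mono) (auto simp: divide_simps)
    also have "\<dots> \<le> (\<Sum>m\<le>n. 1 * (\<Sum>i'\<le>i. \<Sum>j'\<le>j. \<bar>cf q m i' j' * cf b (n - m) (i - i') (j - j')\<bar>))"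
      by (intro sum_mono mult_left_mono order_trans [OF sum_abs] order_refl) auto
    finally show "\<bar>jco (wmc q b n) i j\<bar> \<le> (\<Sum>m\<le>n. \<Sum>i'\<le>i. \<Sum>j'\<le>j. \<bar>cf q m i' j'\<bar> * \<bar>cf b (n - m) (i - i') (j - j')\<bar>)"
      by (simp add: abs_mult)
  qed
  also have "\<dots> \<le> norm q * norm b" by (intro mult_mono wS_le_norm wS_nonneg norm_ge_zero)
  finally show ?thesis .
qed

lemma co_wm: "co (wm q b) n = wmc q b n"
  unfolding wm_def by (rule co_mk [OF wS_wmc])

lemma bounded_bilinear_wm: "bounded_bilinear wm"
proof
  fix a a' b b' :: jalg and c :: real
  show "wm (a + a') b = wm a b + wm a' b" "wm a (b + b') = wm a b + wm a b'"
    "wm (c *\<^sub>R a) b = c *\<^sub>R wm a b" "wm a (c *\<^sub>R b) = c *\<^sub>R wm a b"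
    by (intro jalg_eqI; simp add: co_wm jco_wmc algebra_simps sum.distrib sum_distrib_left)+
  show "\<exists>K. \<forall>a b. norm (wm a b) \<le> norm a * norm b * K"
    by (intro exI [of _ 1]) (simp add: wm_def norm_mk [OF wS_wmc])
qed

lemma norm_wm: "norm (wm q b) \<le> norm q * norm b"
  unfolding wm_def by (rule norm_mk [OF wS_wmc])

text \<open>The multipliers of the linear part depend on r but not on mu2, so their jets live in the
  first increment only and \<open>M n i\<close> needs a single order index.\<close>

definition MJ :: "(nat \<Rightarrow> nat \<Rightarrow> real) \<Rightarrow> nat \<Rightarrow> real fps fps" where
  "MJ M n = Abs_fps (\<lambda>i. fps_const (M n i))"

lemma jco_MJ: "jco (MJ M n) i j = (if j = 0 then M n i else 0)"
  by (simp add: MJ_def jco_def)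

definition Mop :: "(nat \<Rightarrow> nat \<Rightarrow> real) \<Rightarrow> jalg \<Rightarrow> jalg" where
  "Mop M a = mk (\<lambda>n. MJ M n * co a n)"

definition mult_bd :: "real \<Rightarrow> (nat \<Rightarrow> nat \<Rightarrow> real) \<Rightarrow> bool" where
  "mult_bd K M \<longleftrightarrow> (\<forall>n N. (\<Sum>i\<le>N. \<bar>M n i\<bar> * wt n i) \<le> K)"

lemma jco_MJ_mult: "jco (MJ M n * g) i j = (\<Sum>i'\<le>i. M n i' * jco g (i - i') j)"
proof -
  have "(\<Sum>j'\<le>j. jco (MJ M n) i' j' * jco g (i - i') (j - j')) = M n i' * jco g (i - i') j" for i'
  proof -
    have "(\<Sum>j'\<le>j. jco (MJ M n) i' j' * jco g (i - i') (j - j')) = (\<Sum>j'\<le>j. if j' = 0 then M n i' * jco g (i - i') j else 0)"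
      by (intro sum.cong) (auto simp: jco_MJ)
    then show ?thesis by simp
  qed
  then show ?thesis by (simp add: jco_mult)
qed

text \<open>A multiplier acts at a fixed power of y, where the exponent n (i + j) splits exactly.
  Hence the operator norm is the supremum over n of weighted l1 norms of single jets, which is what
  \<open>mult_bd\<close> bounds.\<close>

lemma wS_Mop:
  assumes "mult_bd K M"
  shows "wS N (\<lambda>n. jco (MJ M n * co a n)) \<le> K * norm a"
proof -
  have K: "(\<Sum>i\<le>N. \<bar>M n i\<bar> * wt n i) \<le> K" for n using assms by (simp add: mult_bd_def)
  have "wS N (\<lambda>n. jco (MJ M n * co a n)) \<le>
    (\<Sum>n\<le>N. \<Sum>i\<le>N. \<Sum>i'\<le>i. (\<bar>M n i'\<bar> * wt n i') * (\<Sum>j\<le>N. \<bar>cf a n (i - i') j\<bar> * wt n ((i - i') + j)))"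
    unfolding wS_def
  proof (intro sum_mono)
    fix n i
    have "(\<Sum>j\<le>N. \<bar>jco (MJ M n * co a n) i j\<bar> * wt n (i + j)) \<le>
      (\<Sum>j\<le>N. (\<Sum>i'\<le>i. \<bar>M n i'\<bar> * \<bar>cf a n (i - i') j\<bar>) * wt n (i + j))"
      unfolding jco_MJ_mult abs_mult [symmetric]
      by (intro sum_mono mult_right_mono sum_abs) auto
    also have "\<dots> = (\<Sum>j\<le>N. \<Sum>i'\<le>i. (\<bar>M n i'\<bar> * wt n i') * (\<bar>cf a n (i - i') j\<bar> * wt n ((i - i') + j)))"
      unfolding sum_distrib_right
    proof (intro sum.cong refl)
      fix j i' assume "i' \<in> {..i}"
      then have "n * (i + j) = n * i' + n * (i - i' + j)"
        by (simp add: algebra_simps flip: distrib_left)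
      then have "wt n (i + j) = wt n i' * wt n ((i - i') + j)"
        by (simp only: power_add)
      then show "\<bar>M n i'\<bar> * \<bar>cf a n (i - i') j\<bar> * wt n (i + j) = (\<bar>M n i'\<bar> * wt n i') * (\<bar>cf a n (i - i') j\<bar> * wt n ((i - i') + j))"
        by (simp only: mult_ac)
    qed
    also have "\<dots> = (\<Sum>i'\<le>i. (\<bar>M n i'\<bar> * wt n i') * (\<Sum>j\<le>N. \<bar>cf a n (i - i') j\<bar> * wt n ((i - i') + j)))"
      by (subst sum.swap) (simp only: sum_distrib_left)
    finally show "(\<Sum>j\<le>N. \<bar>jco (MJ M n * co a n) i j\<bar> * wt n (i + j)) \<le> \<dots>" .
  qed
  also have "\<dots> \<le> (\<Sum>n\<le>N. (\<Sum>i\<le>N. \<bar>M n i\<bar> * wt n i) * (\<Sum>i\<le>N. \<Sum>j\<le>N. \<bar>cf a n i j\<bar> * wt n (i + j)))"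
    by (intro sum_mono sum_convolution_le sum_nonneg) auto
  also have "\<dots> \<le> (\<Sum>n\<le>N. K * (\<Sum>i\<le>N. \<Sum>j\<le>N. \<bar>cf a n i j\<bar> * wt n (i + j)))"
    by (intro sum_mono mult_right_mono K sum_nonneg) auto
  also have "\<dots> = K * wS N (cf a)" by (simp add: wS_def sum_distrib_left)
  also have "\<dots> \<le> K * norm a"
  proof (intro mult_left_mono wS_le_norm)
    show "0 \<le> K" using K [of 0] by (rule order_trans [rotated]) (auto intro: sum_nonneg)
  qed
  finally show ?thesis .
qed

lemma co_Mop: "mult_bd K M \<Longrightarrow> co (Mop M a) n = MJ M n * co a n"
  unfolding Mop_def by (rule co_mk [OF wS_Mop])

lemma norm_Mop: "mult_bd K M \<Longrightarrow> norm (Mop M a) \<le> K * norm a"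
  unfolding Mop_def by (rule norm_mk [OF wS_Mop])

lemma bounded_linear_Mop:
  assumes "mult_bd K M" shows "bounded_linear (Mop M)"
proof (rule bounded_linear_intro [of _ K])
  show "norm (Mop M a) \<le> norm a * K" for a using norm_Mop [OF assms] by (simp add: mult.commute)
  fix a b :: jalg and r :: real
  show "Mop M (a + b) = Mop M a + Mop M b"
    by (intro jalg_eqI) (simp add: co_Mop [OF assms] distrib_left)
  show "Mop M (r *\<^sub>R a) = r *\<^sub>R Mop M a"
    by (intro jalg_eqI, simp add: co_Mop [OF assms] jco_MJ_mult, simp add: sum_distrib_left mult.left_commute)
qed

lemma cf_Mop00: "mult_bd K M \<Longrightarrow> cf (Mop M a) n 0 0 = M n 0 * cf a n 0 0"
  by (simp add: co_Mop jco_MJ_mult)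

lemma cf_wm_sh00: "cf (wm q (sh k a)) n 0 0 =
    (\<Sum>m\<le>n. cf q m 0 0 * (real (Suc (n - m)) * cf a (Suc (n - m)) 0 0)) / real (Suc n)"
  by (simp add: co_wm jco_wmc co_sh sum_divide_distrib mult_ac)

section \<open>Jets of differentiable functions\<close>

text \<open>Formal derivatives in the two increments. On Taylor jets they produce the jets of the
  partial derivatives, and since they are derivations, the product rule for all orders becomes one
  identity in the ring.\<close>

definition d1 :: "real fps fps \<Rightarrow> real fps fps" where "d1 g = fps_deriv g"
definition d2 :: "real fps fps \<Rightarrow> real fps fps" where "d2 g = Abs_fps (\<lambda>i. fps_deriv (fps_nth g i))"

lemma jco_d1: "jco (d1 g) i j = real (Suc i) * jco g (Suc i) j"
proof -
  have "(of_nat m :: real fps) = fps_const (real m)" for m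
    by (simp add: fps_of_nat)
  then show ?thesis by (simp add: jco_def d1_def del: of_nat_Suc)
qed

lemma jco_d2: "jco (d2 g) i j = real (Suc j) * jco g i (Suc j)"
  by (simp add: jco_def d2_def)

lemma d1_mult: "d1 (g * h) = d1 g * h + g * d1 h"
  by (simp add: d1_def)

lemma d2_mult: "d2 (g * h) = d2 g * h + g * d2 h"
  by (rule fps_ext) (simp add: d2_def fps_mult_nth fps_deriv_sum sum.distrib)

abbreviation has_partials ::
    "(real \<times> real \<Rightarrow> real) \<Rightarrow> real \<Rightarrow> real \<Rightarrow> real \<times> real \<Rightarrow> (real \<times> real) set \<Rightarrow> bool" where
  "has_partials f a b p S \<equiv> (f has_derivative (\<lambda>v. fst v * a + snd v * b)) (at p within S)"

text \<open>The jet variables are scaled by \<open>e\<close>: the entry \<open>(i, j)\<close> stands for \<open>e^(i + j) / (i! j!)\<close> times a partial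
  derivative.\<close>

definition jc :: "nat \<Rightarrow> real \<Rightarrow> (real \<times> real) set \<Rightarrow> (real \<times> real \<Rightarrow> real fps fps) \<Rightarrow> bool" where
  "jc k e S g \<longleftrightarrow>
     (\<forall>i j. i + j \<le> k \<longrightarrow> continuous_on S (\<lambda>p. jco (g p) i j)) \<and>
     (\<forall>i j. \<forall>p\<in>S. i + j < k \<longrightarrow>
        ((\<lambda>p. jco (g p) i j) has_derivative
         (\<lambda>v. (fst v * jco (d1 (g p)) i j + snd v * jco (d2 (g p)) i j) / e)) (at p within S))"

lemma jc_cont: "jc k e S g \<Longrightarrow> i + j \<le> k \<Longrightarrow> continuous_on S (\<lambda>p. jco (g p) i j)"
  by (simp add: jc_def)

lemma jc_deriv: "jc k e S g \<Longrightarrow> i + j < k \<Longrightarrow> p \<in> S \<Longrightarrow>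
  ((\<lambda>p. jco (g p) i j) has_derivative
         (\<lambda>v. (fst v * jco (d1 (g p)) i j + snd v * jco (d2 (g p)) i j) / e)) (at p within S)"
  by (simp add: jc_def)

lemma jc_add:
  assumes "jc k e S g" "jc k e S h" shows "jc k e S (\<lambda>p. g p + h p)"
  unfolding jc_def
proof (intro conjI allI impI ballI)
  fix i j assume "i + j \<le> k"
  then show "continuous_on S (\<lambda>p. jco (g p + h p) i j)"
    using assms by (auto intro!: continuous_intros jc_cont)
next
  fix i j p assume p: "p \<in> S" "i + j < k"
  show "((\<lambda>p. jco (g p + h p) i j) has_derivative
          (\<lambda>v. (fst v * jco (d1 (g p + h p)) i j + snd v * jco (d2 (g p + h p)) i j) / e)) (at p within S)"
    using has_derivative_add [OF jc_deriv [OF assms(1) p(2,1)] jc_deriv [OF assms(2) p(2,1)]]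
    by (simp add: jco_d1 jco_d2 algebra_simps add_divide_distrib)
qed

lemma jc_const_mult:
  assumes "jc k e S g" shows "jc k e S (\<lambda>p. fps_const (fps_const c) * g p)"
  unfolding jc_def
proof (intro conjI allI impI ballI)
  fix i j assume "i + j \<le> k"
  then show "continuous_on S (\<lambda>p. jco (fps_const (fps_const c) * g p) i j)"
    using assms by (auto intro!: continuous_intros jc_cont)
next
  fix i j p assume p: "p \<in> S" "i + j < k"
  show "((\<lambda>p. jco (fps_const (fps_const c) * g p) i j) has_derivative
          (\<lambda>v. (fst v * jco (d1 (fps_const (fps_const c) * g p)) i j + snd v * jco (d2 (fps_const (fps_const c) * g p)) i j) / e)) (at p within S)"
    using has_derivative_mult_right [OF jc_deriv [OF assms(1) p(2,1)], of c]
    unfolding jco_d1 jco_d2 jco_const_mult by (simp add: algebra_simps add_divide_distrib)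
qed

lemma jc_zero: "jc k e S (\<lambda>p. 0)"
  by (simp add: jc_def jco_d1 jco_d2)

lemma jc_sum:
  assumes "\<And>x. x \<in> A \<Longrightarrow> jc k e S (g x)" shows "jc k e S (\<lambda>p. \<Sum>x\<in>A. g x p)"
  using assms by (induction A rule: infinite_finite_induct) (auto intro: jc_zero jc_add)

text \<open>Differentiating the convolution termwise yields the entries of
  \<open>d1 g * h + g * d1 h\<close> and its analogue for \<open>d2\<close>. As the factorials are
  part of the jets, no binomial coefficients appear.\<close>

lemma jc_mult:
  assumes "jc k e S g" "jc k e S h" shows "jc k e S (\<lambda>p. g p * h p)"
  unfolding jc_def
proof (intro conjI allI impI ballI)
  fix i j assume "i + j \<le> k"
  then show "continuous_on S (\<lambda>p. jco (g p * h p) i j)"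
    unfolding jco_mult by (intro continuous_intros jc_cont [OF assms(1)] jc_cont [OF assms(2)]) auto
next
  fix i j p assume p: "p \<in> S" "i + j < k"
  let ?g = "\<lambda>i j v. (fst v * jco (d1 (g p)) i j + snd v * jco (d2 (g p)) i j) / e"
  let ?h = "\<lambda>i j v. (fst v * jco (d1 (h p)) i j + snd v * jco (d2 (h p)) i j) / e"
  have "((\<lambda>p. jco (g p * h p) i j) has_derivative
      (\<lambda>v. \<Sum>i'\<le>i. \<Sum>j'\<le>j. jco (g p) i' j' * ?h (i - i') (j - j') v + ?g i' j' v * jco (h p) (i - i') (j - j')))
      (at p within S)"
    unfolding jco_mult
    using p by (intro has_derivative_sum has_derivative_mult jc_deriv [OF assms(1)] jc_deriv [OF assms(2)]) auto
  moreover have "(\<Sum>i'\<le>i. \<Sum>j'\<le>j. jco (g p) i' j' * ?h (i - i') (j - j') v + ?g i' j' v * jco (h p) (i - i') (j - j'))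
     = (fst v * jco (d1 (g p * h p)) i j + snd v * jco (d2 (g p * h p)) i j) / e" for v
    unfolding d1_mult d2_mult jco_simps jco_mult
    by (simp add: sum_distrib_left sum_divide_distrib sum.distrib [symmetric] add_divide_distrib algebra_simps)
  ultimately show "((\<lambda>p. jco (g p * h p) i j) has_derivative
          (\<lambda>v. (fst v * jco (d1 (g p * h p)) i j + snd v * jco (d2 (g p * h p)) i j) / e)) (at p within S)"
    by simp
qed

text \<open>Differentiability is required only of entries of order below \<open>k\<close>; the
  derivative then has order at most \<open>k\<close> and survives the truncation.\<close>

lemma jc_tr:
  assumes "jc k e S g" shows "jc k e S (\<lambda>p. tr k (g p))"
  unfolding jc_def
proof (intro conjI allI impI ballI)
  fix i j assume "i + j \<le> k"
  then show "continuous_on S (\<lambda>p. jco (tr k (g p)) i j)"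
    using assms by (auto intro!: continuous_intros jc_cont)
next
  fix i j p assume p: "p \<in> S" "i + j < k"
  show "((\<lambda>p. jco (tr k (g p)) i j) has_derivative
          (\<lambda>v. (fst v * jco (d1 (tr k (g p))) i j + snd v * jco (d2 (tr k (g p))) i j) / e)) (at p within S)"
    using jc_deriv [OF assms(1) p(2,1)] p by (simp add: jco_d1 jco_d2)
qed

text \<open>The derivatives of entries of order below \<open>k\<close> are themselves combinations
  of entries, so they converge uniformly too, and on a convex set the limit may be differentiated
  termwise.\<close>

lemma jc_limit:
  assumes "convex S" and g: "\<And>N. jc k e S (g N)" and "e > 0"
    and lim: "\<And>i j. uniform_limit S (\<lambda>N p. jco (g N p) i j) (\<lambda>p. jco (G p) i j) sequentially"
  shows "jc k e S G"
  unfolding jc_def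
proof (intro conjI allI impI ballI)
  fix i j assume "i + j \<le> k"
  then show "continuous_on S (\<lambda>p. jco (G p) i j)"
    using g by (intro uniform_limit_theorem [OF _ lim]) (auto intro!: always_eventually jc_cont)
next
  fix i j p assume p: "p \<in> S" "i + j < k"
  let ?D = "\<lambda>G p v. (fst v * jco (d1 (G p)) i j + snd v * jco (d2 (G p)) i j) / e"
  have "\<exists>f. \<forall>x\<in>S. (\<lambda>n. jco (g n x) i j) \<longlonglongrightarrow> f x \<and> (f has_derivative ?D G x) (at x within S)"
  proof (rule has_derivative_sequence [OF \<open>convex S\<close> _ _ p(1)])
    show "\<And>n x. x \<in> S \<Longrightarrow> ((\<lambda>x. jco (g n x) i j) has_derivative ?D (g n) x) (at x within S)"
      by (rule jc_deriv [OF g p(2)])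
    show "(\<lambda>n. jco (g n p) i j) \<longlonglongrightarrow> jco (G p) i j"
      using tendsto_uniform_limitI [OF lim p(1)] .
    fix d :: real assume "d > 0"
    \<comment> \<open>The two partial derivatives carry the factors i + 1 and j + 1 and the unit
      1/e; with this choice they add up to d/2.\<close>
    define d' where "d' = d * e / (2 * (real (Suc i) + real (Suc j)))"
    have "d' > 0" using \<open>d > 0\<close> \<open>e > 0\<close> by (simp add: d'_def)
    have "\<forall>\<^sub>F n in sequentially. \<forall>x\<in>S. dist (jco (g n x) (Suc i) j) (jco (G x) (Suc i) j) < d'"
         "\<forall>\<^sub>F n in sequentially. \<forall>x\<in>S. dist (jco (g n x) i (Suc j)) (jco (G x) i (Suc j)) < d'"
      using lim \<open>d' > 0\<close> by (auto simp: uniform_limit_iff)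
    then show "\<forall>\<^sub>F n in sequentially. \<forall>x\<in>S. \<forall>h. norm (?D (g n) x h - ?D G x h) \<le> d * norm h"
    proof eventually_elim
      case (elim n)
      show ?case
      proof (intro ballI allI)
        fix x and h :: "real \<times> real" assume "x \<in> S"
        define A where "A = jco (g n x) (Suc i) j - jco (G x) (Suc i) j"
        define B where "B = jco (g n x) i (Suc j) - jco (G x) i (Suc j)"
        have AB: "\<bar>A\<bar> \<le> d'" "\<bar>B\<bar> \<le> d'" using elim \<open>x \<in> S\<close> by (force simp: A_def B_def dist_real_def)+
        have h: "\<bar>fst h\<bar> \<le> norm h" "\<bar>snd h\<bar> \<le> norm h"
          using norm_fst_le [of "fst h" "snd h"] norm_snd_le [of "snd h" "fst h"] by simp_all
        have "?D (g n) x h - ?D G x h = (fst h * real (Suc i) * A + snd h * real (Suc j) * B) / e"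
          unfolding jco_d1 jco_d2 A_def B_def diff_divide_distrib [symmetric]
          by (simp add: algebra_simps del: of_nat_Suc)
        then have "norm (?D (g n) x h - ?D G x h) = \<bar>fst h * real (Suc i) * A + snd h * real (Suc j) * B\<bar> / e"
          using \<open>e > 0\<close> by simp
        also have "\<dots> \<le> (\<bar>fst h\<bar> * real (Suc i) * \<bar>A\<bar> + \<bar>snd h\<bar> * real (Suc j) * \<bar>B\<bar>) / e"
          using \<open>e > 0\<close> by (intro divide_right_mono order_trans [OF abs_triangle_ineq]) (simp_all add: abs_mult)
        also have "\<dots> \<le> (norm h * real (Suc i) * d' + norm h * real (Suc j) * d') / e"
          using \<open>e > 0\<close> AB h by (intro divide_right_mono add_mono mult_mono) auto
        also have "\<dots> = d' * (real (Suc i) + real (Suc j)) / e * norm h"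
          by (simp add: algebra_simps)
        also have "d' * (real (Suc i) + real (Suc j)) / e = d / 2"
        proof -
          have *: "d * e / (2 * s) * s / e = d / 2" if "s \<noteq> 0" for s
            using that \<open>e > 0\<close> by (simp add: field_simps)
          show ?thesis unfolding d'_def by (rule *) simp
        qed
        also have "d / 2 * norm h \<le> d * norm h" using \<open>d > 0\<close> by (intro mult_right_mono) auto
        finally show "norm (?D (g n) x h - ?D G x h) \<le> d * norm h" .
      qed
    qed
  qed
  then obtain f where f: "\<And>x. x \<in> S \<Longrightarrow> (\<lambda>n. jco (g n x) i j) \<longlonglongrightarrow> f x"
    "\<And>x. x \<in> S \<Longrightarrow> (f has_derivative ?D G x) (at x within S)" by blast
  have fG: "jco (G x) i j = f x" if "x \<in> S" for x
    using LIMSEQ_unique [OF tendsto_uniform_limitI [OF lim that] f(1) [OF that]] .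
  show "((\<lambda>p. jco (G p) i j) has_derivative ?D G p) (at p within S)"
    by (rule has_derivative_transform [OF p(1) fG f(2) [OF p(1)]])
qed

section \<open>Parameter-dependent elements of the algebra whose entries are true
  derivatives\<close>

definition jcB :: "nat \<Rightarrow> real \<Rightarrow> (real \<times> real) set \<Rightarrow> (real \<times> real \<Rightarrow> jalg) \<Rightarrow> bool" where
  "jcB k e S a \<longleftrightarrow> (\<forall>n. jc k e S (\<lambda>p. co (a p) n))"

lemma jcB_D: "jcB k e S a \<Longrightarrow> jc k e S (\<lambda>p. co (a p) n)"
  by (simp add: jcB_def)

lemma jcB_add: "jcB k e S a \<Longrightarrow> jcB k e S b \<Longrightarrow> jcB k e S (\<lambda>p. a p + b p)"
  by (simp add: jcB_def jc_add)

lemma co_scaleR: "co (c *\<^sub>R a) n = fps_const (fps_const c) * co a n"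
  by (rule jet_eqI) simp

lemma jcB_scaleR: "jcB k e S a \<Longrightarrow> jcB k e S (\<lambda>p. c *\<^sub>R a p)"
  by (simp add: jcB_def co_scaleR jc_const_mult)

lemma jcB_diff:
  assumes "jcB k e S a" "jcB k e S b" shows "jcB k e S (\<lambda>p. a p - b p)"
  using jcB_add [OF assms(1) jcB_scaleR [OF assms(2), of "-1"]] by simp

lemma jcB_mult: "jcB k e S a \<Longrightarrow> jcB k e S b \<Longrightarrow> jcB k e S (\<lambda>p. a p * b p)"
  by (simp add: jcB_def co_mult jc_sum jc_mult)

lemma jcB_const:
  assumes "\<And>n i j. i \<noteq> 0 \<or> j \<noteq> 0 \<Longrightarrow> cf a n i j = 0" shows "jcB k e S (\<lambda>p. a)"
  using assms by (simp add: jcB_def jc_def jco_d1 jco_d2)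

lemma jcB_zero: "jcB k e S (\<lambda>p. 0)"
  by (rule jcB_const) simp

lemma jcB_one: "jcB k e S (\<lambda>p. 1)"
  by (rule jcB_const) (auto simp: jco_def)

lemma jcB_yv: "jcB k e S (\<lambda>p. yv)"
  by (rule jcB_const) (auto simp: co_yv jco_def)

lemma jcB_sum:
  assumes "\<And>x. x \<in> A \<Longrightarrow> jcB k e S (a x)" shows "jcB k e S (\<lambda>p. \<Sum>x\<in>A. a x p)"
  using assms by (induction A rule: infinite_finite_induct) (auto intro: jcB_zero jcB_add)

lemma jcB_power: "jcB k e S a \<Longrightarrow> jcB k e S (\<lambda>p. a p ^ m)"
  by (induction m) (auto intro: jcB_one jcB_mult)

lemma jcB_sh: "jcB k e S a \<Longrightarrow> jcB k e S (\<lambda>p. sh k (a p))"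
  by (simp add: jcB_def co_sh jc_tr)

lemma jcB_wm: "jcB k e S a \<Longrightarrow> jcB k e S b \<Longrightarrow> jcB k e S (\<lambda>p. wm (a p) (b p))"
  by (simp add: jcB_def co_wm wmc_def jc_sum jc_mult jc_const_mult)

lemma jcB_limit:
  assumes "convex S" "\<And>N. jcB k e S (a N)" "e > 0" and lim: "uniform_limit S a A sequentially"
  shows "jcB k e S A"
  unfolding jcB_def
proof
  fix n
  show "jc k e S (\<lambda>p. co (A p) n)"
    using assms(1) jcB_D [OF assms(2)] assms(3)
    by (rule jc_limit) (rule bounded_linear.uniform_limit [OF bounded_linear_cf lim])
qed

lemma jcB_cj:
  assumes "e > 0"
    and J: "\<And>i j. i + j \<le> k \<Longrightarrow> continuous_on S (J i j)"
    "\<And>i j p. i + j < k \<Longrightarrow> p \<in> S \<Longrightarrow> has_partials (J i j) (real (Suc i) * J (Suc i) j p) (real (Suc j) * J i (Suc j) p) p S"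
  shows "jcB k e S (\<lambda>p. cj k (\<lambda>i j. e ^ (i + j) * J i j p))"
  unfolding jcB_def jc_def co_cj
proof (intro conjI allI impI ballI)
  fix n i j assume "i + j \<le> k"
  then show "continuous_on S (\<lambda>p. jco (if n = 0 then tr k (jets (\<lambda>i j. e ^ (i + j) * J i j p)) else 0) i j)"
    using J(1) by (cases "n = 0") (auto intro!: continuous_intros)
next
  fix n i j p assume p: "p \<in> S" "i + j < k"
  show "((\<lambda>p. jco (if n = 0 then tr k (jets (\<lambda>i j. e ^ (i + j) * J i j p)) else 0) i j) has_derivative
          (\<lambda>v. (fst v * jco (d1 (if n = 0 then tr k (jets (\<lambda>i j. e ^ (i + j) * J i j p)) else 0)) i j +
           snd v * jco (d2 (if n = 0 then tr k (jets (\<lambda>i j. e ^ (i + j) * J i j p)) else 0)) i j) / e)) (at p within S)"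
  proof (cases "n = 0")
    case True
    have "((\<lambda>p. e ^ (i + j) * J i j p) has_derivative
       (\<lambda>v. e ^ (i + j) * (fst v * (real (Suc i) * J (Suc i) j p) + snd v * (real (Suc j) * J i (Suc j) p)))) (at p within S)"
      by (intro has_derivative_mult_right J p)
    moreover have "e ^ (i + j) * (fst v * (real (Suc i) * J (Suc i) j p) + snd v * (real (Suc j) * J i (Suc j) p)) =
       (fst v * (real (Suc i) * (e ^ (Suc i + j) * J (Suc i) j p)) + snd v * (real (Suc j) * (e ^ (i + Suc j) * J i (Suc j) p))) / e" for v
      using \<open>e > 0\<close> by (simp add: field_simps)
    ultimately show ?thesis
      using p True by (simp add: jco_d1 jco_d2 del: of_nat_Suc power_Suc)
  qed (simp add: jco_d1 jco_d2)
qed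

lemma jcB_Mop:
  assumes K: "\<And>p. p \<in> S \<Longrightarrow> mult_bd K (M p)" and a: "jcB k e S a"
    and M: "\<And>n i p. p \<in> S \<Longrightarrow> ((\<lambda>p. M p n i) has_derivative (\<lambda>v. fst v * (real (Suc i) * M p n (Suc i)) / e)) (at p within S)"
  shows "jcB k e S (\<lambda>p. Mop (M p) (a p))"
  unfolding jcB_def
proof
  fix n
  have "jc k e S (\<lambda>p. MJ (M p) n)"
    unfolding jc_def
  proof (intro conjI allI impI ballI)
    fix i j
    show "continuous_on S (\<lambda>p. jco (MJ (M p) n) i j)"
      using M by (cases "j = 0")
        (auto simp: jco_MJ continuous_on_eq_continuous_within intro!: has_derivative_continuous)
  next
    fix i j p assume p: "p \<in> S" "i + j < k"
    show "((\<lambda>p. jco (MJ (M p) n) i j) has_derivative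
          (\<lambda>v. (fst v * jco (d1 (MJ (M p) n)) i j + snd v * jco (d2 (MJ (M p) n)) i j) / e)) (at p within S)"
      using M [OF p(1)] by (cases "j = 0") (auto simp: jco_d1 jco_d2 jco_MJ simp del: of_nat_Suc)
  qed
  then have "jc k e S (\<lambda>p. MJ (M p) n * co (a p) n)" by (rule jc_mult [OF _ jcB_D [OF a]])
  \<comment> \<open>The multiplier bound, and with it \<open>co_Mop\<close>, is known only on
    \<open>S\<close>, so the two functions agree there and the derivatives within \<open>S\<close>
    have to be transported.\<close>
  then show "jc k e S (\<lambda>p. co (Mop (M p) (a p)) n)"
    by (simp add: jc_def co_Mop [OF K] d1_def d2_def cong: continuous_on_cong)
       (safe, rule has_derivative_transform, auto simp: co_Mop [OF K])
qed

text \<open>Taylor coefficients of \<open>1 / (\<sigma> - \<i>)\<close> at \<open>\<sigma> = l n r\<close>. The real and imaginary parts of this function are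
  \<open>\<sigma> / (1 + \<sigma>\<^sup>2)\<close> and \<open>1 / (1 + \<sigma>\<^sup>2)\<close>, the entries of the inverse matrix, and all its Taylor coefficients are
  bounded by 1.\<close>

definition kap :: "real \<Rightarrow> real \<Rightarrow> nat \<Rightarrow> nat \<Rightarrow> real \<Rightarrow> complex" where
  "kap l e n i r = of_real ((- (l * n * e)) ^ i) / (of_real (l * n * r) - \<i>) ^ Suc i"

lemma kap_denominator: "of_real x - \<i> \<noteq> 0"
  by (auto simp: complex_eq_iff)

lemma kap_deriv:
  assumes "e \<noteq> 0"
  shows "((\<lambda>r. kap l e n i r) has_vector_derivative real (Suc i) * kap l e n (Suc i) r / e) (at r within S)"
proof -
  have "((\<lambda>z. of_real ((- (l * n * e)) ^ i) / (of_real (l * n) * z - \<i>) ^ Suc i) has_field_derivative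
     of_real ((- (l * n * e)) ^ i) * (- (of_nat (Suc i) * (of_real (l * n) * of_real r - \<i>) ^ i * of_real (l * n)) / ((of_real (l * n) * of_real r - \<i>) ^ Suc i * (of_real (l * n) * of_real r - \<i>) ^ Suc i)))
     (at (of_real r))"
    using kap_denominator [of "l * n * r"] by (auto intro!: derivative_eq_intros simp del: power_Suc)
  from has_vector_derivative_real_field [OF this, of S]
  have "((\<lambda>r. kap l e n i r) has_vector_derivative of_real ((- (l * n * e)) ^ i) * (- (of_nat (Suc i) * (of_real (l * n) * of_real r - \<i>) ^ i * of_real (l * n)) / ((of_real (l * n) * of_real r - \<i>) ^ Suc i * (of_real (l * n) * of_real r - \<i>) ^ Suc i))) (at r within S)"
    by (simp add: kap_def del: power_Suc)
  moreover have "of_real ((- (l * n * e)) ^ i) * (- (of_nat (Suc i) * (of_real (l * n) * of_real r - \<i>) ^ i * of_real (l * n)) / ((of_real (l * n) * of_real r - \<i>) ^ Suc i * (of_real (l * n) * of_real r - \<i>) ^ Suc i))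
     = real (Suc i) * kap l e n (Suc i) r / e"
  proof -
    have "(- (c * d)) ^ i * (- (m * w ^ i * c) / (w ^ Suc i * w ^ Suc i)) = m * ((- (c * d)) ^ Suc i / w ^ Suc (Suc i)) / d"
      if "w \<noteq> 0" "d \<noteq> 0" for c d m w :: complex
      using that by (simp add: divide_simps)
    from this [of "of_real (l * n) * of_real r - \<i>" "of_real e" "of_real (l * n)" "of_nat (Suc i)"] show ?thesis
      using kap_denominator [of "l * n * r"] assms by (simp add: kap_def del: power_Suc of_nat_Suc)
  qed
  ultimately show ?thesis by simp
qed

text \<open>For real r the denominator has imaginary part -1, hence modulus at least 1, however
  large l n r becomes.\<close>

lemma norm_kap_le: "norm (kap l e n i r) \<le> (\<bar>l\<bar> * n * \<bar>e\<bar>) ^ i"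
proof -
  have "1 \<le> norm (of_real (l * n * r) - \<i>)"
    using abs_Im_le_cmod [of "of_real (l * n * r) - \<i>"] by simp
  then have "1 \<le> norm (of_real (l * n * r) - \<i>) ^ Suc i" by (rule one_le_power)
  then have "(\<bar>l\<bar> * n * \<bar>e\<bar>) ^ i / norm (of_real (l * n * r) - \<i>) ^ Suc i \<le> (\<bar>l\<bar> * n * \<bar>e\<bar>) ^ i / 1"
    by (intro divide_left_mono) auto
  moreover have "norm (kap l e n i r) = (\<bar>l\<bar> * n * \<bar>e\<bar>) ^ i / norm (of_real (l * n * r) - \<i>) ^ Suc i"
    by (simp only: kap_def norm_divide norm_of_real norm_power power_abs abs_minus_cancel abs_mult abs_of_nat)
  ultimately show ?thesis by simp
qed

text \<open>Each order of differentiation in r brings the factor l n e. The weight contributes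
  2^(-n), which beats n, and |l| e <= 1/2 leaves a geometric series with ratio 1/2, uniformly in n
  and r.\<close>

lemma sum_kap_le:
  assumes "\<bar>l\<bar> * e \<le> 1/2" "0 < e"
  shows "(\<Sum>i\<le>N. norm (kap l e n i r) * wt n i) \<le> 2"
proof -
  have n: "real n / 2 ^ n \<le> 1" using less_exp [of n] by (simp add: of_nat_le_numeral_power_cancel_iff less_imp_le)
  have "norm (kap l e n i r) * wt n i \<le> (1/2) ^ i" for i
  proof -
    have "norm (kap l e n i r) * wt n i \<le> (\<bar>l\<bar> * n * \<bar>e\<bar>) ^ i * wt n i"
      by (intro mult_right_mono norm_kap_le) auto
    also have "\<dots> = ((\<bar>l\<bar> * e) * (real n / 2 ^ n)) ^ i"
    proof -
      have "wt n i = (1 / 2 ^ n) ^ i" by (simp add: power_mult power_one_over)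
      then show ?thesis using assms by (simp only: power_mult_distrib [symmetric]) (simp add: mult_ac)
    qed
    also have "\<dots> \<le> (1/2 * 1) ^ i"
      using assms n by (intro power_mono mult_mono) auto
    finally show ?thesis by simp
  qed
  then have "(\<Sum>i\<le>N. norm (kap l e n i r) * wt n i) \<le> (\<Sum>i\<le>N. (1/2) ^ i)" by (rule sum_mono)
  also have "\<dots> \<le> 2" 
  proof -
    have "(\<Sum>i\<le>N. (1/2::real) ^ i) = 2 - (1/2) ^ N" by (induction N) auto
    then show ?thesis by simp
  qed
  finally show ?thesis .
qed

definition mC :: "real \<Rightarrow> real \<Rightarrow> real \<times> real \<Rightarrow> nat \<Rightarrow> nat \<Rightarrow> real" where
  "mC l e p n i = Im (kap l e n i (fst p))"
definition mD :: "real \<Rightarrow> real \<Rightarrow> real \<times> real \<Rightarrow> nat \<Rightarrow> nat \<Rightarrow> real" where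
  "mD l e p n i = Re (kap l e n i (fst p))"
text \<open>The products of \<open>mC\<close> and \<open>mD\<close> with \<open>r (n + 1)\<close>, written so that their boundedness is visible.\<close>

definition mU :: "real \<Rightarrow> real \<Rightarrow> real \<times> real \<Rightarrow> nat \<Rightarrow> nat \<Rightarrow> real" where
  "mU l e p n i = (if n = 0 then (if i = 0 then fst p else if i = 1 then e else 0)
      else real (Suc n) / (n * l) * mD l e p n i)"
definition mV :: "real \<Rightarrow> real \<Rightarrow> real \<times> real \<Rightarrow> nat \<Rightarrow> nat \<Rightarrow> real" where
  "mV l e p n i = (if n = 0 then 0
      else real (Suc n) / (n * l) * ((if i = 0 then 1 else 0) - mC l e p n i))"

lemma kap_deriv_pair:
  assumes "e \<noteq> 0"
  shows "((\<lambda>p. kap l e n i (fst p)) has_derivative (\<lambda>v. fst v *\<^sub>R (real (Suc i) * kap l e n (Suc i) (fst p) / e))) (at p within S)"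
  using has_derivative_compose [OF has_derivative_fst [OF has_derivative_ident]
     kap_deriv [OF assms, of l n i "fst p" UNIV, unfolded has_vector_derivative_def]]
  by simp

lemma mC_deriv:
  assumes "e \<noteq> 0"
  shows "((\<lambda>p. mC l e p n i) has_derivative (\<lambda>v. fst v * (real (Suc i) * mC l e p n (Suc i)) / e)) (at p within S)"
proof -
  have "(\<lambda>v. fst v * (real (Suc i) * mC l e p n (Suc i)) / e) = (\<lambda>v. Im (fst v *\<^sub>R (real (Suc i) * kap l e n (Suc i) (fst p) / e)))"
    by (auto simp: fun_eq_iff mC_def simp del: of_nat_Suc)
  then show ?thesis
    unfolding mC_def using has_derivative_Im [OF kap_deriv_pair [OF assms]] by simp
qed

lemma mD_deriv:
  assumes "e \<noteq> 0"
  shows "((\<lambda>p. mD l e p n i) has_derivative (\<lambda>v. fst v * (real (Suc i) * mD l e p n (Suc i)) / e)) (at p within S)"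
proof -
  have "(\<lambda>v. fst v * (real (Suc i) * mD l e p n (Suc i)) / e) = (\<lambda>v. Re (fst v *\<^sub>R (real (Suc i) * kap l e n (Suc i) (fst p) / e)))"
    by (auto simp: fun_eq_iff mD_def simp del: of_nat_Suc)
  then show ?thesis
    unfolding mD_def using has_derivative_Re [OF kap_deriv_pair [OF assms]] by simp
qed

lemma mU_deriv:
  assumes "e \<noteq> 0"
  shows "((\<lambda>p. mU l e p n i) has_derivative (\<lambda>v. fst v * (real (Suc i) * mU l e p n (Suc i)) / e)) (at p within S)"
proof (cases "n = 0")
  case True
  then show ?thesis using assms by (auto simp: mU_def intro!: derivative_eq_intros)
next
  case False
  then show ?thesis
    using has_derivative_mult_right [OF mD_deriv [OF assms], of "real (Suc n) / (n * l)" l n i p S]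
    by (simp add: mU_def mult_ac del: of_nat_Suc)
qed

lemma mV_deriv:
  assumes "e \<noteq> 0"
  shows "((\<lambda>p. mV l e p n i) has_derivative (\<lambda>v. fst v * (real (Suc i) * mV l e p n (Suc i)) / e)) (at p within S)"
proof (cases "n = 0")
  case True
  then show ?thesis by (simp add: mV_def)
next
  case False
  have "((\<lambda>p. (if i = 0 then 1 else 0) - mC l e p n i) has_derivative
    (\<lambda>v. 0 - fst v * (real (Suc i) * mC l e p n (Suc i)) / e)) (at p within S)"
    by (intro has_derivative_diff mC_deriv assms has_derivative_const)
  from has_derivative_mult_right [OF this, of "real (Suc n) / (n * l)"] False show ?thesis
    by (simp add: mV_def mult_ac del: of_nat_Suc)
qed

lemma mult_bd_C: "\<bar>l\<bar> * e \<le> 1/2 \<Longrightarrow> 0 < e \<Longrightarrow> mult_bd 2 (mC l e p)"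
  unfolding mult_bd_def mC_def
  by (intro allI order_trans [OF sum_mono sum_kap_le]) (auto intro!: mult_right_mono abs_Im_le_cmod)

lemma mult_bd_D: "\<bar>l\<bar> * e \<le> 1/2 \<Longrightarrow> 0 < e \<Longrightarrow> mult_bd 2 (mD l e p)"
  unfolding mult_bd_def mD_def
  by (intro allI order_trans [OF sum_mono sum_kap_le]) (auto intro!: mult_right_mono abs_Re_le_cmod)

lemma Suc_div_le: "n \<noteq> 0 \<Longrightarrow> \<bar>real (Suc n) / (n * l)\<bar> \<le> 2 / \<bar>l\<bar>"
  by (cases "l = 0") (auto simp: abs_mult divide_simps)

text \<open>One constant serves both \<open>mU\<close> and \<open>mV\<close>. The 2 covers
  \<open>n = 0\<close>, where the entries are r and e. For other n the prefactor is at most 2/|l|,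
  multiplied by 2 for \<open>mD\<close> here and by 3 for 1 - C in \<open>mult_bd_V\<close>, whence
  the 6.\<close>

lemma mult_bd_U:
  assumes "\<bar>l\<bar> * e \<le> 1/2" "0 < e" "e \<le> 1" "\<bar>fst p\<bar> \<le> 1"
  shows "mult_bd (2 + 6 / \<bar>l\<bar>) (mU l e p)"
  unfolding mult_bd_def
proof (intro allI)
  fix n N
  show "(\<Sum>i\<le>N. \<bar>mU l e p n i\<bar> * wt n i) \<le> 2 + 6 / \<bar>l\<bar>"
  proof (cases "n = 0")
    case True
    have "(\<Sum>i\<le>N. \<bar>mU l e p n i\<bar> * wt n i) = (\<Sum>i\<le>N. (if i = 0 then \<bar>fst p\<bar> else 0) + (if i = 1 then e else 0))"
      using True assms by (intro sum.cong) (auto simp: mU_def)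
    also have "\<dots> \<le> \<bar>fst p\<bar> + e" using assms by (simp add: sum.distrib)
    also have "\<dots> \<le> 2 + 6 / \<bar>l\<bar>" using assms by (simp add: add_increasing2)
    finally show ?thesis .
  next
    case False
    have "(\<Sum>i\<le>N. \<bar>mU l e p n i\<bar> * wt n i) = \<bar>real (Suc n) / (n * l)\<bar> * (\<Sum>i\<le>N. \<bar>mD l e p n i\<bar> * wt n i)"
      using False by (simp add: mU_def sum_distrib_left abs_mult mult_ac)
    also have "\<dots> \<le> 2 / \<bar>l\<bar> * 2"
      using mult_bd_D [OF assms(1,2)] Suc_div_le [OF False]
      by (intro mult_mono) (auto simp: mult_bd_def intro!: sum_nonneg)
    also have "\<dots> \<le> 2 + 6 / \<bar>l\<bar>" by (cases "l = 0") (auto simp: field_simps)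
    finally show ?thesis .
  qed
qed

lemma mult_bd_V:
  assumes "\<bar>l\<bar> * e \<le> 1/2" "0 < e"
  shows "mult_bd (2 + 6 / \<bar>l\<bar>) (mV l e p)"
  unfolding mult_bd_def
proof (intro allI)
  fix n N
  show "(\<Sum>i\<le>N. \<bar>mV l e p n i\<bar> * wt n i) \<le> 2 + 6 / \<bar>l\<bar>"
  proof (cases "n = 0")
    case True
    then show ?thesis by (simp add: mV_def)
  next
    case False
    have "(\<Sum>i\<le>N. \<bar>(if i = 0 then 1 else 0) - mC l e p n i\<bar> * wt n i) \<le> (\<Sum>i\<le>N. (if i = 0 then 1 else 0) + \<bar>mC l e p n i\<bar> * wt n i)"
    proof (rule sum_mono)
      fix i
      show "\<bar>(if i = 0 then 1 else 0) - mC l e p n i\<bar> * wt n i \<le> (if i = 0 then 1 else 0) + \<bar>mC l e p n i\<bar> * wt n i"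
        by (cases "i = 0") (auto simp: abs_triangle_ineq4 order_trans [OF abs_triangle_ineq4])
    qed
    also have "\<dots> \<le> 1 + 2"
      using mult_bd_C [OF assms] by (simp add: sum.distrib mult_bd_def)
    finally have le: "(\<Sum>i\<le>N. \<bar>(if i = 0 then 1 else 0) - mC l e p n i\<bar> * wt n i) \<le> 3" by simp
    have "(\<Sum>i\<le>N. \<bar>mV l e p n i\<bar> * wt n i) = \<bar>real (Suc n) / (n * l)\<bar> * (\<Sum>i\<le>N. \<bar>(if i = 0 then 1 else 0) - mC l e p n i\<bar> * wt n i)"
      using False by (simp add: mV_def sum_distrib_left abs_mult mult_ac)
    also have "\<dots> \<le> 2 / \<bar>l\<bar> * 3"
      using le Suc_div_le [OF False] by (intro mult_mono) (auto intro!: sum_nonneg)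
    finally show ?thesis by simp
  qed
qed

lemma mC_0: "mC l e p n 0 = 1 / (1 + (l * n * fst p)\<^sup>2)"
  by (simp add: mC_def kap_def Im_divide power2_eq_square)

lemma mD_0: "mD l e p n 0 = l * n * fst p / (1 + (l * n * fst p)\<^sup>2)"
  by (simp add: mD_def kap_def Re_divide power2_eq_square add.commute)

text \<open>With sigma = l n r, C = 1/(1 + sigma^2) and D = sigma C, the identities D = sigma C and
  1 - C = sigma D turn a division by l n into a factor r. The bounded quotient (n + 1)/n is what
  remains of n + 1.\<close>

lemma mU_0: "l \<noteq> 0 \<Longrightarrow> mU l e p n 0 = fst p * real (Suc n) * mC l e p n 0"
  by (simp add: mU_def mC_0 mD_0)

lemma mV_0: "l \<noteq> 0 \<Longrightarrow> mV l e p n 0 = fst p * real (Suc n) * mD l e p n 0"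
proof (cases "n = 0")
  case False
  assume l: "l \<noteq> 0"
  have "1 + (l * n * fst p)\<^sup>2 \<noteq> 0" by (metis add_nonneg_eq_0_iff zero_le_one zero_le_power2 zero_neq_one)
  then have "1 - 1 / (1 + (l * n * fst p)\<^sup>2) = (l * n * fst p)\<^sup>2 / (1 + (l * n * fst p)\<^sup>2)"
    by (simp add: field_simps)
  then show ?thesis using False l by (simp add: mV_def mC_0 mD_0 power2_eq_square)
qed (simp add: mV_def mD_0)

section \<open>Power series in three variables\<close>

text \<open>\<open>ta\<close>, \<open>tb\<close>, \<open>tc\<close> enumerate all exponent triples
  by a single natural number, so that power series in three variables become ordinary
  series.\<close>

definition ta :: "nat \<Rightarrow> nat" where "ta i = fst (prod_decode i)"
definition tb :: "nat \<Rightarrow> nat" where "tb i = fst (prod_decode (snd (prod_decode i)))"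
definition tc :: "nat \<Rightarrow> nat" where "tc i = snd (prod_decode (snd (prod_decode i)))"
definition tdeg :: "nat \<Rightarrow> nat" where "tdeg i = ta i + tb i + tc i"

definition tri :: "nat \<Rightarrow> nat \<times> nat \<times> nat" where "tri i = (ta i, tb i, tc i)"

lemma bij_tri: "bij tri"
proof (rule bijI)
  show "inj tri"
  proof (rule injI)
    fix i j assume "tri i = tri j"
    then have "snd (prod_decode i) = snd (prod_decode j)" "fst (prod_decode i) = fst (prod_decode j)"
      by (auto simp: tri_def ta_def tb_def tc_def intro: inj_prod_decode [of UNIV, THEN injD] prod_eqI)
    then show "i = j" by (metis prod_decode_inverse prod_eqI)
  qed
  have "tri (prod_encode (a, prod_encode (b, c))) = (a, b, c)" for a b c
    by (simp add: tri_def ta_def tb_def tc_def)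
  then show "surj tri" by (intro surjI [of tri "\<lambda>(a, b, c). prod_encode (a, prod_encode (b, c))"]) auto
qed

lemma finite_tri_box: "finite (tri -` ({..M} \<times> {..M} \<times> {..M}))"
  by (intro finite_vimageI bij_is_inj bij_tri) auto

lemma sum_tri_box:
  fixes p q s :: "'a :: comm_semiring_1"
  shows "(\<Sum>i\<in>tri -` ({..M} \<times> {..M} \<times> {..M}). p ^ ta i * q ^ tb i * s ^ tc i) =
    (\<Sum>a\<le>M. p ^ a) * (\<Sum>b\<le>M. q ^ b) * (\<Sum>c\<le>M. s ^ c)"
proof -
  let ?B = "{..M} \<times> {..M} \<times> {..M}"
  have b: "bij_betw tri (tri -` ?B) ?B"
    using bij_tri by (auto simp: bij_betw_def surj_image_vimage_eq intro: inj_on_subset)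
  have "(\<Sum>i\<in>tri -` ?B. p ^ ta i * q ^ tb i * s ^ tc i) = (\<Sum>i\<in>tri -` ?B. (\<lambda>(a, b, c). p ^ a * q ^ b * s ^ c) (tri i))"
    by (simp add: tri_def)
  also have "\<dots> = (\<Sum>(a, b, c)\<in>?B. p ^ a * q ^ b * s ^ c)"
    by (rule sum.reindex_bij_betw [OF b])
  also have "\<dots> = (\<Sum>a\<le>M. \<Sum>b\<le>M. \<Sum>c\<le>M. p ^ a * q ^ b * s ^ c)"
    by (simp add: sum.cartesian_product)
  also have "\<dots> = (\<Sum>a\<le>M. p ^ a) * (\<Sum>b\<le>M. q ^ b) * (\<Sum>c\<le>M. s ^ c)"
    by (simp only: sum_distrib_left [symmetric] sum_distrib_right [symmetric])
  finally show ?thesis .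
qed

lemma geometric_half_le: "(\<Sum>i\<le>N. (1/2::real) ^ i) \<le> 2"
proof -
  have "(\<Sum>i\<le>N. (1/2::real) ^ i) = 2 - (1/2) ^ N" by (induction N) auto
  then show ?thesis by simp
qed

text \<open>An initial segment of the enumeration lies in a box of exponents, where the sum factors
  into three geometric sums, each at most 2.\<close>

lemma sum_tri_le: "(\<Sum>i<N. (1/2::real) ^ tdeg i) \<le> 8"
proof -
  define M where "M = Max (insert 0 ((\<lambda>i. tdeg i) ` {..<N}))"
  have M: "tdeg i \<le> M" if "i < N" for i using that unfolding M_def by (intro Max_ge) auto
  have "(\<Sum>i<N. (1/2::real) ^ tdeg i) = (\<Sum>i<N. (1/2) ^ ta i * (1/2) ^ tb i * (1/2) ^ tc i)"
    by (simp only: tdeg_def power_add)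
  also have "\<dots> \<le> (\<Sum>i\<in>tri -` ({..M} \<times> {..M} \<times> {..M}). (1/2) ^ ta i * (1/2) ^ tb i * (1/2) ^ tc i)"
  proof (rule sum_mono2 [OF finite_tri_box])
    show "{..<N} \<subseteq> tri -` ({..M} \<times> {..M} \<times> {..M})"
      using M by (fastforce simp: tri_def tdeg_def)
  qed auto
  also have "\<dots> \<le> 2 * 2 * 2"
    unfolding sum_tri_box by (intro mult_mono geometric_half_le mult_nonneg_nonneg sum_nonneg) auto
  finally show ?thesis by simp
qed

lemma summable_tri: "summable (\<lambda>i. (1/2::real) ^ tdeg i)"
  and suminf_tri: "(\<Sum>i. (1/2::real) ^ tdeg i) \<le> 8"
proof -
  show *: "summable (\<lambda>i. (1/2::real) ^ tdeg i)"
  proof (rule bounded_imp_summable)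
    show "(\<Sum>i\<le>n. (1/2::real) ^ tdeg i) \<le> 8" for n
      using sum_tri_le [of "Suc n"] by (simp add: lessThan_Suc_atMost)
  qed auto
  show "(\<Sum>i. (1/2::real) ^ tdeg i) \<le> 8"
    by (rule suminf_le_const [OF * sum_tri_le])
qed

text \<open>The enumeration itself gives no usable partial sums. Absolute convergence allows
  summation along the boxes of exponents instead, which exhaust the index set and on which the sum
  factors.\<close>

lemma triple_geometric_sums:
  fixes p q s :: complex
  assumes "norm p \<le> 1/2" "norm q \<le> 1/2" "norm s \<le> 1/2"
  shows "(\<lambda>i. p ^ ta i * q ^ tb i * s ^ tc i) sums (1 / ((1 - p) * (1 - q) * (1 - s)))"
proof -
  let ?f = "\<lambda>i. p ^ ta i * q ^ tb i * s ^ tc i"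
  have "norm (?f i) \<le> (1/2) ^ tdeg i" for i
    unfolding norm_mult norm_power tdeg_def power_add using assms
    by (intro mult_mono power_mono mult_nonneg_nonneg) auto
  then have sm: "summable (\<lambda>i. norm (?f i))"
    by (intro summable_comparison_test' [OF summable_tri, of 0]) auto
  then have "?f sums suminf ?f" by (simp add: summable_norm_cancel summable_sums)
  then have "(?f has_sum suminf ?f) UNIV" by (rule norm_summable_imp_has_sum [OF sm])
  then have lim: "(sum ?f \<longlongrightarrow> suminf ?f) (finite_subsets_at_top UNIV)" by (simp add: has_sum_def)
  have "filterlim (\<lambda>M. tri -` ({..M} \<times> {..M} \<times> {..M})) (finite_subsets_at_top UNIV) sequentially"
    unfolding filterlim_finite_subsets_at_top
  proof (intro allI impI)
    fix X :: "nat set" assume X: "finite X \<and> X \<subseteq> UNIV"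
    define M where "M = Max (insert 0 (tdeg ` X))"
    have M: "tdeg i \<le> M" if "i \<in> X" for i using that X unfolding M_def by (intro Max_ge) auto
    show "\<forall>\<^sub>F y in sequentially. finite (tri -` ({..y} \<times> {..y} \<times> {..y})) \<and> X \<subseteq> tri -` ({..y} \<times> {..y} \<times> {..y}) \<and> tri -` ({..y} \<times> {..y} \<times> {..y}) \<subseteq> UNIV"
      using M by (intro eventually_sequentiallyI [of M]) (fastforce simp: finite_tri_box tri_def tdeg_def)
  qed
  from filterlim_compose [OF lim this]
  have "(\<lambda>M. (\<Sum>a\<le>M. p ^ a) * (\<Sum>b\<le>M. q ^ b) * (\<Sum>c\<le>M. s ^ c)) \<longlonglongrightarrow> suminf ?f"
    by (simp only: sum_tri_box)
  moreover have g: "(\<lambda>M. \<Sum>a\<le>M. x ^ a) \<longlonglongrightarrow> 1 / (1 - x)" if "norm x \<le> 1/2" for x :: complex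
  proof -
    have "(\<lambda>n. x ^ n) sums (1 / (1 - x))" by (rule geometric_sums) (use that in auto)
    then show ?thesis by (simp add: sums_def_le)
  qed
  have "(\<lambda>M. (\<Sum>a\<le>M. p ^ a) * (\<Sum>b\<le>M. q ^ b) * (\<Sum>c\<le>M. s ^ c)) \<longlonglongrightarrow> 1 / (1 - p) * (1 / (1 - q)) * (1 / (1 - s))"
    by (intro tendsto_mult g assms)
  ultimately have "suminf ?f = 1 / (1 - p) * (1 / (1 - q)) * (1 / (1 - s))"
    by (rule LIMSEQ_unique)
  then show ?thesis using \<open>?f sums suminf ?f\<close> by simp
qed

text \<open>Polymorphic because the same series is formed with jets, for the fixed-point map, and
  with real numbers, for the vector field; \<open>ev_psum\<close> connects the two.\<close>

definition psum :: "(nat \<Rightarrow> 'a) \<Rightarrow> 'a \<Rightarrow> 'a \<Rightarrow> 'a \<Rightarrow> 'a :: {real_normed_algebra_1, comm_ring_1, banach}" where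
  "psum g x y z = (\<Sum>i. g i * (x ^ ta i * y ^ tb i * z ^ tc i))"

lemma norm_power_le_1: "norm (x :: 'a :: real_normed_algebra_1) \<le> 1 \<Longrightarrow> norm (x ^ n) \<le> 1"
  by (rule order_trans [OF norm_power_ineq power_le_one]) auto

lemma norm_monomial_le_1:
  fixes x y z :: "'a :: real_normed_algebra_1"
  assumes "norm x \<le> 1" "norm y \<le> 1" "norm z \<le> 1"
  shows "norm (x ^ a * y ^ b * z ^ c) \<le> 1"
proof -
  have "norm (x ^ a * y ^ b * z ^ c) \<le> norm (x ^ a) * norm (y ^ b) * norm (z ^ c)"
    by (intro order_trans [OF norm_mult_ineq mult_right_mono] norm_mult_ineq norm_ge_zero)
  also have "\<dots> \<le> 1 * 1 * 1"
    by (intro mult_mono norm_power_le_1 assms mult_nonneg_nonneg) auto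
  finally show ?thesis by simp
qed

lemma coeff_bound_nonneg:
  assumes "norm (a :: 'a :: real_normed_vector) \<le> C * (1/4) ^ n" shows "0 \<le> C"
proof -
  have "0 \<le> C * (1/4) ^ n" using assms norm_ge_zero order_trans by blast
  moreover have "0 < (1/4::real) ^ n" by simp
  ultimately show ?thesis by (auto simp: zero_le_mult_iff)
qed

lemma quarter_le_half: "0 \<le> C \<Longrightarrow> C * (1/4::real) ^ n \<le> C * (1/2) ^ n"
  by (intro mult_left_mono power_mono) auto

lemma psum_term_le:
  fixes x y z :: "'a :: {real_normed_algebra_1, comm_ring_1, banach}"
  assumes "\<And>i. norm (g i) \<le> C * (1/4) ^ tdeg i" "norm x \<le> 1" "norm y \<le> 1" "norm z \<le> 1"
  shows "norm (g i * (x ^ ta i * y ^ tb i * z ^ tc i)) \<le> C * (1/2) ^ tdeg i"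
proof -
  have "0 \<le> C" by (rule coeff_bound_nonneg [OF assms(1)])
  then have C: "0 \<le> C * (1/4) ^ tdeg i" by simp
  have "norm (g i * (x ^ ta i * y ^ tb i * z ^ tc i)) \<le> norm (g i) * norm (x ^ ta i * y ^ tb i * z ^ tc i)"
    by (rule norm_mult_ineq)
  also have "\<dots> \<le> (C * (1/4) ^ tdeg i) * 1"
    by (intro mult_mono assms(1) norm_monomial_le_1 assms C) auto
  finally show ?thesis using quarter_le_half [OF \<open>0 \<le> C\<close>, of "tdeg i"] by simp
qed

lemma psum_summable:
  fixes x y z :: "'a :: {real_normed_algebra_1, comm_ring_1, banach}"
  assumes "\<And>i. norm (g i) \<le> C * (1/4) ^ tdeg i" "norm x \<le> 1" "norm y \<le> 1" "norm z \<le> 1"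
  shows "summable (\<lambda>i. norm (g i * (x ^ ta i * y ^ tb i * z ^ tc i)))"
  by (rule summable_comparison_test' [OF summable_mult [OF summable_tri, of C], of 0])
     (simp add: psum_term_le [OF assms])

lemma norm_psum_le:
  fixes x y z :: "'a :: {real_normed_algebra_1, comm_ring_1, banach}"
  assumes "\<And>i. norm (g i) \<le> C * (1/4) ^ tdeg i" "norm x \<le> 1" "norm y \<le> 1" "norm z \<le> 1"
  shows "norm (psum g x y z) \<le> 8 * C"
proof -
  have "0 \<le> C" by (rule coeff_bound_nonneg [OF assms(1)])
  have "norm (psum g x y z) \<le> (\<Sum>i. C * (1/2) ^ tdeg i)"
    unfolding psum_def using psum_summable [OF assms] psum_term_le [OF assms] summable_mult [OF summable_tri]
    by (intro order_trans [OF summable_norm suminf_le]) auto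
  also have "\<dots> = C * (\<Sum>i. (1/2) ^ tdeg i)" by (rule suminf_mult [OF summable_tri])
  also have "\<dots> \<le> C * 8" by (intro mult_left_mono suminf_tri \<open>0 \<le> C\<close>)
  finally show ?thesis by simp
qed

lemma norm_monomial_diff:
  fixes x y z :: "'a :: {real_normed_algebra_1, comm_ring_1}"
  assumes "norm x \<le> 1" "norm y \<le> 1" "norm z \<le> 1" "norm x' \<le> 1" "norm y' \<le> 1" "norm z' \<le> 1"
  shows "norm (x ^ a * y ^ b * z ^ c - x' ^ a * y' ^ b * z' ^ c)
     \<le> real (a + b + c) * (norm (x - x') + norm (y - y') + norm (z - z'))"
proof -
  \<comment> \<open>The factors \<open>1 ^ 0\<close> give each cofactor the shape of a product of
    three powers, as in \<open>norm_monomial_le_1\<close>.\<close>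
  have "x ^ a * y ^ b * z ^ c - x' ^ a * y' ^ b * z' ^ c =
     (x ^ a - x' ^ a) * (y ^ b * z ^ c * 1 ^ 0) + (x' ^ a * z ^ c * 1 ^ 0) * (y ^ b - y' ^ b) + (x' ^ a * y' ^ b * 1 ^ 0) * (z ^ c - z' ^ c)"
    by (simp add: algebra_simps)
  also have "norm \<dots> \<le> norm ((x ^ a - x' ^ a) * (y ^ b * z ^ c * 1 ^ 0)) + norm ((x' ^ a * z ^ c * 1 ^ 0) * (y ^ b - y' ^ b)) + norm ((x' ^ a * y' ^ b * 1 ^ 0) * (z ^ c - z' ^ c))"
    by (intro order_trans [OF norm_triangle_ineq] add_mono norm_triangle_ineq order_refl)
  also have "\<dots> \<le> (a * norm (x - x')) * 1 + 1 * (b * norm (y - y')) + 1 * (c * norm (z - z'))"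
    using assms
    by (intro add_mono order_trans [OF norm_mult_ineq] mult_mono norm_power_diff norm_monomial_le_1) auto
  also have "\<dots> \<le> real (a + b + c) * (norm (x - x') + norm (y - y') + norm (z - z'))"
    by (simp add: algebra_simps)
  finally show ?thesis .
qed

text \<open>Monomials of degree d have Lipschitz constant d on the unit ball, and d <= 2^d. The
  decay 4^(-d) of the coefficients, stronger than the summable 2^(-d), is the reserve for this
  factor.\<close>

lemma psum_diff_le:
  fixes x y z :: "'a :: {real_normed_algebra_1, comm_ring_1, banach}"
  assumes g: "\<And>i. norm (g i) \<le> C * (1/4) ^ tdeg i"
    and n: "norm x \<le> 1" "norm y \<le> 1" "norm z \<le> 1" "norm x' \<le> 1" "norm y' \<le> 1" "norm z' \<le> 1"
  shows "norm (psum g x y z - psum g x' y' z') \<le> 8 * C * (norm (x - x') + norm (y - y') + norm (z - z'))"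
proof -
  let ?d = "norm (x - x') + norm (y - y') + norm (z - z')"
  have "0 \<le> C" by (rule coeff_bound_nonneg [OF g])
  have s: "summable (\<lambda>i. g i * (x ^ ta i * y ^ tb i * z ^ tc i))" "summable (\<lambda>i. g i * (x' ^ ta i * y' ^ tb i * z' ^ tc i))"
    using psum_summable [OF g n(1-3)] psum_summable [OF g n(4-6)] by (auto intro: summable_norm_cancel)
  have t: "norm (g i * (x ^ ta i * y ^ tb i * z ^ tc i - x' ^ ta i * y' ^ tb i * z' ^ tc i)) \<le> C * ?d * (1/2) ^ tdeg i" for i
  proof -
    have "norm (g i * (x ^ ta i * y ^ tb i * z ^ tc i - x' ^ ta i * y' ^ tb i * z' ^ tc i)) \<le> (C * (1/4) ^ tdeg i) * (real (tdeg i) * ?d)"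
      unfolding tdeg_def [of i, symmetric]
      by (intro order_trans [OF norm_mult_ineq] mult_mono g norm_monomial_diff [where ?a = "ta i" and b = "tb i" and c = "tc i", folded tdeg_def] n) (use \<open>0 \<le> C\<close> in auto)
    also have "\<dots> \<le> (C * (1/4) ^ tdeg i) * (2 ^ tdeg i * ?d)"
      using less_exp [of "tdeg i"] \<open>0 \<le> C\<close>
      by (intro mult_left_mono mult_right_mono) (auto simp: less_imp_le of_nat_le_numeral_power_cancel_iff)
    also have "\<dots> = C * ?d * ((1/4) ^ tdeg i * 2 ^ tdeg i)" by (simp only: mult_ac)
    also have "(1/4) ^ tdeg i * 2 ^ tdeg i = (1/2::real) ^ tdeg i" by (simp only: power_mult_distrib [symmetric]) simp
    finally show ?thesis .
  qed
  have sm: "summable (\<lambda>i. norm (g i * (x ^ ta i * y ^ tb i * z ^ tc i - x' ^ ta i * y' ^ tb i * z' ^ tc i)))"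
    by (rule summable_comparison_test' [OF summable_mult [OF summable_tri, of "C * ?d"], of 0])
       (unfold real_norm_def abs_norm_cancel, rule t)
  have eq: "psum g x y z - psum g x' y' z' = (\<Sum>i. g i * (x ^ ta i * y ^ tb i * z ^ tc i - x' ^ ta i * y' ^ tb i * z' ^ tc i))"
    unfolding psum_def by (subst suminf_diff [OF s]) (simp add: algebra_simps)
  have "norm (psum g x y z - psum g x' y' z') \<le> (\<Sum>i. norm (g i * (x ^ ta i * y ^ tb i * z ^ tc i - x' ^ ta i * y' ^ tb i * z' ^ tc i)))"
    unfolding eq by (rule summable_norm [OF sm])
  also have "\<dots> \<le> (\<Sum>i. C * ?d * (1/2) ^ tdeg i)"
    by (rule suminf_le [OF t sm summable_mult [OF summable_tri]])
  also have "\<dots> = C * ?d * (\<Sum>i. (1/2) ^ tdeg i)" by (rule suminf_mult [OF summable_tri])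
  also have "\<dots> \<le> C * ?d * 8" using \<open>0 \<le> C\<close> by (intro mult_left_mono suminf_tri) auto
  finally show ?thesis by (simp only: mult_ac)
qed

lemma ev_psum:
  assumes t: "\<bar>t\<bar> \<le> 1" and g: "\<And>i. norm (g i) \<le> C * (1/4) ^ tdeg i" "norm x \<le> 1" "norm y \<le> 1" "norm z \<le> 1"
  shows "ev t (psum g x y z) = psum (\<lambda>i. ev t (g i)) (ev t x) (ev t y) (ev t z)"
proof -
  have "ev t (psum g x y z) = (\<Sum>i. ev t (g i * (x ^ ta i * y ^ tb i * z ^ tc i)))"
    unfolding psum_def
    by (rule bounded_linear.suminf [OF bounded_linear_ev [OF t] summable_norm_cancel [OF psum_summable [OF g]]])
  then show ?thesis by (simp add: psum_def ev_simps [OF t])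
qed

text \<open>The partial sums are polynomials in admissible families, and the majorant C 2^(-d) does
  not depend on the parameters, so they converge uniformly and \<open>jcB_limit\<close>
  applies.\<close>

lemma jcB_psum:
  assumes S: "convex S" "e > 0" and g: "\<And>i. jcB k e S (\<lambda>p. g p i)" "\<And>p i. p \<in> S \<Longrightarrow> norm (g p i) \<le> C * (1/4) ^ tdeg i"
    and x: "jcB k e S x" "\<And>p. p \<in> S \<Longrightarrow> norm (x p) \<le> 1"
    and y: "jcB k e S y" "\<And>p. p \<in> S \<Longrightarrow> norm (y p) \<le> 1"
    and z: "jcB k e S z" "\<And>p. p \<in> S \<Longrightarrow> norm (z p) \<le> 1"
  shows "jcB k e S (\<lambda>p. psum (g p) (x p) (y p) (z p))"
proof (rule jcB_limit [OF S(1) _ S(2)])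
  show "jcB k e S (\<lambda>p. \<Sum>i<N. g p i * (x p ^ ta i * y p ^ tb i * z p ^ tc i))" for N
    by (intro jcB_sum jcB_mult jcB_power g x y z)
  show "uniform_limit S (\<lambda>N p. \<Sum>i<N. g p i * (x p ^ ta i * y p ^ tb i * z p ^ tc i))
     (\<lambda>p. psum (g p) (x p) (y p) (z p)) sequentially"
    unfolding psum_def
    by (rule Weierstrass_m_test [OF psum_term_le summable_mult [OF summable_tri]]) (use g x y z in auto)
qed

section \<open>Bounds and Lipschitz constants on a ball of pairs (X, Z)\<close>

definition LB :: "real \<Rightarrow> real \<Rightarrow> real \<Rightarrow> (jalg \<times> jalg \<Rightarrow> jalg) \<Rightarrow> bool" where
  "LB b A L f \<longleftrightarrow> (\<forall>w. norm w \<le> b \<longrightarrow> norm (f w) \<le> A) \<and>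
     (\<forall>w w'. norm w \<le> b \<longrightarrow> norm w' \<le> b \<longrightarrow> norm (f w - f w') \<le> L * norm (w - w'))"

lemma LB_I:
  assumes "\<And>w. norm w \<le> b \<Longrightarrow> norm (f w) \<le> A"
    and "\<And>w w'. norm w \<le> b \<Longrightarrow> norm w' \<le> b \<Longrightarrow> norm (f w - f w') \<le> L * norm (w - w')"
  shows "LB b A L f"
  unfolding LB_def using assms by blast

lemma LB_D1: "LB b A L f \<Longrightarrow> norm w \<le> b \<Longrightarrow> norm (f w) \<le> A"
  unfolding LB_def by blast

lemma LB_D2: "LB b A L f \<Longrightarrow> norm w \<le> b \<Longrightarrow> norm w' \<le> b \<Longrightarrow> norm (f w - f w') \<le> L * norm (w - w')"
  unfolding LB_def by blast

lemma LB_mono: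
  assumes f: "LB b A L f" and "A \<le> A'" "L \<le> L'" shows "LB b A' L' f"
proof (rule LB_I)
  show "norm w \<le> b \<Longrightarrow> norm (f w) \<le> A'" for w
    using LB_D1 [OF f, of w] assms(2) by linarith
  show "norm w \<le> b \<Longrightarrow> norm w' \<le> b \<Longrightarrow> norm (f w - f w') \<le> L' * norm (w - w')" for w w'
    using LB_D2 [OF f, of w w'] mult_right_mono [OF assms(3), of "norm (w - w')"] by simp
qed

lemma LB_const: "norm c \<le> A \<Longrightarrow> LB b A 0 (\<lambda>w. c)"
  by (rule LB_I) auto

lemma LB_fst: "LB b b 1 fst"
proof (rule LB_I)
  have *: "norm (fst w) \<le> norm w" for w :: "jalg \<times> jalg"
    using norm_fst_le [of "fst w" "snd w"] by simp
  show "norm w \<le> b \<Longrightarrow> norm (fst w) \<le> b" for w :: "jalg \<times> jalg"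
    using * [of w] by linarith
  show "norm (fst w - fst w') \<le> 1 * norm (w - w')" for w w' :: "jalg \<times> jalg"
    using * [of "w - w'"] by simp
qed

lemma LB_snd: "LB b b 1 snd"
proof (rule LB_I)
  have *: "norm (snd w) \<le> norm w" for w :: "jalg \<times> jalg"
    using norm_snd_le [of "snd w" "fst w"] by simp
  show "norm w \<le> b \<Longrightarrow> norm (snd w) \<le> b" for w :: "jalg \<times> jalg"
    using * [of w] by linarith
  show "norm (snd w - snd w') \<le> 1 * norm (w - w')" for w w' :: "jalg \<times> jalg"
    using * [of "w - w'"] by simp
qed

lemma LB_add:
  assumes f: "LB b A L f" and g: "LB b A' L' g" shows "LB b (A + A') (L + L') (\<lambda>w. f w + g w)"
proof (rule LB_I)
  fix w :: "jalg \<times> jalg" assume w: "norm w \<le> b"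
  show "norm (f w + g w) \<le> A + A'"
    by (rule order_trans [OF norm_triangle_ineq add_mono [OF LB_D1 [OF f w] LB_D1 [OF g w]]])
  fix w' :: "jalg \<times> jalg" assume w': "norm w' \<le> b"
  show "norm (f w + g w - (f w' + g w')) \<le> (L + L') * norm (w - w')"
    unfolding distrib_right
    by (rule order_trans [OF norm_diff_triangle_ineq add_mono [OF LB_D2 [OF f w w'] LB_D2 [OF g w w']]])
qed

lemma LB_linear:
  assumes T: "bounded_linear T" "\<And>a. norm (T a) \<le> K * norm a" "0 \<le> K" and f: "LB b A L f"
  shows "LB b (K * A) (K * L) (\<lambda>w. T (f w))"
proof (rule LB_I)
  interpret bounded_linear T by (rule T)
  fix w :: "jalg \<times> jalg" assume w: "norm w \<le> b"
  show "norm (T (f w)) \<le> K * A"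
    by (rule order_trans [OF T(2) mult_left_mono [OF LB_D1 [OF f w] T(3)]])
  fix w' :: "jalg \<times> jalg" assume w': "norm w' \<le> b"
  show "norm (T (f w) - T (f w')) \<le> K * L * norm (w - w')"
    unfolding diff [symmetric] mult.assoc
    by (rule order_trans [OF T(2) mult_left_mono [OF LB_D2 [OF f w w'] T(3)]])
qed

lemma LB_scaleR: "LB b A L f \<Longrightarrow> LB b (\<bar>c\<bar> * A) (\<bar>c\<bar> * L) (\<lambda>w. c *\<^sub>R f w)"
  by (rule LB_linear [OF bounded_linear_scaleR_right]) auto

lemma LB_diff: "LB b A L f \<Longrightarrow> LB b A' L' g \<Longrightarrow> LB b (A + A') (L + L') (\<lambda>w. f w - g w)"
  using LB_add [of b A L f A' L' "\<lambda>w. - g w"] LB_scaleR [of b A' L' g "-1"] by simp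

text \<open>Splitting the difference of products shows that the Lipschitz constant involves the
  bounds of both factors; this is why \<open>LB\<close> carries a bound and a Lipschitz constant
  together.\<close>

lemma LB_bilinear:
  assumes B: "bounded_bilinear B" "\<And>a c. norm (B a c) \<le> norm a * norm c"
    and f: "LB b A L f" and g: "LB b A' L' g" and nn: "0 \<le> A" "0 \<le> L"
  shows "LB b (A * A') (A * L' + L * A') (\<lambda>w. B (f w) (g w))"
proof (rule LB_I)
  interpret bounded_bilinear B by (rule B)
  fix w :: "jalg \<times> jalg" assume w: "norm w \<le> b"
  show "norm (B (f w) (g w)) \<le> A * A'"
    by (rule order_trans [OF B(2) mult_mono [OF LB_D1 [OF f w] LB_D1 [OF g w]]]) (auto simp: nn)
  fix w' :: "jalg \<times> jalg" assume w': "norm w' \<le> b"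
  have "B (f w) (g w) - B (f w') (g w') = B (f w) (g w - g w') + B (f w - f w') (g w')"
    by (simp add: diff_left diff_right)
  then have "norm (B (f w) (g w) - B (f w') (g w')) \<le> norm (f w) * norm (g w - g w') + norm (f w - f w') * norm (g w')"
    by (simp only:) (rule order_trans [OF norm_triangle_ineq add_mono [OF B(2) B(2)]])
  also have "\<dots> \<le> A * (L' * norm (w - w')) + (L * norm (w - w')) * A'"
    using nn by (intro add_mono mult_mono LB_D1 [OF f w] LB_D2 [OF g w w'] LB_D2 [OF f w w'] LB_D1 [OF g w']) auto
  finally show "norm (B (f w) (g w) - B (f w') (g w')) \<le> (A * L' + L * A') * norm (w - w')"
    by (simp add: algebra_simps)
qed

lemma LB_mult: "LB b A L f \<Longrightarrow> LB b A' L' g \<Longrightarrow> 0 \<le> A \<Longrightarrow> 0 \<le> L \<Longrightarrow> LB b (A * A') (A * L' + L * A') (\<lambda>w. f w * g w)"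
  by (rule LB_bilinear [OF bounded_bilinear_mult norm_mult_ineq])

lemma LB_wm: "LB b A L f \<Longrightarrow> LB b A' L' g \<Longrightarrow> 0 \<le> A \<Longrightarrow> 0 \<le> L \<Longrightarrow> LB b (A * A') (A * L' + L * A') (\<lambda>w. wm (f w) (g w))"
  by (rule LB_bilinear [OF bounded_bilinear_wm norm_wm])

lemma LB_psum:
  assumes g: "\<And>i. norm (g i) \<le> C * (1/4) ^ tdeg i"
    and f: "LB b 1 L1 f1" "LB b 1 L2 f2" "LB b 1 L3 f3"
  shows "LB b (8 * C) (8 * C * (L1 + L2 + L3)) (\<lambda>w. psum g (f1 w) (f2 w) (f3 w))"
proof (rule LB_I)
  fix w :: "jalg \<times> jalg" assume w: "norm w \<le> b"
  show "norm (psum g (f1 w) (f2 w) (f3 w)) \<le> 8 * C"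
    by (rule norm_psum_le [OF g LB_D1 [OF f(1) w] LB_D1 [OF f(2) w] LB_D1 [OF f(3) w]])
  fix w' :: "jalg \<times> jalg" assume w': "norm w' \<le> b"
  have "0 \<le> C" by (rule coeff_bound_nonneg [OF g])
  have "norm (psum g (f1 w) (f2 w) (f3 w) - psum g (f1 w') (f2 w') (f3 w')) \<le>
     8 * C * (norm (f1 w - f1 w') + norm (f2 w - f2 w') + norm (f3 w - f3 w'))"
    by (rule psum_diff_le [OF g]; rule LB_D1 [OF f(1)] LB_D1 [OF f(2)] LB_D1 [OF f(3)]; rule w w')
  also have "\<dots> \<le> 8 * C * (L1 * norm (w - w') + L2 * norm (w - w') + L3 * norm (w - w'))"
    using \<open>0 \<le> C\<close> by (intro mult_left_mono add_mono LB_D2 [OF f(1) w w'] LB_D2 [OF f(2) w w'] LB_D2 [OF f(3) w w']) auto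
  finally show "norm (psum g (f1 w) (f2 w) (f3 w) - psum g (f1 w') (f2 w') (f3 w')) \<le> 8 * C * (L1 + L2 + L3) * norm (w - w')"
    by (simp add: algebra_simps)
qed

section \<open>The fixed-point problem\<close>

text \<open>The entries are Taylor coefficients, with the factorials divided out, hence the factors
  \<open>Suc i\<close> and \<open>Suc j\<close>. The unit e is not yet included; \<open>gJ\<close>
  supplies the powers of it.\<close>

definition jetfam :: "nat \<Rightarrow> real \<Rightarrow> (real \<times> real) set \<Rightarrow> (nat \<Rightarrow> nat \<Rightarrow> real \<times> real \<Rightarrow> real) \<Rightarrow> bool" where
  "jetfam k c S J \<longleftrightarrow>
     (\<forall>i j. i + j \<le> k \<longrightarrow> continuous_on S (J i j)) \<and>
     (\<forall>i j. \<forall>p\<in>S. i + j \<le> k \<longrightarrow> \<bar>J i j p\<bar> \<le> c) \<and>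
     (\<forall>i j. \<forall>p\<in>S. i + j < k \<longrightarrow> has_partials (J i j) (real (Suc i) * J (Suc i) j p) (real (Suc j) * J i (Suc j) p) p S)"

lemma cj_cong: "(\<And>i j. i + j \<le> k \<Longrightarrow> J i j = J' i j) \<Longrightarrow> cj k J = cj k J'"
  by (rule jalg_eqI) (simp add: co_cj)

definition gJ :: "nat \<Rightarrow> real \<Rightarrow> (nat \<Rightarrow> nat \<Rightarrow> real \<times> real \<Rightarrow> real) \<Rightarrow> real \<times> real \<Rightarrow> jalg" where
  "gJ k e J p = cj k (\<lambda>i j. e ^ (i + j) * J i j p)"

lemma jcB_gJ: "0 < e \<Longrightarrow> jetfam k c S J \<Longrightarrow> jcB k e S (gJ k e J)"
  unfolding gJ_def [abs_def] jetfam_def by (rule jcB_cj) auto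

lemma ev_gJ: "ev t (gJ k e J p) = J 0 0 p"
  by (simp add: gJ_def ev_cj)

lemma norm_gJ:
  assumes "jetfam k c S J" "p \<in> S" "0 < e" "e \<le> 1"
  shows "norm (gJ k e J p) \<le> (real (Suc k))\<^sup>2 * c"
proof -
  have c: "0 \<le> c"
    using assms(1,2) unfolding jetfam_def by (metis abs_ge_zero add_0 le0 order_trans)
  \<comment> \<open>The family is controlled only up to order \<open>k\<close>. The remaining
    entries are cut off by \<open>cj\<close> anyway and are set to 0 so that the crude double sum of
    \<open>norm_cj\<close> can be bounded.\<close>
  let ?J = "\<lambda>i j. if i + j \<le> k then e ^ (i + j) * J i j p else 0"
  have "gJ k e J p = cj k ?J" unfolding gJ_def by (rule cj_cong) simp
  also have "norm \<dots> \<le> (\<Sum>i\<le>k. \<Sum>j\<le>k. \<bar>?J i j\<bar>)" by (rule norm_cj)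
  also have "\<dots> \<le> (\<Sum>i\<le>k. \<Sum>j\<le>k. c)"
  proof (intro sum_mono)
    fix i j
    have "\<bar>e ^ (i + j) * J i j p\<bar> \<le> 1 * c" if "i + j \<le> k"
      unfolding abs_mult using assms that
      by (intro mult_mono) (auto simp: jetfam_def power_le_one)
    then show "\<bar>?J i j\<bar> \<le> c" using c by auto
  qed
  also have "\<dots> = (real (Suc k))\<^sup>2 * c" by (simp add: power2_eq_square)
  finally show ?thesis .
qed

definition rJ :: "nat \<Rightarrow> nat \<Rightarrow> real \<times> real \<Rightarrow> real" where
  "rJ i j p = (if j = 0 then if i = 0 then fst p else if i = 1 then 1 else 0 else 0)"
definition sJ :: "nat \<Rightarrow> nat \<Rightarrow> real \<times> real \<Rightarrow> real" where
  "sJ i j p = (if i = 0 then if j = 0 then snd p else if j = 1 then 1 else 0 else 0)"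

lemma norm_gJ_r:
  assumes "0 < e" shows "norm (gJ k e rJ p) \<le> \<bar>fst p\<bar> + e"
proof -
  have "norm (gJ k e rJ p) \<le> (\<Sum>i\<le>k. \<Sum>j\<le>k. \<bar>e ^ (i + j) * rJ i j p\<bar>)"
    unfolding gJ_def by (rule norm_cj)
  also have "\<dots> = (\<Sum>i\<le>k. \<Sum>j\<le>k. if j = 0 then (if i = 0 then \<bar>fst p\<bar> else 0) + (if i = 1 then e else 0) else 0)"
    using assms by (intro sum.cong refl) (auto simp: rJ_def)
  also have "\<dots> = (\<Sum>i\<le>k. (if i = 0 then \<bar>fst p\<bar> else 0) + (if i = 1 then e else 0))"
    by (simp add: sum.delta)
  also have "\<dots> \<le> \<bar>fst p\<bar> + e"
    using assms by (simp add: sum.distrib sum.delta)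
  finally show ?thesis .
qed

lemma norm_gJ_s:
  assumes "0 < e" shows "norm (gJ k e sJ p) \<le> \<bar>snd p\<bar> + e"
proof -
  have "norm (gJ k e sJ p) \<le> (\<Sum>i\<le>k. \<Sum>j\<le>k. \<bar>e ^ (i + j) * sJ i j p\<bar>)"
    unfolding gJ_def by (rule norm_cj)
  also have "\<dots> = (\<Sum>i\<le>k. if i = 0 then (\<Sum>j\<le>k. (if j = 0 then \<bar>snd p\<bar> else 0) + (if j = 1 then e else 0)) else 0)"
    using assms by (intro sum.cong refl) (auto simp: sJ_def intro!: sum.cong)
  also have "\<dots> = (\<Sum>j\<le>k. (if j = 0 then \<bar>snd p\<bar> else 0) + (if j = 1 then e else 0))"
    by (simp add: sum.delta)
  also have "\<dots> \<le> \<bar>snd p\<bar> + e"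
    using assms by (simp add: sum.distrib sum.delta)
  finally show ?thesis .
qed

lemma jcB_r: "0 < e \<Longrightarrow> jcB k e S (gJ k e rJ)"
  unfolding gJ_def [abs_def]
proof (rule jcB_cj)
  show "continuous_on S (rJ i j)" for i j
    by (cases "j = 0"; cases "i = 0"; cases "i = 1") (auto simp: rJ_def [abs_def] intro!: continuous_intros)
  show "has_partials (rJ i j) (real (Suc i) * rJ (Suc i) j p) (real (Suc j) * rJ i (Suc j) p) p S" for i j p
    by (cases "j = 0"; cases "i = 0"; cases "i = 1") (auto simp: rJ_def [abs_def] intro!: derivative_eq_intros)
qed

lemma jcB_s: "0 < e \<Longrightarrow> jcB k e S (gJ k e sJ)"
  unfolding gJ_def [abs_def]
proof (rule jcB_cj)
  show "continuous_on S (sJ i j)" for i j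
    by (cases "i = 0"; cases "j = 0"; cases "j = 1") (auto simp: sJ_def [abs_def] intro!: continuous_intros)
  show "has_partials (sJ i j) (real (Suc i) * sJ (Suc i) j p) (real (Suc j) * sJ i (Suc j) p) p S" for i j p
    by (cases "i = 0"; cases "j = 0"; cases "j = 1") (auto simp: sJ_def [abs_def] intro!: derivative_eq_intros)
qed

lemma mult_bd_mono: "mult_bd K M \<Longrightarrow> K \<le> K' \<Longrightarrow> mult_bd K' M"
  unfolding mult_bd_def by (meson order_trans)

text \<open>In the locale, \<open>p = (r, \<mu>\<^sub>2)\<close>, \<open>y = rho t\<close>, \<open>vel\<close> is the \<open>y\<close>-velocity divided by \<open>r\<close>, and the right-hand sides of the
  two equations are \<open>f0\<close> and \<open>g1 + g2\<close>, up to the terms with derivatives, \<open>W1\<close> and \<open>W2\<close>.\<close>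

locale jet_system =
  fixes l a2 R C M e rho beta kappa :: real and k :: nat
    and JF JG JH :: "nat \<Rightarrow> nat \<Rightarrow> nat \<Rightarrow> real \<times> real \<Rightarrow> real" and S :: "(real \<times> real) set"
  assumes l0: "l \<noteq> 0" and R0: "0 < R" and convS: "convex S"
    and e: "0 < e" "e \<le> 1" "\<bar>l\<bar> * e \<le> 1/2"
    and pS: "\<And>p. p \<in> S \<Longrightarrow> \<bar>fst p\<bar> + e \<le> kappa" "\<And>p. p \<in> S \<Longrightarrow> \<bar>snd p\<bar> + e \<le> kappa"
    and J: "\<And>i. jetfam k (C * (1/4) ^ tdeg i) S (JF i)" "\<And>i. jetfam k (C * (1/4) ^ tdeg i) S (JG i)"
      "\<And>i. jetfam k (C * (1/4) ^ tdeg i) S (JH i)"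
    and M: "1 \<le> M" "\<bar>l\<bar> \<le> M" "\<bar>a2\<bar> \<le> M" "2 + 6 / \<bar>l\<bar> \<le> M" "2 ^ k \<le> M" "0 \<le> C"
      "8 * ((real (Suc k))\<^sup>2 * C) \<le> M" "8 * ((real (Suc k))\<^sup>2 * C) * (2 / R) \<le> M"
    and small: "0 < rho" "rho \<le> 1" "0 < beta" "beta \<le> 1" "0 < kappa" "kappa \<le> 1"
      "rho * rho + beta \<le> R" "rho + beta \<le> R"
    \<comment> \<open>\<open>contr\<close> adds the Lipschitz constants of one component of the map,
      in the order \<open>f0\<close>, \<open>g1\<close> plus \<open>g2\<close>, and two derivative
      terms with their factor 1/rho. In \<open>self\<close> the 17 is 11 + 6, the bounds of
      \<open>f0\<close> and \<open>g2\<close>.\<close>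
    and contr: "M * (6 * M * kappa) + M * (2 * rho + 2 * beta + 5 * M * kappa) + 2 * ((1 / rho) * (M * (2 * M\<^sup>2 * kappa + 3 * M\<^sup>2 * beta))) \<le> 1/4"
    and self: "17 * M\<^sup>2 * kappa \<le> beta / 4"
begin

definition Yv where "Yv = rho *\<^sub>R yv"
definition rh where "rh p = gJ k e rJ p"
definition mh where "mh p = gJ k e sJ p"
text \<open>The nonlinearity at x = -y^2 + X and z = y + Z, with arguments divided by
  \<open>R\<close>, the scale on which its Taylor coefficients decay geometrically.\<close>

definition comp where
  "comp J p w = psum (\<lambda>i. gJ k e (J i) p) ((1/R) *\<^sub>R (fst w - Yv * Yv)) ((1/R) *\<^sub>R Yv) ((1/R) *\<^sub>R (Yv + snd w))"
definition q where "q p w = (1/2) *\<^sub>R mh p + a2 *\<^sub>R snd w + rh p * comp JG p w"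
definition vel where "vel p w = l *\<^sub>R Yv + q p w"
definition f0 where
  "f0 p w = 2 *\<^sub>R (Yv * (rh p * vel p w)) - (rh p * mh p) * (Yv + snd w) + rh p * comp JF p w"
text \<open>Separated from \<open>g2\<close> because it carries no factor r: it is small only
  through rho and beta, and it vanishes at w = 0.\<close>

definition g1 where "g1 w = 2 *\<^sub>R (Yv * snd w) + snd w * snd w" for w :: "jalg \<times> jalg"
definition g2 where "g2 p w = rh p * ((Yv + snd w) * comp JH p w) - rh p * vel p w"
definition W1 where "W1 p w = wm (q p w) (sh k (fst w))"
definition W2 where "W2 p w = wm (q p w) (sh k (snd w))"
text \<open>Solving the 2 x 2 system gives X_n = D f_n - C g_n and Z_n = C f_n + D g_n. In the
  derivative terms the factor r (n + 1) is merged into the multipliers, turning D and C into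
  \<open>mV\<close> and \<open>mU\<close>; 1/rho comes from d/dy = (1/rho) d/dt.\<close>

definition T1 where
  "T1 p w = Mop (mD l e p) (f0 p w) - Mop (mC l e p) (g1 w + g2 p w)
     - (1/rho) *\<^sub>R Mop (mV l e p) (W1 p w) + (1/rho) *\<^sub>R Mop (mU l e p) (W2 p w)"
definition T2 where
  "T2 p w = Mop (mC l e p) (f0 p w) + Mop (mD l e p) (g1 w + g2 p w)
     - (1/rho) *\<^sub>R Mop (mU l e p) (W1 p w) - (1/rho) *\<^sub>R Mop (mV l e p) (W2 p w)"

abbreviation "C' \<equiv> (real (Suc k))\<^sup>2 * C"

section \<open>Estimates for the fixed-point map\<close>

lemma norm_Yv: "norm Yv \<le> rho"
  using norm_yv small mult_left_mono [OF norm_yv, of rho] by (simp add: Yv_def)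

lemma norm_rh: "p \<in> S \<Longrightarrow> norm (rh p) \<le> kappa"
  using norm_gJ_r [OF e(1)] pS(1) order_trans unfolding rh_def by blast

lemma norm_mh: "p \<in> S \<Longrightarrow> norm (mh p) \<le> kappa"
  using norm_gJ_s [OF e(1)] pS(2) order_trans unfolding mh_def by blast

lemma norm_coeffs:
  assumes "\<And>i. jetfam k (C * (1/4) ^ tdeg i) S (J i)" "p \<in> S"
  shows "norm (gJ k e (J i) p) \<le> C' * (1/4) ^ tdeg i"
  using norm_gJ [OF assms e(1,2), of i] by (simp add: mult.assoc)

lemma LB_arg1: "LB beta 1 (1/R) (\<lambda>w. (1/R) *\<^sub>R (fst w - Yv * Yv))"
proof -
  have "norm (Yv * Yv) \<le> rho * rho"
    using norm_Yv small by (intro order_trans [OF norm_mult_ineq] mult_mono) auto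
  then have "LB beta (\<bar>1/R\<bar> * (beta + rho * rho)) (\<bar>1/R\<bar> * (1 + 0)) (\<lambda>w. (1/R) *\<^sub>R (fst w - Yv * Yv))"
    by (intro LB_scaleR LB_diff LB_fst LB_const)
  then show ?thesis by (rule LB_mono) (use small R0 in \<open>auto simp: field_simps\<close>)
qed

lemma LB_arg2: "LB beta 1 0 (\<lambda>w. (1/R) *\<^sub>R Yv)"
proof (rule LB_const)
  have "rho \<le> R" using small by linarith
  then show "norm ((1 / R) *\<^sub>R Yv) \<le> 1" using norm_Yv R0 by (simp add: field_simps)
qed

lemma LB_YZ: "LB beta (rho + beta) 1 (\<lambda>w. Yv + snd w)"
  using LB_add [OF LB_const [OF norm_Yv] LB_snd] by simp

lemma LB_arg3: "LB beta 1 (1/R) (\<lambda>w. (1/R) *\<^sub>R (Yv + snd w))"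
  by (rule LB_mono [OF LB_scaleR [OF LB_YZ]]) (use small R0 in \<open>auto simp: field_simps\<close>)

lemma LB_comp:
  assumes "\<And>i. jetfam k (C * (1/4) ^ tdeg i) S (J i)" "p \<in> S"
  shows "LB beta M M (comp J p)"
  unfolding comp_def [abs_def]
  by (rule LB_mono [OF LB_psum [OF norm_coeffs [OF assms] LB_arg1 LB_arg2 LB_arg3]])
     (use M in \<open>simp_all add: mult.assoc\<close>)

lemma kappa_bounds: "kappa \<le> M * kappa" "kappa * M = M * kappa" "0 \<le> M * kappa" "M * rho \<le> M" "M * beta \<le> M" "M * kappa \<le> M" "0 \<le> M * beta"
  using M(1) small by (auto simp: mult_le_cancel_right1 mult_left_le)

lemma LB_rh: "p \<in> S \<Longrightarrow> LB beta kappa 0 (\<lambda>w. rh p)"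
  by (intro LB_const norm_rh)

lemma LB_rh_mult: "p \<in> S \<Longrightarrow> LB beta A L f \<Longrightarrow> LB beta (kappa * A) (kappa * L) (\<lambda>w. rh p * f w)"
  using LB_mult [OF LB_rh] small by fastforce

lemma LB_Yv_mult: "LB beta A L f \<Longrightarrow> LB beta (rho * A) (rho * L) (\<lambda>w. Yv * f w)"
  using LB_mult [OF LB_const [OF norm_Yv]] small by fastforce

lemma LB_q:
  assumes p: "p \<in> S" shows "LB beta (2 * M * kappa + M * beta) (2 * M) (q p)"
proof -
  have "norm ((1/2) *\<^sub>R mh p) \<le> kappa" using norm_mh [OF p] small by simp
  then have "LB beta (kappa + \<bar>a2\<bar> * beta + kappa * M) (0 + \<bar>a2\<bar> * 1 + kappa * M) (q p)"
    unfolding q_def [abs_def]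
    by (intro LB_add LB_const LB_scaleR LB_snd LB_rh_mult LB_comp p J)
  then show ?thesis
  proof (rule LB_mono)
    show "kappa + \<bar>a2\<bar> * beta + kappa * M \<le> 2 * M * kappa + M * beta"
      using kappa_bounds mult_right_mono [OF M(3), of beta] small by linarith
    show "0 + \<bar>a2\<bar> * 1 + kappa * M \<le> 2 * M" using kappa_bounds M by linarith
  qed
qed

lemma LB_vel:
  assumes p: "p \<in> S" shows "LB beta (4 * M) (2 * M) (vel p)"
proof -
  have "norm (l *\<^sub>R Yv) \<le> M * rho"
    using mult_mono [OF M(2) norm_Yv] M(1) by simp
  then have "LB beta (M * rho + (2 * M * kappa + M * beta)) (0 + 2 * M) (vel p)"
    unfolding vel_def [abs_def] by (intro LB_add LB_const LB_q p)
  then show ?thesis by (rule LB_mono) (use kappa_bounds in linarith)+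
qed

lemma LB_f0:
  assumes p: "p \<in> S" shows "LB beta (11 * M * kappa) (6 * M * kappa) (f0 p)"
proof -
  have "norm (rh p * mh p) \<le> kappa * 1"
    using norm_rh [OF p] norm_mh [OF p] small by (intro order_trans [OF norm_mult_ineq] mult_mono) auto
  then have "LB beta kappa 0 (\<lambda>w. rh p * mh p)" by (intro LB_const) simp
  from LB_mult [OF this LB_YZ] have 2: "LB beta (kappa * (rho + beta)) kappa (\<lambda>w. (rh p * mh p) * (Yv + snd w))"
    using small by simp
  have "LB beta (\<bar>2\<bar> * (rho * (kappa * (4 * M))) + kappa * (rho + beta) + kappa * M) (\<bar>2\<bar> * (rho * (kappa * (2 * M))) + kappa + kappa * M) (f0 p)"
    unfolding f0_def [abs_def]
    by (intro LB_add LB_diff LB_scaleR 2 LB_Yv_mult LB_rh_mult LB_comp LB_vel p J)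
  then show ?thesis
  proof (rule LB_mono)
    have a: "rho * (kappa * M) \<le> M * kappa" using kappa_bounds(3) small by (simp add: mult_left_le_one_le mult.commute [of kappa])
    have b: "kappa * (rho + beta) \<le> kappa * 2" using small by (intro mult_left_mono) auto
    show "\<bar>2\<bar> * (rho * (kappa * (4 * M))) + kappa * (rho + beta) + kappa * M \<le> 11 * M * kappa"
      using a b kappa_bounds by (simp add: algebra_simps)
    show "\<bar>2\<bar> * (rho * (kappa * (2 * M))) + kappa + kappa * M \<le> 6 * M * kappa"
      using a kappa_bounds by (simp add: algebra_simps)
  qed
qed

lemma LB_g1: "LB beta (2 * rho * beta + beta * beta) (2 * rho + 2 * beta) g1"
proof -
  have "LB beta (\<bar>2\<bar> * (rho * beta) + beta * beta) (\<bar>2\<bar> * (rho * 1) + (beta * 1 + 1 * beta)) g1"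
    unfolding g1_def [abs_def]
    by (intro LB_add LB_scaleR LB_Yv_mult LB_mult LB_snd) (use small in auto)
  then show ?thesis by (rule LB_mono) simp_all
qed

lemma LB_g2:
  assumes p: "p \<in> S" shows "LB beta (6 * M * kappa) (5 * M * kappa) (g2 p)"
proof -
  have "LB beta (kappa * ((rho + beta) * M) + kappa * (4 * M)) (kappa * ((rho + beta) * M + 1 * M) + kappa * (2 * M)) (g2 p)"
    unfolding g2_def [abs_def]
    by (intro LB_diff LB_rh_mult LB_mult LB_YZ LB_comp LB_vel p J) (use small in auto)
  then show ?thesis
  proof (rule LB_mono)
    have "kappa * ((rho + beta) * M) \<le> kappa * (2 * M)"
      using small M(1) by (intro mult_left_mono mult_right_mono) auto
    then show "kappa * ((rho + beta) * M) + kappa * (4 * M) \<le> 6 * M * kappa"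
      "kappa * ((rho + beta) * M + 1 * M) + kappa * (2 * M) \<le> 5 * M * kappa"
      by (simp_all add: algebra_simps)
  qed
qed

lemma LB_sh: "LB beta A L f \<Longrightarrow> 0 \<le> A \<Longrightarrow> 0 \<le> L \<Longrightarrow> LB beta (M * A) (M * L) (\<lambda>w. sh k (f w))"
  by (rule LB_mono [OF LB_linear [OF bounded_linear_sh norm_sh]])
     (use M(5) in \<open>auto intro: mult_right_mono\<close>)

abbreviation "LW \<equiv> 2 * M\<^sup>2 * kappa + 3 * M\<^sup>2 * beta"

lemma LB_W:
  assumes p: "p \<in> S" and f: "LB beta beta 1 f"
  shows "LB beta ((2 * M * kappa + M * beta) * (M * beta)) LW (\<lambda>w. wm (q p w) (sh k (f w)))"
proof -
  have "LB beta ((2 * M * kappa + M * beta) * (M * beta)) ((2 * M * kappa + M * beta) * (M * 1) + (2 * M) * (M * beta)) (\<lambda>w. wm (q p w) (sh k (f w)))"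
    by (intro LB_wm LB_q LB_sh p f) (use small M(1) in auto)
  then show ?thesis
    by (rule LB_mono) (simp_all add: algebra_simps power2_eq_square)
qed

lemma mults:
  assumes "p \<in> S"
  shows "mult_bd M (mC l e p)" "mult_bd M (mD l e p)" "mult_bd M (mU l e p)" "mult_bd M (mV l e p)"
proof -
  have 2: "2 \<le> M" by (rule order_trans [OF _ M(4)]) simp
  have "\<bar>fst p\<bar> \<le> 1" using pS(1) [OF assms] e small by linarith
  then show "mult_bd M (mU l e p)" by (intro mult_bd_mono [OF mult_bd_U M(4)] e)
  show "mult_bd M (mC l e p)" "mult_bd M (mD l e p)" "mult_bd M (mV l e p)"
    by (rule mult_bd_mono [OF mult_bd_C [OF e(3,1)] 2] mult_bd_mono [OF mult_bd_D [OF e(3,1)] 2]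
        mult_bd_mono [OF mult_bd_V [OF e(3,1)] M(4)])+
qed

lemma LB_Mop: "mult_bd M m \<Longrightarrow> LB beta A L f \<Longrightarrow> LB beta (M * A) (M * L) (\<lambda>w. Mop m (f w))"
  by (rule LB_linear [OF bounded_linear_Mop norm_Mop]) (use M(1) in auto)

text \<open>The norm of a pair is at most the sum of the norms of its components, so 1/4 for each
  component yields the contraction constant 1/2.\<close>

lemma T_lip:
  assumes p: "p \<in> S" and w: "norm w \<le> beta" "norm w' \<le> beta"
  shows "norm (T1 p w - T1 p w') \<le> 1/4 * norm (w - w')" "norm (T2 p w - T2 p w') \<le> 1/4 * norm (w - w')"
proof -
  note W = LB_W [OF p LB_fst, folded W1_def] LB_W [OF p LB_snd, folded W2_def]
  let ?A = "(2 * M * kappa + M * beta) * (M * beta)" and ?G = "(2 * rho * beta + beta * beta) + 6 * M * kappa"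
  have "LB beta (M * (11 * M * kappa) + M * ?G + \<bar>1/rho\<bar> * (M * ?A) + \<bar>1/rho\<bar> * (M * ?A))
    (M * (6 * M * kappa) + M * ((2 * rho + 2 * beta) + 5 * M * kappa) + \<bar>1/rho\<bar> * (M * LW) + \<bar>1/rho\<bar> * (M * LW)) (T1 p)"
    unfolding T1_def [abs_def]
    by (intro LB_add LB_diff LB_scaleR LB_Mop mults p LB_f0 LB_g1 LB_g2 W)
  from LB_mono [OF this order_refl, of "1/4"]
  have "LB beta (M * (11 * M * kappa) + M * ?G + \<bar>1/rho\<bar> * (M * ?A) + \<bar>1/rho\<bar> * (M * ?A)) (1/4) (T1 p)"
    using contr small by simp
  then show "norm (T1 p w - T1 p w') \<le> 1/4 * norm (w - w')" by (rule LB_D2 [OF _ w])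
  have "LB beta (M * (11 * M * kappa) + M * ?G + \<bar>1/rho\<bar> * (M * ?A) + \<bar>1/rho\<bar> * (M * ?A))
    (M * (6 * M * kappa) + M * ((2 * rho + 2 * beta) + 5 * M * kappa) + \<bar>1/rho\<bar> * (M * LW) + \<bar>1/rho\<bar> * (M * LW)) (T2 p)"
    unfolding T2_def [abs_def]
    by (intro LB_add LB_diff LB_scaleR LB_Mop mults p LB_f0 LB_g1 LB_g2 W)
  from LB_mono [OF this order_refl, of "1/4"]
  have "LB beta (M * (11 * M * kappa) + M * ?G + \<bar>1/rho\<bar> * (M * ?A) + \<bar>1/rho\<bar> * (M * ?A)) (1/4) (T2 p)"
    using contr small by simp
  then show "norm (T2 p w - T2 p w') \<le> 1/4 * norm (w - w')" by (rule LB_D2 [OF _ w])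
qed

lemma Mop_zero: "mult_bd M m \<Longrightarrow> Mop m 0 = 0"
  by (rule linear_0 [OF bounded_linear.linear [OF bounded_linear_Mop]])

text \<open>At w = 0 the derivative terms and \<open>g1\<close> vanish, and everything left has a
  factor r. Two components of size beta/4 and the contraction constant 1/2 add up to the radius
  beta, so the ball is mapped into itself.\<close>

lemma T_zero:
  assumes p: "p \<in> S"
  shows "norm (T1 p 0) \<le> beta / 4" "norm (T2 p 0) \<le> beta / 4"
proof -
  have z: "norm (0 :: jalg \<times> jalg) \<le> beta" using small by simp
  have W: "W1 p 0 = 0" "W2 p 0 = 0" "g1 0 = 0"
    by (simp_all add: W1_def W2_def g1_def linear_0 [OF bounded_linear.linear [OF bounded_linear_sh]]
        bounded_bilinear.zero_right [OF bounded_bilinear_wm])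
  have f: "norm (Mop m (f0 p 0)) \<le> M * (11 * M * kappa)" if "mult_bd M m" for m
    by (rule order_trans [OF norm_Mop [OF that] mult_left_mono [OF LB_D1 [OF LB_f0 [OF p] z]]]) (use M(1) in auto)
  have g: "norm (Mop m (g2 p 0)) \<le> M * (6 * M * kappa)" if "mult_bd M m" for m
    by (rule order_trans [OF norm_Mop [OF that] mult_left_mono [OF LB_D1 [OF LB_g2 [OF p] z]]]) (use M(1) in auto)
  have eq: "T1 p 0 = Mop (mD l e p) (f0 p 0) - Mop (mC l e p) (g2 p 0)" "T2 p 0 = Mop (mC l e p) (f0 p 0) + Mop (mD l e p) (g2 p 0)"
    by (simp_all add: T1_def T2_def W Mop_zero [OF mults(1) [OF p]] Mop_zero [OF mults(2) [OF p]]
        Mop_zero [OF mults(3) [OF p]] Mop_zero [OF mults(4) [OF p]])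
  have s: "M * (11 * M * kappa) + M * (6 * M * kappa) \<le> beta / 4"
    using self by (simp add: power2_eq_square algebra_simps)
  show "norm (T1 p 0) \<le> beta / 4"
    unfolding eq using f [OF mults(2) [OF p]] g [OF mults(1) [OF p]] s
    by (intro order_trans [OF norm_triangle_ineq4]) linarith
  show "norm (T2 p 0) \<le> beta / 4"
    unfolding eq using f [OF mults(1) [OF p]] g [OF mults(2) [OF p]] s
    by (intro order_trans [OF norm_triangle_ineq]) linarith
qed

definition T where "T p w = (T1 p w, T2 p w)"

lemma T_contraction:
  assumes "p \<in> S" "norm w \<le> beta" "norm w' \<le> beta"
  shows "norm (T p w - T p w') \<le> 1/2 * norm (w - w')"
proof -
  have "norm (T p w - T p w') \<le> norm (T1 p w - T1 p w') + norm (T2 p w - T2 p w')"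
    unfolding T_def diff_Pair by (rule norm_Pair_le)
  then show ?thesis using T_lip [OF assms] by linarith
qed

lemma T_self:
  assumes "p \<in> S" "norm w \<le> beta" shows "norm (T p w) \<le> beta"
proof -
  have "norm (T p w - T p 0) \<le> 1/2 * norm (w - 0)"
    by (rule T_contraction [OF assms]) (use small in simp)
  moreover have "norm (T p 0) \<le> norm (T1 p 0) + norm (T2 p 0)"
    unfolding T_def by (rule norm_Pair_le)
  moreover have "norm (T p w) \<le> norm (T p w - T p 0) + norm (T p 0)"
    using norm_triangle_ineq [of "T p w - T p 0" "T p 0"] by simp
  ultimately show ?thesis using T_zero [OF assms(1)] assms(2) by simp
qed

section \<open>The fixed point and its dependence on the parameters\<close>

definition sol where "sol p = (SOME w. norm w \<le> beta \<and> T p w = w)"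

lemma sol:
  assumes p: "p \<in> S" shows "norm (sol p) \<le> beta" "T p (sol p) = sol p"
proof -
  have "\<exists>!w\<in>cball 0 beta. T p w = w"
  proof (rule Banach_fix [where c = "1/2"])
    show "complete (cball (0 :: jalg \<times> jalg) beta)" by (simp add: complete_eq_closed)
    show "T p ` cball 0 beta \<subseteq> cball 0 beta" using T_self [OF p] by auto
    show "dist (T p x) (T p y) \<le> 1/2 * dist x y" if "x \<in> cball 0 beta" "y \<in> cball 0 beta" for x y
      using T_contraction [OF p, of x y] that by (simp add: dist_norm)
  qed (use small in auto)
  then have "\<exists>w. norm w \<le> beta \<and> T p w = w" by auto
  from someI_ex [OF this] show "norm (sol p) \<le> beta" "T p (sol p) = sol p"
    unfolding sol_def by blast+
qed

definition iter where "iter N p = (T p ^^ N) (0 :: jalg \<times> jalg)"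

lemma iter_Suc: "iter (Suc N) p = T p (iter N p)" and iter_0: "iter 0 p = 0"
  by (simp_all add: iter_def)

lemma norm_iter: "p \<in> S \<Longrightarrow> norm (iter N p) \<le> beta"
  by (induction N) (use small T_self in \<open>auto simp: iter_Suc iter_0\<close>)

lemma iter_sol: "p \<in> S \<Longrightarrow> norm (iter N p - sol p) \<le> beta * (1/2) ^ N"
proof (induction N)
  case 0
  then show ?case using sol(1) by (simp add: iter_0)
next
  case (Suc N)
  have "norm (T p (iter N p) - T p (sol p)) \<le> 1/2 * norm (iter N p - sol p)"
    by (intro T_contraction norm_iter sol Suc.prems)
  then show ?case using Suc sol(2) [OF Suc.prems] by (simp add: iter_Suc)
qed

lemma uniform_limit_iter: "uniform_limit S iter sol sequentially"
  unfolding uniform_limit_iff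
proof (intro allI impI)
  fix d :: real assume "0 < d"
  have "(\<lambda>N. beta * (1/2) ^ N) \<longlonglongrightarrow> beta * 0" by (intro tendsto_intros) simp
  then have "\<forall>\<^sub>F N in sequentially. beta * (1/2) ^ N < d"
    using \<open>0 < d\<close> by (intro order_tendstoD) auto
  then show "\<forall>\<^sub>F N in sequentially. \<forall>p\<in>S. dist (iter N p) (sol p) < d"
  proof eventually_elim
    case (elim N)
    then show ?case using iter_sol le_less_trans unfolding dist_norm by blast
  qed
qed

lemma jcB_Yv: "jcB k e S (\<lambda>p. Yv)"
  unfolding Yv_def by (intro jcB_scaleR jcB_yv)

lemma jcB_rh: "jcB k e S rh" and jcB_mh: "jcB k e S mh"
  unfolding rh_def [abs_def] mh_def [abs_def] by (intro jcB_r jcB_s e)+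

text \<open>\<open>w\<close> is an arbitrary admissible family in the ball, later an iterate. Its
  components are treated separately because \<open>jcB\<close> speaks of families in the algebra and
  not of pairs.\<close>

context
  fixes w assumes w: "\<And>p. p \<in> S \<Longrightarrow> norm (w p) \<le> beta" "jcB k e S (\<lambda>p. fst (w p))" "jcB k e S (\<lambda>p. snd (w p))"
begin

lemma jcB_comp:
  assumes "\<And>i. jetfam k (C * (1/4) ^ tdeg i) S (J i)"
  shows "jcB k e S (\<lambda>p. comp J p (w p))"
  unfolding comp_def
proof (rule jcB_psum [OF convS e(1)])
  show "jcB k e S (\<lambda>p. gJ k e (J i) p)" for i by (rule jcB_gJ [OF e(1) assms])
  show "norm (gJ k e (J i) p) \<le> C' * (1/4) ^ tdeg i" if "p \<in> S" for p i by (rule norm_coeffs [OF assms that])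
  show "jcB k e S (\<lambda>p. (1/R) *\<^sub>R (fst (w p) - Yv * Yv))" "jcB k e S (\<lambda>p. (1/R) *\<^sub>R Yv)" "jcB k e S (\<lambda>p. (1/R) *\<^sub>R (Yv + snd (w p)))"
    by (intro jcB_scaleR jcB_diff jcB_add jcB_mult jcB_Yv w)+
qed (use LB_D1 [OF LB_arg1 w(1)] LB_D1 [OF LB_arg2 w(1)] LB_D1 [OF LB_arg3 w(1)] in auto)

lemma jcB_q: "jcB k e S (\<lambda>p. q p (w p))"
  unfolding q_def by (intro jcB_add jcB_scaleR jcB_mult jcB_rh jcB_mh w jcB_comp J)

lemma jcB_f0: "jcB k e S (\<lambda>p. f0 p (w p))"
  unfolding f0_def vel_def by (intro jcB_add jcB_diff jcB_scaleR jcB_mult jcB_rh jcB_mh jcB_Yv w jcB_comp jcB_q J)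

lemma jcB_g: "jcB k e S (\<lambda>p. g1 (w p) + g2 p (w p))"
  unfolding g1_def g2_def vel_def by (intro jcB_add jcB_diff jcB_scaleR jcB_mult jcB_rh jcB_mh jcB_Yv w jcB_comp jcB_q J)

lemma jcB_Mops:
  assumes "jcB k e S a"
  shows "jcB k e S (\<lambda>p. Mop (mC l e p) (a p))" "jcB k e S (\<lambda>p. Mop (mD l e p) (a p))"
    "jcB k e S (\<lambda>p. Mop (mU l e p) (a p))" "jcB k e S (\<lambda>p. Mop (mV l e p) (a p))"
  using e(1) by (intro jcB_Mop [OF mults(1) assms] jcB_Mop [OF mults(2) assms] jcB_Mop [OF mults(3) assms] jcB_Mop [OF mults(4) assms]
    mC_deriv mD_deriv mU_deriv mV_deriv; simp)+

lemma jcB_T: "jcB k e S (\<lambda>p. fst (T p (w p)))" "jcB k e S (\<lambda>p. snd (T p (w p)))"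
  unfolding T_def fst_conv snd_conv T1_def T2_def W1_def W2_def
  by (intro jcB_add jcB_diff jcB_scaleR jcB_Mops jcB_f0 jcB_g jcB_wm jcB_sh jcB_q w)+

end

lemma jcB_iter: "jcB k e S (\<lambda>p. fst (iter N p)) \<and> jcB k e S (\<lambda>p. snd (iter N p))"
proof (induction N)
  case 0
  then show ?case by (simp add: iter_0 jcB_zero)
next
  case (Suc N)
  then show ?case unfolding iter_Suc by (intro conjI jcB_T norm_iter) auto
qed

lemma jcB_sol: "jcB k e S (\<lambda>p. fst (sol p))" "jcB k e S (\<lambda>p. snd (sol p))"
  by (rule jcB_limit [OF convS conjunct1 [OF jcB_iter] e(1) bounded_linear.uniform_limit [OF bounded_linear_fst uniform_limit_iter]]
      jcB_limit [OF convS conjunct2 [OF jcB_iter] e(1) bounded_linear.uniform_limit [OF bounded_linear_snd uniform_limit_iter]])+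

end

section \<open>The invariance equation\<close>

definition dev :: "real \<Rightarrow> jalg \<Rightarrow> real" where
  "dev t a = (\<Sum>n. real (Suc n) * cf a (Suc n) 0 0 * t ^ n)"

lemma summable_abs_cf_Suc: "summable (\<lambda>n. \<bar>cf a (Suc n) 0 0\<bar>)"
  by (subst summable_Suc_iff) (rule summable_abs_cf)

text \<open>On half of the disc the powers of t absorb the factor n + 1 <= 2^n of the differentiated
  series. This is why the equations are read off for |t| <= 1/2, although the series itself is
  controlled on the whole unit interval.\<close>

lemma summable_cf_half:
  assumes "\<bar>t\<bar> \<le> 1/2" shows "summable (\<lambda>n. norm (real (Suc n) * cf a (Suc n) 0 0 * t ^ n))"
    and "norm (real (Suc n) * cf a (Suc n) 0 0 * t ^ n) \<le> \<bar>cf a (Suc n) 0 0\<bar>"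
proof -
  show *: "norm (real (Suc n) * cf a (Suc n) 0 0 * t ^ n) \<le> \<bar>cf a (Suc n) 0 0\<bar>" for n
  proof -
    have "Suc n \<le> 2 ^ n" by (induction n) auto
    then have n: "real (Suc n) \<le> 2 ^ n" by (metis of_nat_le_iff of_nat_numeral of_nat_power)
    have "real (Suc n) * \<bar>t\<bar> ^ n \<le> 2 ^ n * (1/2) ^ n"
      by (intro mult_mono power_mono assms n) auto
    also have "\<dots> = 1" by (simp add: power_one_over)
    finally have "\<bar>cf a (Suc n) 0 0\<bar> * (real (Suc n) * \<bar>t\<bar> ^ n) \<le> \<bar>cf a (Suc n) 0 0\<bar> * 1"
      by (rule mult_left_mono) simp
    moreover have "norm (real (Suc n) * cf a (Suc n) 0 0 * t ^ n) = \<bar>cf a (Suc n) 0 0\<bar> * (real (Suc n) * \<bar>t\<bar> ^ n)"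
      by (simp only: real_norm_def abs_mult power_abs abs_of_nat mult_ac)
    ultimately show ?thesis by simp
  qed
  show "summable (\<lambda>n. norm (real (Suc n) * cf a (Suc n) 0 0 * t ^ n))"
  proof (rule summable_comparison_test')
    show "summable (\<lambda>n. \<bar>cf a (Suc n) 0 0\<bar>)" by (rule summable_abs_cf_Suc)
    show "norm (norm (real (Suc n) * cf a (Suc n) 0 0 * t ^ n)) \<le> \<bar>cf a (Suc n) 0 0\<bar>" for n
      using * by simp
  qed
qed

lemma abs_dev_le:
  assumes "\<bar>t\<bar> \<le> 1/2" shows "\<bar>dev t a\<bar> \<le> norm a"
proof -
  have "\<bar>dev t a\<bar> \<le> (\<Sum>n. norm (real (Suc n) * cf a (Suc n) 0 0 * t ^ n))"
    unfolding dev_def using summable_norm [OF summable_cf_half(1) [OF assms, of a]] by simp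
  also have "\<dots> \<le> (\<Sum>n. \<bar>cf a (Suc n) 0 0\<bar>)"
    by (rule suminf_le [OF summable_cf_half(2) [OF assms] summable_cf_half(1) [OF assms] summable_abs_cf_Suc])
  also have "\<dots> \<le> norm a"
  proof (rule suminf_le_const [OF summable_abs_cf_Suc])
    fix N
    have "(\<Sum>n<N. \<bar>cf a (Suc n) 0 0\<bar>) = (\<Sum>n\<in>Suc ` {..<N}. \<bar>cf a n 0 0\<bar>)"
      by (simp add: sum.reindex)
    also have "\<dots> \<le> (\<Sum>n\<le>N. \<bar>cf a n 0 0\<bar>)" by (rule sum_mono2) auto
    also have "\<dots> \<le> norm a" by (rule sum_cf_le_norm)
    finally show "(\<Sum>n<N. \<bar>cf a (Suc n) 0 0\<bar>) \<le> norm a" .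
  qed
  finally show ?thesis .
qed

lemma DERIV_ev:
  assumes "\<bar>t\<bar> < 1" shows "((\<lambda>t. ev t a) has_field_derivative dev t a) (at t)"
proof -
  have "summable (\<lambda>n. cf a n 0 0 * 1 ^ n)" by (rule summable_ev) simp
  from termdiffs_strong [OF this, of t] assms show ?thesis
    by (simp add: ev_def [abs_def] dev_def diffs_def del: of_nat_Suc)
qed

text \<open>Multiplying by n + 1 undoes the division inside \<open>wm\<close>; what remains is the
  Cauchy product of q with the derivative of a.\<close>

lemma sum_wm:
  assumes "\<bar>t\<bar> \<le> 1/2"
  shows "(\<lambda>n. real (Suc n) * cf (wm q (sh k a)) n 0 0 * t ^ n) sums (ev t q * dev t a)"
proof -
  have 1: "(\<lambda>n. \<Sum>m\<le>n. (cf q m 0 0 * t ^ m) * (real (Suc (n - m)) * cf a (Suc (n - m)) 0 0 * t ^ (n - m)))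
     sums (ev t q * dev t a)"
    unfolding ev_def dev_def using assms
    by (intro Cauchy_product_sums summable_ev_norm summable_cf_half) auto
  have 2: "(\<Sum>m\<le>n. (cf q m 0 0 * t ^ m) * (real (Suc (n - m)) * cf a (Suc (n - m)) 0 0 * t ^ (n - m))) =
      real (Suc n) * cf (wm q (sh k a)) n 0 0 * t ^ n" for n
  proof -
    have "(\<Sum>m\<le>n. (cf q m 0 0 * t ^ m) * (real (Suc (n - m)) * cf a (Suc (n - m)) 0 0 * t ^ (n - m))) =
       (\<Sum>m\<le>n. (cf q m 0 0 * (real (Suc (n - m)) * cf a (Suc (n - m)) 0 0)) * t ^ n)"
    proof (intro sum.cong refl)
      fix m assume "m \<in> {..n}"
      then have "t ^ n = t ^ m * t ^ (n - m)" by (simp add: power_add [symmetric])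
      then show "(cf q m 0 0 * t ^ m) * (real (Suc (n - m)) * cf a (Suc (n - m)) 0 0 * t ^ (n - m)) =
         (cf q m 0 0 * (real (Suc (n - m)) * cf a (Suc (n - m)) 0 0)) * t ^ n"
        by (simp only: mult_ac)
    qed
    also have "\<dots> = real (Suc n) * cf (wm q (sh k a)) n 0 0 * t ^ n"
      unfolding sum_distrib_right [symmetric] cf_wm_sh00 by simp
    finally show ?thesis .
  qed
  show ?thesis by (rule iffD1 [OF sums_cong [OF 2] 1])
qed

text \<open>The Euler operator t d/dt multiplies the n-th coefficient by n. Applied to the part l y
  of the velocity, this is the origin of sigma.\<close>

lemma sum_theta:
  assumes "\<bar>t\<bar> \<le> 1/2"
  shows "(\<lambda>n. real n * cf a n 0 0 * t ^ n) sums (t * dev t a)"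
proof -
  have "(\<lambda>n. real (Suc n) * cf a (Suc n) 0 0 * t ^ n) sums dev t a"
    unfolding dev_def by (rule summable_sums [OF summable_norm_cancel [OF summable_cf_half(1) [OF assms]]])
  from sums_mult [OF this, of t]
  have "(\<lambda>n. real (Suc n) * cf a (Suc n) 0 0 * t ^ Suc n) sums (t * dev t a)"
    by (simp only: power_Suc mult_ac)
  from sums_Suc [OF this] show ?thesis by simp
qed

context jet_system
begin

section \<open>From coefficients back to differential equations\<close>

definition XX where "XX p = fst (sol p)"
definition ZZ where "ZZ p = snd (sol p)"

lemma norm_XX: "p \<in> S \<Longrightarrow> norm (XX p) \<le> beta" and norm_ZZ: "p \<in> S \<Longrightarrow> norm (ZZ p) \<le> beta"
  unfolding XX_def ZZ_def
  using sol(1) [of p] norm_fst_le [of "fst (sol p)" "snd (sol p)"] norm_snd_le [of "snd (sol p)" "fst (sol p)"] by simp_all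

text \<open>At the entry (0, 0) the bounded multipliers \<open>mU\<close> and \<open>mV\<close>
  become r (n + 1) C and r (n + 1) D again, so the fixed-point equation is the inverse matrix
  applied to the full right-hand sides, and multiplying by the matrix recovers the linear
  system.\<close>

lemma sol_coefficients:
  fixes p n
  defines "sg \<equiv> l * n * fst p"
  defines "f \<equiv> cf (f0 p (sol p)) n 0 0 - fst p / rho * (real (Suc n) * cf (W1 p (sol p)) n 0 0)"
  defines "g \<equiv> cf (g1 (sol p) + g2 p (sol p)) n 0 0 - fst p / rho * (real (Suc n) * cf (W2 p (sol p)) n 0 0)"
  assumes p: "p \<in> S"
  shows "sg * cf (XX p) n 0 0 + cf (ZZ p) n 0 0 = f" "sg * cf (ZZ p) n 0 0 - cf (XX p) n 0 0 = g"
    "cf (XX p) n 0 0 = (sg * f - g) / (1 + sg\<^sup>2)" "cf (ZZ p) n 0 0 = (f + sg * g) / (1 + sg\<^sup>2)"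
proof -
  let ?c = "1 / (1 + sg\<^sup>2)"
  have c: "mC l e p n 0 = ?c" "mD l e p n 0 = sg * ?c" "mU l e p n 0 = fst p * real (Suc n) * ?c"
    "mV l e p n 0 = fst p * real (Suc n) * (sg * ?c)"
    using mU_0 [OF l0, of e p n] mV_0 [OF l0, of e p n] by (simp_all add: mC_0 mD_0 sg_def)
  have X: "XX p = T1 p (sol p)" and Z: "ZZ p = T2 p (sol p)"
    using sol(2) [OF p] unfolding XX_def ZZ_def T_def by (metis fst_conv snd_conv)+
  note cfs = cf_Mop00 [OF mults(1) [OF p]] cf_Mop00 [OF mults(2) [OF p]] cf_Mop00 [OF mults(3) [OF p]] cf_Mop00 [OF mults(4) [OF p]]
  let ?f0 = "cf (f0 p (sol p)) n 0 0" and ?g = "cf (g1 (sol p) + g2 p (sol p)) n 0 0"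
    and ?w1 = "cf (W1 p (sol p)) n 0 0" and ?w2 = "cf (W2 p (sol p)) n 0 0"
  have 1: "cf (XX p) n 0 0 = sg * ?c * ?f0 - ?c * ?g - 1/rho * (fst p * real (Suc n) * (sg * ?c) * ?w1) + 1/rho * (fst p * real (Suc n) * ?c * ?w2)"
    unfolding X T1_def co_simps(2,3) jco_simps cf_scaleR cfs c by simp
  have 2: "cf (ZZ p) n 0 0 = ?c * ?f0 + sg * ?c * ?g - 1/rho * (fst p * real (Suc n) * ?c * ?w1) - 1/rho * (fst p * real (Suc n) * (sg * ?c) * ?w2)"
    unfolding Z T2_def co_simps(2,3) jco_simps cf_scaleR cfs c by simp
  have 3: "cf (XX p) n 0 0 = sg * ?c * f - ?c * g" "cf (ZZ p) n 0 0 = ?c * f + sg * ?c * g"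
    unfolding 1 2 f_def g_def by (simp_all add: algebra_simps del: of_nat_Suc)
  then show X': "cf (XX p) n 0 0 = (sg * f - g) / (1 + sg\<^sup>2)" and Z': "cf (ZZ p) n 0 0 = (f + sg * g) / (1 + sg\<^sup>2)"
    by (simp_all add: diff_divide_distrib add_divide_distrib)
  have "1 + sg\<^sup>2 \<noteq> 0" using zero_le_power2 [of sg] by linarith
  moreover have "sg * (sg * f - g) + (f + sg * g) = f * (1 + sg\<^sup>2)" "sg * (f + sg * g) - (sg * f - g) = g * (1 + sg\<^sup>2)"
    by (simp_all add: algebra_simps power2_eq_square)
  ultimately show "sg * cf (XX p) n 0 0 + cf (ZZ p) n 0 0 = f" "sg * cf (ZZ p) n 0 0 - cf (XX p) n 0 0 = g"
    unfolding X' Z' times_divide_eq_right add_divide_distrib [symmetric] diff_divide_distrib [symmetric] by simp_all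
qed

definition Qf where "Qf p t = ev t (q p (sol p))"

text \<open>After multiplication by t^n and summation, the Euler term l t d/dt and the term from
  \<open>wm\<close> combine into the single velocity factor l y + q in front of the
  derivative.\<close>

lemma sol_function:
  assumes p: "p \<in> S" and t: "\<bar>t\<bar> \<le> 1/2"
  shows "fst p / rho * (l * (rho * t) + Qf p t) * dev t (XX p) + ev t (ZZ p) = ev t (f0 p (sol p))"
    "fst p / rho * (l * (rho * t) + Qf p t) * dev t (ZZ p) - ev t (XX p) = ev t (g1 (sol p) + g2 p (sol p))"
proof -
  have t1: "\<bar>t\<bar> \<le> 1" using t by simp
  have ev: "(\<lambda>n. cf a n 0 0 * t ^ n) sums ev t a" for a
    unfolding ev_def by (rule summable_sums [OF summable_ev [OF t1]])
  have "(\<lambda>n. l * fst p * (real n * cf (XX p) n 0 0 * t ^ n) + cf (ZZ p) n 0 0 * t ^ n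
      + fst p / rho * (real (Suc n) * cf (W1 p (sol p)) n 0 0 * t ^ n)) sums
    (l * fst p * (t * dev t (XX p)) + ev t (ZZ p) + fst p / rho * (Qf p t * dev t (XX p)))"
    unfolding W1_def Qf_def XX_def by (intro sums_add sums_mult sum_theta sum_wm ev t)
  moreover have "l * fst p * (real n * cf (XX p) n 0 0 * t ^ n) + cf (ZZ p) n 0 0 * t ^ n
      + fst p / rho * (real (Suc n) * cf (W1 p (sol p)) n 0 0 * t ^ n) = cf (f0 p (sol p)) n 0 0 * t ^ n" for n
  proof -
    have "l * fst p * (real n * cf (XX p) n 0 0 * t ^ n) + cf (ZZ p) n 0 0 * t ^ n
      + fst p / rho * (real (Suc n) * cf (W1 p (sol p)) n 0 0 * t ^ n) =
      ((l * n * fst p * cf (XX p) n 0 0 + cf (ZZ p) n 0 0) + fst p / rho * (real (Suc n) * cf (W1 p (sol p)) n 0 0)) * t ^ n"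
      by (simp add: algebra_simps del: of_nat_Suc)
    then show ?thesis unfolding sol_coefficients(1) [OF p] by simp
  qed
  ultimately have "(\<lambda>n. cf (f0 p (sol p)) n 0 0 * t ^ n) sums
    (l * fst p * (t * dev t (XX p)) + ev t (ZZ p) + fst p / rho * (Qf p t * dev t (XX p)))" by simp
  from sums_unique2 [OF this ev] show "fst p / rho * (l * (rho * t) + Qf p t) * dev t (XX p) + ev t (ZZ p) = ev t (f0 p (sol p))"
    using small by (simp add: field_simps)
  have "(\<lambda>n. l * fst p * (real n * cf (ZZ p) n 0 0 * t ^ n) - cf (XX p) n 0 0 * t ^ n
      + fst p / rho * (real (Suc n) * cf (W2 p (sol p)) n 0 0 * t ^ n)) sums
    (l * fst p * (t * dev t (ZZ p)) - ev t (XX p) + fst p / rho * (Qf p t * dev t (ZZ p)))"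
    unfolding W2_def Qf_def ZZ_def by (intro sums_add sums_diff sums_mult sum_theta sum_wm ev t)
  moreover have "l * fst p * (real n * cf (ZZ p) n 0 0 * t ^ n) - cf (XX p) n 0 0 * t ^ n
      + fst p / rho * (real (Suc n) * cf (W2 p (sol p)) n 0 0 * t ^ n) = cf (g1 (sol p) + g2 p (sol p)) n 0 0 * t ^ n" for n
  proof -
    have "l * fst p * (real n * cf (ZZ p) n 0 0 * t ^ n) - cf (XX p) n 0 0 * t ^ n
      + fst p / rho * (real (Suc n) * cf (W2 p (sol p)) n 0 0 * t ^ n) =
      ((l * n * fst p * cf (ZZ p) n 0 0 - cf (XX p) n 0 0) + fst p / rho * (real (Suc n) * cf (W2 p (sol p)) n 0 0)) * t ^ n"
      by (simp add: algebra_simps del: of_nat_Suc)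
    then show ?thesis unfolding sol_coefficients(2) [OF p] by simp
  qed
  ultimately have "(\<lambda>n. cf (g1 (sol p) + g2 p (sol p)) n 0 0 * t ^ n) sums
    (l * fst p * (t * dev t (ZZ p)) - ev t (XX p) + fst p / rho * (Qf p t * dev t (ZZ p)))" by simp
  from sums_unique2 [OF this ev] show "fst p / rho * (l * (rho * t) + Qf p t) * dev t (ZZ p) - ev t (XX p) = ev t (g1 (sol p) + g2 p (sol p))"
    using small by (simp add: field_simps)
qed

text \<open>At r = 0 the jet of r may still have its first-order entry, but its value is 0, which
  removes every term with a factor \<open>rh p\<close> from the order-zero equations. As sigma = 0,
  the first equation gives Z = 0; then \<open>g1\<close>, a multiple of Z, vanishes, and the second
  equation gives X = 0.\<close>

lemma sol_zero:
  assumes p: "p \<in> S" and r: "fst p = 0"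
  shows "cf (ZZ p) n 0 0 = 0" "cf (XX p) n 0 0 = 0"
proof -
  have rh: "cf (rh p * a) n 0 0 = 0" for a n
    unfolding cf_mult00 by (rule sum.neutral) (auto simp: rh_def gJ_def co_cj rJ_def r)
  have f: "cf (f0 p (sol p)) n 0 0 = 0" for n
  proof -
    have "f0 p (sol p) = rh p * (2 *\<^sub>R (Yv * vel p (sol p)) - mh p * (Yv + snd (sol p)) + comp JF p (sol p))"
      by (simp add: f0_def algebra_simps)
    then show ?thesis by (simp only: rh)
  qed
  show Z: "cf (ZZ p) n 0 0 = 0" for n
    using sol_coefficients(4) [OF p, of n] by (simp add: r f)
  have g: "cf (g1 (sol p) + g2 p (sol p)) n 0 0 = 0" for n
  proof -
    have "g2 p (sol p) = rh p * ((Yv + snd (sol p)) * comp JH p (sol p) - vel p (sol p))"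
      by (simp add: g2_def algebra_simps)
    then have "cf (g2 p (sol p)) n 0 0 = 0" by (simp only: rh)
    moreover have "cf (a * snd (sol p)) n 0 0 = 0" for a
      using Z unfolding ZZ_def cf_mult00 by simp
    ultimately show ?thesis by (simp add: g1_def)
  qed
  show "cf (XX p) n 0 0 = 0"
    using sol_coefficients(3) [OF p, of n] unfolding g r by simp
qed

definition pr where "pr J p x y z = psum (\<lambda>i. J i 0 0 p) (x / R) (y / R) (z / R)"

definition hx where "hx p y = - (y\<^sup>2) + ev (y / rho) (XX p)"
definition hz where "hz p y = y + ev (y / rho) (ZZ p)"

lemma ev_comp:
  assumes "\<And>i. jetfam k (C * (1/4) ^ tdeg i) S (J i)" and p: "p \<in> S" and y: "\<bar>y\<bar> \<le> rho"
  shows "ev (y / rho) (comp J p (sol p)) = pr J p (hx p y) y (hz p y)"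
proof -
  have t: "\<bar>y / rho\<bar> \<le> 1" using y small by simp
  show ?thesis
    unfolding comp_def pr_def hx_def hz_def
    by (subst ev_psum [OF t norm_coeffs [OF assms(1) p] LB_D1 [OF LB_arg1 sol(1) [OF p]] LB_D1 [OF LB_arg2 sol(1) [OF p]] LB_D1 [OF LB_arg3 sol(1) [OF p]]])
       (use small in \<open>simp add: ev_simps [OF t] ev_gJ Yv_def ev_yv XX_def ZZ_def power2_eq_square\<close>)
qed

lemma ev_rh: "ev t (rh p) = fst p" and ev_mh: "ev t (mh p) = snd p"
  by (simp_all add: rh_def mh_def ev_gJ rJ_def sJ_def)

text \<open>Tangency of the vector field to the graph: \<open>v\<close> is the velocity in y, and
  each slope times \<open>v\<close> equals the velocity of the corresponding coordinate. It follows
  from \<open>sol_function\<close> by moving the contributions of -y^2 and y back to the left-hand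
  side.\<close>

lemma invariance_equation:
  fixes p y
  assumes p: "p \<in> S" and y: "\<bar>y\<bar> \<le> rho / 2"
  defines "x \<equiv> hx p y" and "z \<equiv> hz p y"
  defines "v \<equiv> fst p * (l * y + snd p / 2 + a2 * (z - y) + fst p * pr JG p x y z)"
  shows "(- 2 * y + dev (y / rho) (XX p) / rho) * v = y - (fst p * snd p + 1) * z + fst p * pr JF p x y z"
    "(1 + dev (y / rho) (ZZ p) / rho) * v = x + z\<^sup>2 + fst p * z * pr JH p x y z"
proof -
  have t: "\<bar>y / rho\<bar> \<le> 1" "\<bar>y / rho\<bar> \<le> 1/2" and y': "\<bar>y\<bar> \<le> rho" using y small by (auto simp: field_simps)
  have ry: "rho * (y / rho) = y" using small by simp
  have z: "ev (y / rho) (ZZ p) = z - y" "ev (y / rho) (snd (sol p)) = z - y" by (simp_all add: z_def hz_def ZZ_def)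
  have x: "ev (y / rho) (XX p) = x + y\<^sup>2" by (simp add: x_def hx_def)
  have Yv: "ev (y / rho) Yv = y" using small by (simp add: Yv_def ev_simps [OF t(1)] ev_yv)
  note c = ev_comp [OF J(1) p y', folded x_def z_def] ev_comp [OF J(2) p y', folded x_def z_def] ev_comp [OF J(3) p y', folded x_def z_def]
  have Q: "Qf p (y / rho) = snd p / 2 + a2 * (z - y) + fst p * pr JG p x y z"
    by (simp add: Qf_def q_def ev_simps [OF t(1)] ev_rh ev_mh c z)
  have vel: "ev (y / rho) (vel p (sol p)) = l * y + Qf p (y / rho)"
    by (simp add: vel_def Qf_def ev_simps [OF t(1)] Yv)
  have v: "v = fst p * (l * y + Qf p (y / rho))" by (simp add: v_def Q)
  have f: "ev (y / rho) (f0 p (sol p)) = 2 * y * v - fst p * snd p * z + fst p * pr JF p x y z"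
    by (simp add: f0_def ev_simps [OF t(1)] ev_rh ev_mh c z Yv vel v)
  have g: "ev (y / rho) (g1 (sol p) + g2 p (sol p)) = 2 * y * (z - y) + (z - y)\<^sup>2 + fst p * z * pr JH p x y z - v"
    by (simp add: g1_def g2_def ev_simps [OF t(1)] ev_rh ev_mh c z Yv vel v power2_eq_square)
  note e = sol_function [OF p t(2), unfolded f g ry]
  have "dev (y / rho) (XX p) / rho * v + (z - y) = 2 * y * v - fst p * snd p * z + fst p * pr JF p x y z"
    using e(1) unfolding z v by (simp add: mult_ac)
  then show "(- 2 * y + dev (y / rho) (XX p) / rho) * v = y - (fst p * snd p + 1) * z + fst p * pr JF p x y z"
    by (simp add: algebra_simps)
  have "dev (y / rho) (ZZ p) / rho * v - (x + y\<^sup>2) = 2 * y * (z - y) + (z - y)\<^sup>2 + fst p * z * pr JH p x y z - v"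
    using e(2) unfolding x v by (simp add: mult_ac)
  then show "(1 + dev (y / rho) (ZZ p) / rho) * v = x + z\<^sup>2 + fst p * z * pr JH p x y z"
    by (simp add: algebra_simps power2_eq_square)
qed

lemma DERIV_hx: "\<bar>y\<bar> < rho \<Longrightarrow> (hx p has_field_derivative (- 2 * y + dev (y / rho) (XX p) / rho)) (at y)"
  and DERIV_hz: "\<bar>y\<bar> < rho \<Longrightarrow> (hz p has_field_derivative (1 + dev (y / rho) (ZZ p) / rho)) (at y)"
proof -
  assume "\<bar>y\<bar> < rho"
  then have t: "\<bar>y / rho\<bar> < 1" using small by simp
  have "((\<lambda>y. y / rho) has_field_derivative 1 / rho) (at y)"
    by (intro DERIV_cdivide DERIV_ident)
  note * = DERIV_chain2 [OF DERIV_ev [OF t] this]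
  show "(hx p has_field_derivative (- 2 * y + dev (y / rho) (XX p) / rho)) (at y)"
    unfolding hx_def [abs_def] by (auto intro!: derivative_eq_intros *)
  show "(hz p has_field_derivative (1 + dev (y / rho) (ZZ p) / rho)) (at y)"
    unfolding hz_def [abs_def] by (auto intro!: derivative_eq_intros *)
qed

lemma abs_hx: "p \<in> S \<Longrightarrow> \<bar>y\<bar> < rho \<Longrightarrow> \<bar>hx p y\<bar> < R"
  and abs_hz: "p \<in> S \<Longrightarrow> \<bar>y\<bar> < rho \<Longrightarrow> \<bar>hz p y\<bar> < R"
proof -
  assume p: "p \<in> S" and y: "\<bar>y\<bar> < rho"
  then have t: "\<bar>y / rho\<bar> \<le> 1" using small by simp
  have "\<bar>y\<bar> * \<bar>y\<bar> < rho * rho" using y by (intro mult_strict_mono') auto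
  then have "y\<^sup>2 < rho * rho" by (simp add: power2_eq_square abs_mult [symmetric])
  moreover have "\<bar>ev (y / rho) (XX p)\<bar> \<le> beta" using abs_ev_le [OF t] norm_XX [OF p] order_trans by blast
  ultimately show "\<bar>hx p y\<bar> < R" unfolding hx_def using small(7) zero_le_power2 [of y] by linarith
  have "\<bar>ev (y / rho) (ZZ p)\<bar> \<le> beta" using abs_ev_le [OF t] norm_ZZ [OF p] order_trans by blast
  then show "\<bar>hz p y\<bar> < R" unfolding hz_def using y small(8) by linarith
qed

end

section \<open>Local invariance of graphs\<close>

text \<open>Forward in time the function times exp(-K t) decreases, backward in time the function
  times exp(K t) increases; both start from 0 at \<open>t0\<close>. The interval may contain its
  endpoints, so continuity is used up to the ends and derivatives only inside.\<close>

lemma gronwall_zero: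
  fixes \<phi> :: "real \<Rightarrow> real"
  assumes T: "is_interval T" "t0 \<in> T" "t \<in> T"
    and D: "\<And>t. t \<in> T \<Longrightarrow> (\<phi> has_real_derivative \<phi>' t) (at t within T)"
    and le: "\<And>t. t \<in> T \<Longrightarrow> \<bar>\<phi>' t\<bar> \<le> K * \<phi> t"
    and zero: "\<phi> t0 = 0"
  shows "\<phi> t \<le> 0"
proof -
  have sub: "{a..b} \<subseteq> T" if "a \<in> T" "b \<in> T" for a b
  proof
    fix x assume "x \<in> {a..b}"
    then show "x \<in> T" using mem_is_interval_1_I [OF T(1) that] by simp
  qed
  have at: "(\<phi> has_real_derivative \<phi>' x) (at x)" if "a \<in> T" "b \<in> T" "a < x" "x < b" for a b x
  proof -
    have *: "{a<..<b} \<subseteq> T" using sub [OF that(1,2)] greaterThanLessThan_subseteq_atLeastAtMost_iff [of a b a b] by blast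
    have "x \<in> interior T" by (rule interiorI [OF open_greaterThanLessThan _ *]) (use that(3,4) in simp)
    then have "at x within T = at x" by (rule at_within_interior)
    moreover have "x \<in> T" using \<open>x \<in> interior T\<close> interior_subset by blast
    ultimately show ?thesis using D [of x] by simp
  qed
  have cont: "continuous_on {a..b} \<phi>" if "a \<in> T" "b \<in> T" for a b
    by (rule continuous_on_subset [OF DERIV_continuous_on [OF D] sub [OF that]])
  \<comment> \<open>The sign \<open>s\<close> treats both directions of time at once:
    \<open>s = -1\<close> is used for times after \<open>t0\<close> and \<open>s = 1\<close> for
    times before it.\<close>
  have mono: "s * \<phi> a * exp (s * K * a) \<le> s * \<phi> b * exp (s * K * b)"
    if ab: "a \<in> T" "b \<in> T" "a \<le> b" and s: "\<bar>s\<bar> = 1" "\<And>u v. \<bar>u\<bar> \<le> v \<Longrightarrow> 0 \<le> s * u + s * s * v" for a b s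
  proof (rule DERIV_nonneg_imp_increasing_open [OF ab(3), of "\<lambda>x. s * \<phi> x * exp (s * K * x)"])
    show "continuous_on {a..b} (\<lambda>x. s * \<phi> x * exp (s * K * x))"
      by (intro continuous_intros cont ab)
    fix x assume x: "a < x" "x < b"
    have "((\<lambda>x. s * \<phi> x * exp (s * K * x)) has_real_derivative
        (s * \<phi>' x + s * s * (K * \<phi> x)) * exp (s * K * x)) (at x)"
      by (auto intro!: derivative_eq_intros at [OF ab(1,2) x] simp: algebra_simps)
    moreover have "x \<in> T" by (rule subsetD [OF sub [OF ab(1,2)]]) (use x in simp)
    then have "0 \<le> (s * \<phi>' x + s * s * (K * \<phi> x)) * exp (s * K * x)"
      by (intro mult_nonneg_nonneg s(2) le) auto
    ultimately show "\<exists>y. ((\<lambda>x. s * \<phi> x * exp (s * K * x)) has_real_derivative y) (at x) \<and> 0 \<le> y"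
      by blast
  qed
  show ?thesis
  proof (cases "t0 \<le> t")
    case True
    have "-1 * \<phi> t0 * exp (-1 * K * t0) \<le> -1 * \<phi> t * exp (-1 * K * t)"
      by (rule mono) (use T True in auto)
    then show ?thesis using zero by (simp add: mult_le_0_iff)
  next
    case False
    have "1 * \<phi> t * exp (1 * K * t) \<le> 1 * \<phi> t0 * exp (1 * K * t0)"
      by (rule mono) (use T False in auto)
    then show ?thesis using zero by (simp add: mult_le_0_iff)
  qed
qed

text \<open>The deviation from the graph is measured at the same y, by u = x - h1(y) and w = z -
  h2(y). Its derivative along a solution is the tangency defect, which is bounded by the deviation
  itself, so u^2 + w^2 stays 0. Leaving through the end |y| = nu of the graph means leaving
  \<open>V\<close>.\<close>

lemma graph_locally_invariant:
  fixes f :: "real \<times> real \<times> real \<Rightarrow> real \<times> real \<times> real"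
  assumes V: "open V" "M \<subseteq> V" "\<And>x y z. (x, y, z) \<in> V \<Longrightarrow> \<bar>y\<bar> < \<nu>"
    and M: "\<And>x y z. (x, y, z) \<in> M \<longleftrightarrow> \<bar>y\<bar> < \<nu> \<and> x = h1 y \<and> z = h2 y"
    and D: "\<And>y. \<bar>y\<bar> < \<nu> \<Longrightarrow> (h1 has_field_derivative k1 y) (at y)" "\<And>y. \<bar>y\<bar> < \<nu> \<Longrightarrow> (h2 has_field_derivative k2 y) (at y)"
    and L: "\<And>x y z. (x, y, z) \<in> V \<Longrightarrow> \<bar>fst (f (x, y, z)) - k1 y * fst (snd (f (x, y, z)))\<bar> \<le> L * (\<bar>x - h1 y\<bar> + \<bar>z - h2 y\<bar>)"
      "\<And>x y z. (x, y, z) \<in> V \<Longrightarrow> \<bar>snd (snd (f (x, y, z))) - k2 y * fst (snd (f (x, y, z)))\<bar> \<le> L * (\<bar>x - h1 y\<bar> + \<bar>z - h2 y\<bar>)"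
    and "0 \<le> L"
  shows "locally_invariant f M"
  unfolding locally_invariant_def
proof (intro exI [of _ V] conjI V(1,2) allI impI)
  fix \<gamma> :: "real \<Rightarrow> real \<times> real \<times> real" and T t0
  assume *: "is_interval T \<and> t0 \<in> T \<and> solution_on f \<gamma> T \<and> \<gamma> t0 \<in> M \<and> \<gamma> ` T \<subseteq> V"
  define x where "x t = fst (\<gamma> t)" for t
  define y where "y t = fst (snd (\<gamma> t))" for t
  define z where "z t = snd (snd (\<gamma> t))" for t
  have \<gamma>: "\<gamma> t = (x t, y t, z t)" for t by (simp add: x_def y_def z_def)
  have inV: "(x t, y t, z t) \<in> V" if "t \<in> T" for t using * that \<gamma> by (metis image_subset_iff)
  have dg: "(\<gamma> has_vector_derivative f (\<gamma> t)) (at t within T)" if "t \<in> T" for t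
    using * that by (simp add: solution_on_def)
  have dx: "(x has_real_derivative fst (f (\<gamma> t))) (at t within T)"
    and dy: "(y has_real_derivative fst (snd (f (\<gamma> t)))) (at t within T)"
    and dz: "(z has_real_derivative snd (snd (f (\<gamma> t)))) (at t within T)" if "t \<in> T" for t
    unfolding x_def [abs_def] y_def [abs_def] z_def [abs_def] has_real_derivative_iff_has_vector_derivative
    by (intro bounded_linear.has_vector_derivative [OF bounded_linear_fst]
        bounded_linear.has_vector_derivative [OF bounded_linear_snd] dg that)+
  define u where "u t = x t - h1 (y t)" for t
  define w where "w t = z t - h2 (y t)" for t
  define u' where "u' t = fst (f (\<gamma> t)) - k1 (y t) * fst (snd (f (\<gamma> t)))" for t
  define w' where "w' t = snd (snd (f (\<gamma> t))) - k2 (y t) * fst (snd (f (\<gamma> t)))" for t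
  have du: "(u has_real_derivative u' t) (at t within T)" and dw: "(w has_real_derivative w' t) (at t within T)"
    if "t \<in> T" for t
    unfolding u_def [abs_def] w_def [abs_def] u'_def w'_def
    by (intro DERIV_diff dx dz DERIV_chain2 [OF D(1) dy] DERIV_chain2 [OF D(2) dy] that V(3) [OF inV])+
  have "(u t)\<^sup>2 + (w t)\<^sup>2 \<le> 0" if "t \<in> T" for t
  \<comment> \<open>The constant arises from 2 L (|u| + |w|)^2 <= 4 L (u^2 + w^2).\<close>
  proof (rule gronwall_zero [of T t0 t _ "\<lambda>t. 2 * u t * u' t + 2 * w t * w' t" "4 * L"])
    show "((\<lambda>t. (u t)\<^sup>2 + (w t)\<^sup>2) has_real_derivative 2 * u t * u' t + 2 * w t * w' t) (at t within T)" if "t \<in> T" for t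
      by (auto intro!: derivative_eq_intros du dw that)
    show "\<bar>2 * u t * u' t + 2 * w t * w' t\<bar> \<le> 4 * L * ((u t)\<^sup>2 + (w t)\<^sup>2)" if "t \<in> T" for t
    proof -
      define a where "a = \<bar>u t\<bar>"
      define b where "b = \<bar>w t\<bar>"
      have l: "\<bar>u' t\<bar> \<le> L * (a + b)" "\<bar>w' t\<bar> \<le> L * (a + b)"
        using L [OF inV [OF that]] by (simp_all add: u_def w_def u'_def w'_def \<gamma> a_def b_def)
      have "\<bar>2 * u t * u' t + 2 * w t * w' t\<bar> \<le> 2 * a * \<bar>u' t\<bar> + 2 * b * \<bar>w' t\<bar>"
        by (rule order_trans [OF abs_triangle_ineq]) (simp add: abs_mult a_def b_def)
      also have "\<dots> \<le> 2 * a * (L * (a + b)) + 2 * b * (L * (a + b))"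
        using l by (intro add_mono mult_left_mono) (auto simp: a_def b_def)
      also have "\<dots> = 2 * L * (a + b)\<^sup>2" by (simp add: algebra_simps power2_eq_square)
      also have "\<dots> \<le> 2 * L * (2 * (a\<^sup>2 + b\<^sup>2))"
      proof (rule mult_left_mono)
        have "0 \<le> (a - b)\<^sup>2" by simp
        then show "(a + b)\<^sup>2 \<le> 2 * (a\<^sup>2 + b\<^sup>2)" by (simp add: power2_eq_square algebra_simps)
      qed (use \<open>0 \<le> L\<close> in simp)
      finally show ?thesis by (simp add: a_def b_def distrib_left mult.assoc)
    qed
    show "(u t0)\<^sup>2 + (w t0)\<^sup>2 = 0" using * M by (simp add: u_def w_def \<gamma>)
  qed (use * that in auto)
  then have "u t = 0 \<and> w t = 0" if "t \<in> T" for t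
    using that sum_power2_le_zero_iff by blast
  then show "\<gamma> ` T \<subseteq> M"
    using M V(3) [OF inV] by (auto simp: \<gamma> u_def w_def)
qed

section \<open>Differentiability in the weighted coefficient norm\<close>

text \<open>Differentiability is required for each coefficient separately, but every derivative
  comes with a geometric bound of rate \<open>\<tau>\<close>, uniform in the parameters. On a disc
  with \<open>\<tau> * \<nu> < 1\<close> this is enough for differentiability in the norm of
  \<open>Omega\<close>.\<close>

primrec CG :: "nat \<Rightarrow> real \<Rightarrow> (real \<times> real \<Rightarrow> nat \<Rightarrow> real ^ 2) \<Rightarrow> (real \<times> real) set \<Rightarrow> bool" where
  "CG 0 \<tau> f S \<longleftrightarrow> (\<forall>n. continuous_on S (\<lambda>p. f p n)) \<and> (\<exists>c. \<forall>p\<in>S. \<forall>n. norm (f p n) \<le> c * \<tau> ^ n)"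
| "CG (Suc k) \<tau> f S \<longleftrightarrow> (\<exists>c. \<forall>p\<in>S. \<forall>n. norm (f p n) \<le> c * \<tau> ^ n) \<and>
     (\<exists>g1 g2. (\<forall>n. \<forall>p\<in>S. ((\<lambda>p. f p n) has_derivative (\<lambda>v. fst v *\<^sub>R g1 p n + snd v *\<^sub>R g2 p n)) (at p within S)) \<and>
        CG k \<tau> g1 S \<and> CG k \<tau> g2 S)"

lemma CG_bound: "CG k \<tau> f S \<Longrightarrow> \<exists>c. \<forall>p\<in>S. \<forall>n. norm (f p n) \<le> c * \<tau> ^ n"
  by (cases k) auto

lemma geometric_bound_linear:
  fixes f g :: "real \<times> real \<Rightarrow> nat \<Rightarrow> real ^ 2"
  assumes "\<forall>p\<in>S. \<forall>n. norm (f p n) \<le> c1 * \<tau> ^ n" "\<forall>p\<in>S. \<forall>n. norm (g p n) \<le> c2 * \<tau> ^ n"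
  shows "\<exists>c. \<forall>p\<in>S. \<forall>n. norm (a *\<^sub>R f p n + b *\<^sub>R g p n) \<le> c * \<tau> ^ n"
proof (intro exI ballI allI)
  fix p n assume p: "p \<in> S"
  have "norm (a *\<^sub>R f p n + b *\<^sub>R g p n) \<le> \<bar>a\<bar> * norm (f p n) + \<bar>b\<bar> * norm (g p n)"
    by (rule order_trans [OF norm_triangle_ineq]) simp
  also have "\<dots> \<le> \<bar>a\<bar> * (c1 * \<tau> ^ n) + \<bar>b\<bar> * (c2 * \<tau> ^ n)"
    using assms p by (intro add_mono mult_left_mono) auto
  finally show "norm (a *\<^sub>R f p n + b *\<^sub>R g p n) \<le> (\<bar>a\<bar> * c1 + \<bar>b\<bar> * c2) * \<tau> ^ n"
    by (simp add: algebra_simps)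
qed

lemma CG_linear:
  "CG k \<tau> f S \<Longrightarrow> CG k \<tau> g S \<Longrightarrow> CG k \<tau> (\<lambda>p n. a *\<^sub>R f p n + b *\<^sub>R g p n) S"
proof (induction k arbitrary: f g)
  case 0
  then show ?case using geometric_bound_linear by (auto intro!: continuous_intros)
next
  case (Suc k)
  obtain f1 f2 where f: "\<And>n p. p \<in> S \<Longrightarrow> ((\<lambda>p. f p n) has_derivative (\<lambda>v. fst v *\<^sub>R f1 p n + snd v *\<^sub>R f2 p n)) (at p within S)"
    "CG k \<tau> f1 S" "CG k \<tau> f2 S" using Suc.prems(1) unfolding CG.simps by blast
  obtain g1 g2 where g: "\<And>n p. p \<in> S \<Longrightarrow> ((\<lambda>p. g p n) has_derivative (\<lambda>v. fst v *\<^sub>R g1 p n + snd v *\<^sub>R g2 p n)) (at p within S)"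
    "CG k \<tau> g1 S" "CG k \<tau> g2 S" using Suc.prems(2) unfolding CG.simps by blast
  have bd: "\<exists>c. \<forall>p\<in>S. \<forall>n. norm (a *\<^sub>R f p n + b *\<^sub>R g p n) \<le> c * \<tau> ^ n"
      using CG_bound [OF Suc.prems(1)] CG_bound [OF Suc.prems(2)] geometric_bound_linear by blast
  show ?case unfolding CG.simps
  proof (intro conjI [OF bd] conjI exI allI ballI)
    show "CG k \<tau> (\<lambda>p n. a *\<^sub>R f1 p n + b *\<^sub>R g1 p n) S" "CG k \<tau> (\<lambda>p n. a *\<^sub>R f2 p n + b *\<^sub>R g2 p n) S"
      by (intro Suc.IH f g)+
    fix n p assume p: "p \<in> S"
    have "((\<lambda>p. a *\<^sub>R f p n + b *\<^sub>R g p n) has_derivative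
       (\<lambda>v. a *\<^sub>R (fst v *\<^sub>R f1 p n + snd v *\<^sub>R f2 p n) + b *\<^sub>R (fst v *\<^sub>R g1 p n + snd v *\<^sub>R g2 p n))) (at p within S)"
      by (intro has_derivative_add has_derivative_scaleR_right f g p)
    then show "((\<lambda>p. a *\<^sub>R f p n + b *\<^sub>R g p n) has_derivative
       (\<lambda>v. fst v *\<^sub>R (a *\<^sub>R f1 p n + b *\<^sub>R g1 p n) + snd v *\<^sub>R (a *\<^sub>R f2 p n + b *\<^sub>R g2 p n))) (at p within S)"
      by (simp add: scaleR_add_right mult.commute add_ac)
  qed
qed

lemma Omega_of_bound:
  assumes "\<And>n. norm (h n) \<le> c * \<tau> ^ n" "0 \<le> \<tau>" "0 \<le> \<nu>" "\<tau> * \<nu> < 1"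
  shows "h \<in> Omega \<nu>"
proof -
  have "summable (\<lambda>n. norm (h n) * \<nu> ^ n)"
  proof (rule summable_comparison_test')
    show "summable (\<lambda>n. c * (\<tau> * \<nu>) ^ n)" using assms by (intro summable_mult summable_geometric) auto
    fix n :: nat
    have "norm (h n) * \<nu> ^ n \<le> (c * \<tau> ^ n) * \<nu> ^ n" using assms by (intro mult_right_mono) auto
    then show "norm (norm (h n) * \<nu> ^ n) \<le> c * (\<tau> * \<nu>) ^ n" using assms by (simp add: power_mult_distrib mult_ac)
  qed
  then show ?thesis by (simp add: Omega_def)
qed

text \<open>Dominated convergence for series, in the form of Tannery's theorem with the majorant c
  (tau nu)^n.\<close>

lemma tendsto_suminf_weighted:
  fixes a :: "nat \<Rightarrow> 'b \<Rightarrow> real"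
  assumes "\<And>n. (a n \<longlongrightarrow> 0) F" "\<forall>\<^sub>F q in F. \<forall>n. \<bar>a n q\<bar> \<le> c * \<tau> ^ n" "0 \<le> \<tau>" "0 \<le> \<nu>" "\<tau> * \<nu> < 1"
  shows "((\<lambda>q. \<Sum>n. a n q * \<nu> ^ n) \<longlongrightarrow> 0) F"
proof (cases "F = bot")
  case False
  have "((\<lambda>q. \<Sum>n. a n q * \<nu> ^ n) \<longlongrightarrow> (\<Sum>n::nat. 0)) F"
  proof (rule conjunct2 [OF conjunct2 [OF tannerys_theorem]])
    show "((\<lambda>q. a n q * \<nu> ^ n) \<longlongrightarrow> 0) F" for n
      using tendsto_mult [OF assms(1) tendsto_const, of n "\<nu> ^ n"] by simp
    show "summable (\<lambda>n. c * (\<tau> * \<nu>) ^ n)" using assms by (intro summable_mult summable_geometric) auto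
    \<comment> \<open>The domination is expected along the product filter of n and q; here it holds
      for all n at once.\<close>
    have "eventually (\<lambda>x. True \<and> (\<forall>n. \<bar>a n (snd x)\<bar> \<le> c * \<tau> ^ n)) (at_top \<times>\<^sub>F F)"
      by (rule eventually_prodI) (use assms in auto)
    then show "\<forall>\<^sub>F (n, q) in at_top \<times>\<^sub>F F. norm (a n q * \<nu> ^ n) \<le> c * (\<tau> * \<nu>) ^ n"
    proof (rule eventually_mono)
      fix x :: "nat \<times> 'b" assume *: "True \<and> (\<forall>n. \<bar>a n (snd x)\<bar> \<le> c * \<tau> ^ n)"
      have "\<bar>a (fst x) (snd x)\<bar> * \<nu> ^ fst x \<le> (c * \<tau> ^ fst x) * \<nu> ^ fst x"
        using * assms by (intro mult_right_mono) auto
      then show "case x of (n, q) \<Rightarrow> norm (a n q * \<nu> ^ n) \<le> c * (\<tau> * \<nu>) ^ n"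
        using assms by (simp add: abs_mult power_mult_distrib mult_ac case_prod_unfold)
    qed
  qed (rule False)
  then show ?thesis by simp
qed simp

text \<open>For each coefficient the difference quotient minus the derivative tends to 0. By the
  mean value inequality on the convex set these quantities are bounded by a geometric sequence
  independent of q, so the limit may be taken inside the sum.\<close>

lemma CG_imp_Ck_Omega:
  assumes \<nu>: "0 \<le> \<tau>" "0 \<le> \<nu>" "\<tau> * \<nu> < 1" and S: "convex S"
  shows "CG k \<tau> f S \<Longrightarrow> Ck_Omega_on k \<nu> f S"
proof (induction k arbitrary: f)
  case 0
  then obtain c where c: "\<And>p n. p \<in> S \<Longrightarrow> norm (f p n) \<le> c * \<tau> ^ n" and
    cont: "\<And>n. continuous_on S (\<lambda>p. f p n)" by auto
  have "((\<lambda>q. Omega_norm \<nu> (\<lambda>n. f q n - f p n)) \<longlongrightarrow> 0) (at p within S)" if p: "p \<in> S" for p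
    unfolding Omega_norm_def
  proof (rule tendsto_suminf_weighted [OF _ _ \<nu>])
    show "((\<lambda>q. norm (f q n - f p n)) \<longlongrightarrow> 0) (at p within S)" for n
      using cont [of n] p by (auto simp: continuous_on_def intro!: tendsto_norm_zero LIM_zero)
    have "\<forall>\<^sub>F q in at p within S. q \<in> S" by (simp add: eventually_at_filter)
    then show "\<forall>\<^sub>F q in at p within S. \<forall>n. \<bar>norm (f q n - f p n)\<bar> \<le> (2 * c) * \<tau> ^ n"
    proof (rule eventually_mono, intro allI)
      fix q n assume "q \<in> S"
      then show "\<bar>norm (f q n - f p n)\<bar> \<le> (2 * c) * \<tau> ^ n"
        using c [OF p, of n] c [of q n] norm_triangle_ineq4 [of "f q n" "f p n"] by simp
    qed
  qed
  then show ?case using Omega_of_bound [OF c \<nu>] by simp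
next
  case (Suc k)
  obtain c where c: "\<And>p n. p \<in> S \<Longrightarrow> norm (f p n) \<le> c * \<tau> ^ n" using CG_bound [OF Suc.prems] by blast
  obtain g1 g2 where g: "\<And>n p. p \<in> S \<Longrightarrow> ((\<lambda>p. f p n) has_derivative (\<lambda>v. fst v *\<^sub>R g1 p n + snd v *\<^sub>R g2 p n)) (at p within S)"
    "CG k \<tau> g1 S" "CG k \<tau> g2 S" using Suc.prems unfolding CG.simps by blast
  obtain c1 where c1: "\<And>p n. p \<in> S \<Longrightarrow> norm (g1 p n) \<le> c1 * \<tau> ^ n" using CG_bound [OF g(2)] by blast
  obtain c2 where c2: "\<And>p n. p \<in> S \<Longrightarrow> norm (g2 p n) \<le> c2 * \<tau> ^ n" using CG_bound [OF g(3)] by blast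
  define D where "D p v n = fst v *\<^sub>R g1 p n + snd v *\<^sub>R g2 p n" for p :: "real \<times> real" and v :: "real \<times> real" and n
  have lin: "linear (\<lambda>v. D p v n)" for p n
    unfolding D_def by (rule linearI) (simp_all add: algebra_simps)
  have nD: "norm (D p v n) \<le> (c1 + c2) * \<tau> ^ n * norm v" if p: "p \<in> S" for p v n
  proof -
    have v: "\<bar>fst v\<bar> \<le> norm v" "\<bar>snd v\<bar> \<le> norm v"
      using norm_fst_le [of "fst v" "snd v"] norm_snd_le [of "snd v" "fst v"] by simp_all
    have "norm (D p v n) \<le> \<bar>fst v\<bar> * norm (g1 p n) + \<bar>snd v\<bar> * norm (g2 p n)"
      unfolding D_def by (rule order_trans [OF norm_triangle_ineq]) simp
    also have "\<dots> \<le> norm v * (c1 * \<tau> ^ n) + norm v * (c2 * \<tau> ^ n)"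
      using v c1 c2 p by (intro add_mono mult_mono) auto
    finally show ?thesis by (simp add: algebra_simps)
  qed
  have lip: "norm (f q n - f p n) \<le> (c1 + c2) * \<tau> ^ n * norm (q - p)" if "p \<in> S" "q \<in> S" for p q n
  proof (rule differentiable_bound [OF S _ _ that(2,1), where f = "\<lambda>p. f p n" and f' = "\<lambda>p v. D p v n"])
    show "((\<lambda>p. f p n) has_derivative (\<lambda>v. D x v n)) (at x within S)" if "x \<in> S" for x
      unfolding D_def by (rule g(1) [OF that])
    show "onorm (\<lambda>v. D x v n) \<le> (c1 + c2) * \<tau> ^ n" if "x \<in> S" for x
      by (rule onorm_le [OF nD [OF that]])
  qed
  have "((\<lambda>q. Omega_norm \<nu> (\<lambda>n. f q n - f p n - D p (q - p) n) / norm (q - p)) \<longlongrightarrow> 0) (at p within S)" if p: "p \<in> S" for p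
  proof -
    have inS: "\<forall>\<^sub>F q in at p within S. q \<in> S" by (simp add: eventually_at_filter)
    have b: "norm (f q n - f p n - D p (q - p) n) \<le> (2 * (c1 + c2)) * \<tau> ^ n * norm (q - p)" if "q \<in> S" for q n
      using lip [OF p that, of n] nD [OF p, of "q - p" n] norm_triangle_ineq4 [of "f q n - f p n" "D p (q - p) n"]
      by (simp add: algebra_simps)
    have "((\<lambda>q. \<Sum>n. norm (f q n - f p n - D p (q - p) n) / norm (q - p) * \<nu> ^ n) \<longlongrightarrow> 0) (at p within S)"
    proof (rule tendsto_suminf_weighted [OF _ _ \<nu>])
      show "((\<lambda>q. norm (f q n - f p n - D p (q - p) n) / norm (q - p)) \<longlongrightarrow> 0) (at p within S)" for n
        using g(1) [OF p, of n] unfolding has_derivative_iff_norm D_def by blast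
      show "\<forall>\<^sub>F q in at p within S. \<forall>n. \<bar>norm (f q n - f p n - D p (q - p) n) / norm (q - p)\<bar> \<le> (2 * (c1 + c2)) * \<tau> ^ n"
        using inS
      proof (rule eventually_mono, intro allI)
        fix q n assume q: "q \<in> S"
        have "0 \<le> (2 * (c1 + c2)) * \<tau> ^ n"
          using order_trans [OF norm_ge_zero c1 [OF p, of n]] order_trans [OF norm_ge_zero c2 [OF p, of n]]
          by (simp add: distrib_right mult.assoc)
        then show "\<bar>norm (f q n - f p n - D p (q - p) n) / norm (q - p)\<bar> \<le> (2 * (c1 + c2)) * \<tau> ^ n"
          using b [OF q, of n] by (cases "q = p") (auto simp: divide_le_eq)
      qed
    qed
    moreover have "\<forall>\<^sub>F q in at p within S. (\<Sum>n. norm (f q n - f p n - D p (q - p) n) / norm (q - p) * \<nu> ^ n) =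
        Omega_norm \<nu> (\<lambda>n. f q n - f p n - D p (q - p) n) / norm (q - p)"
      using inS
    proof (rule eventually_mono)
      fix q assume q: "q \<in> S"
      have "(\<lambda>n. f q n - f p n - D p (q - p) n) \<in> Omega \<nu>"
        by (rule Omega_of_bound [OF _ \<nu>, where c = "2 * (c1 + c2) * norm (q - p)"]) (use b [OF q] in \<open>simp add: mult_ac\<close>)
      then have "summable (\<lambda>n. norm (f q n - f p n - D p (q - p) n) * \<nu> ^ n)" by (simp add: Omega_def)
      from suminf_divide [OF this, of "norm (q - p)"]
      show "(\<Sum>n. norm (f q n - f p n - D p (q - p) n) / norm (q - p) * \<nu> ^ n) =
        Omega_norm \<nu> (\<lambda>n. f q n - f p n - D p (q - p) n) / norm (q - p)"
        by (simp add: Omega_norm_def)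
    qed
    ultimately show ?thesis by (rule Lim_transform_eventually)
  qed
  moreover have "Ck_Omega_on k \<nu> (\<lambda>p. D p v) S" for v
    unfolding D_def by (intro Suc.IH CG_linear g)
  ultimately show ?case using Omega_of_bound [OF c \<nu>] lin by (auto intro!: exI [of _ D])
qed

text \<open>\<open>m\<close> counts the orders of differentiation still available at the entry (i,
  j), so the induction climbs from order \<open>k\<close> down to order 0.\<close>

lemma CG_jets:
  assumes "\<And>i j n. i + j \<le> k \<Longrightarrow> continuous_on S (\<lambda>p. J i j p n)"
    and "\<And>i j n p. i + j \<le> k \<Longrightarrow> p \<in> S \<Longrightarrow> norm (J i j p n) \<le> c i j * \<tau> ^ n"
    and "\<And>i j n p. i + j < k \<Longrightarrow> p \<in> S \<Longrightarrow>
      ((\<lambda>p. J i j p n) has_derivative (\<lambda>v. fst v *\<^sub>R J (Suc i) j p n + snd v *\<^sub>R J i (Suc j) p n)) (at p within S)"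
  shows "i + j + m = k \<Longrightarrow> CG m \<tau> (J i j) S"
proof (induction m arbitrary: i j)
  case 0
  then have ij: "i + j \<le> k" by simp
  show ?case unfolding CG.simps
    using assms(1,2) [OF ij] by blast
next
  case (Suc m)
  then have ij: "i + j \<le> k" "i + j < k" by simp_all
  have b: "\<exists>c. \<forall>p\<in>S. \<forall>n. norm (J i j p n) \<le> c * \<tau> ^ n"
    using assms(2) [OF ij(1)] by blast
  show ?case unfolding CG.simps
  proof (intro conjI [OF b] conjI exI ballI allI)
    show "CG m \<tau> (J (Suc i) j) S" "CG m \<tau> (J i (Suc j)) S" using Suc by auto
    show "\<And>n p. p \<in> S \<Longrightarrow> ((\<lambda>p. J i j p n) has_derivative (\<lambda>v. fst v *\<^sub>R J (Suc i) j p n + snd v *\<^sub>R J i (Suc j) p n)) (at p within S)"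
      by (rule assms(3) [OF ij(2)])
  qed
qed

section \<open>Functions with bounded partial derivatives\<close>

text \<open>A single constant bounds all derivatives. It has to be kept explicit because the same
  constant must serve infinitely many Taylor coefficients.\<close>

primrec CB :: "nat \<Rightarrow> real \<Rightarrow> (real \<times> real) set \<Rightarrow> (real \<times> real \<Rightarrow> real) \<Rightarrow> bool" where
  "CB 0 c S f \<longleftrightarrow> continuous_on S f \<and> (\<forall>p\<in>S. \<bar>f p\<bar> \<le> c)"
| "CB (Suc k) c S f \<longleftrightarrow> (\<forall>p\<in>S. \<bar>f p\<bar> \<le> c) \<and>
     (\<exists>f1 f2. (\<forall>p\<in>S. has_partials f (f1 p) (f2 p) p S) \<and>
        CB k c S f1 \<and> CB k c S f2)"

lemma CB_SucI:
  assumes "\<And>p. p \<in> S \<Longrightarrow> \<bar>f p\<bar> \<le> c"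
    "\<And>p. p \<in> S \<Longrightarrow> has_partials f (f1 p) (f2 p) p S"
    "CB k c S f1" "CB k c S f2"
  shows "CB (Suc k) c S f"
  unfolding CB.simps using assms by blast

lemma CB_SucE:
  assumes "CB (Suc k) c S f"
  obtains f1 f2 where "\<And>p. p \<in> S \<Longrightarrow> \<bar>f p\<bar> \<le> c"
    "\<And>p. p \<in> S \<Longrightarrow> has_partials f (f1 p) (f2 p) p S"
    "CB k c S f1" "CB k c S f2"
  using assms unfolding CB.simps by blast

lemma CB_bound: "CB k c S f \<Longrightarrow> p \<in> S \<Longrightarrow> \<bar>f p\<bar> \<le> c"
  by (cases k) auto

lemma CB_cont: "CB k c S f \<Longrightarrow> continuous_on S f"
proof (cases k)
  case (Suc m)
  assume "CB k c S f"
  then show ?thesis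
    unfolding Suc by (rule CB_SucE) (rule has_derivative_continuous_on)
qed simp

lemma CB_mono: "CB k c S f \<Longrightarrow> c \<le> c' \<Longrightarrow> CB k c' S f"
proof (induction k arbitrary: f)
  case 0
  then show ?case unfolding CB.simps using order_trans by blast
next
  case (Suc k)
  from Suc.prems(1) show ?case
  proof (rule CB_SucE)
    fix f1 f2
    assume *: "\<And>p. p \<in> S \<Longrightarrow> \<bar>f p\<bar> \<le> c"
      "\<And>p. p \<in> S \<Longrightarrow> has_partials f (f1 p) (f2 p) p S"
      "CB k c S f1" "CB k c S f2"
    show ?thesis
      by (rule CB_SucI [OF order_trans [OF *(1) Suc.prems(2)] *(2) Suc.IH [OF *(3) Suc.prems(2)] Suc.IH [OF *(4) Suc.prems(2)]])
  qed
qed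

lemma CB_Suc_imp: "CB (Suc k) c S f \<Longrightarrow> CB k c S f"
proof (induction k arbitrary: f)
  case 0
  then show ?case using CB_cont [OF 0] CB_bound [OF 0] unfolding CB.simps(1) by blast
next
  case (Suc k)
  from Suc.prems show ?case
  proof (rule CB_SucE)
    fix f1 f2
    assume *: "\<And>p. p \<in> S \<Longrightarrow> \<bar>f p\<bar> \<le> c"
      "\<And>p. p \<in> S \<Longrightarrow> has_partials f (f1 p) (f2 p) p S"
      "CB (Suc k) c S f1" "CB (Suc k) c S f2"
    show ?thesis
      by (rule CB_SucI [OF *(1,2) Suc.IH [OF *(3)] Suc.IH [OF *(4)]])
  qed
qed

lemma CB_add: "CB k c S f \<Longrightarrow> CB k c' S g \<Longrightarrow> CB k (c + c') S (\<lambda>p. f p + g p)"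
proof (induction k arbitrary: f g)
  case 0
  have "\<bar>f p + g p\<bar> \<le> c + c'" if "p \<in> S" for p
    using CB_bound [OF 0(1) that] CB_bound [OF 0(2) that] by linarith
  then show ?case using 0 unfolding CB.simps by (intro conjI continuous_on_add) blast+
next
  case (Suc k)
  from Suc.prems(1) show ?case
  proof (rule CB_SucE)
    fix f1 f2
    assume f: "\<And>p. p \<in> S \<Longrightarrow> \<bar>f p\<bar> \<le> c"
      "\<And>p. p \<in> S \<Longrightarrow> has_partials f (f1 p) (f2 p) p S"
      "CB k c S f1" "CB k c S f2"
    from Suc.prems(2) show ?thesis
    proof (rule CB_SucE)
      fix g1 g2
      assume g: "\<And>p. p \<in> S \<Longrightarrow> \<bar>g p\<bar> \<le> c'"
        "\<And>p. p \<in> S \<Longrightarrow> has_partials g (g1 p) (g2 p) p S"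
        "CB k c' S g1" "CB k c' S g2"
      show ?thesis
      proof (rule CB_SucI)
        show "\<bar>f p + g p\<bar> \<le> c + c'" if "p \<in> S" for p
          using f(1) [OF that] g(1) [OF that] by linarith
        show "has_partials (\<lambda>p. f p + g p) (f1 p + g1 p) (f2 p + g2 p) p S" if "p \<in> S" for p
          using has_derivative_add [OF f(2) [OF that] g(2) [OF that]] by (simp add: algebra_simps)
      qed (intro Suc.IH f g)+
    qed
  qed
qed

text \<open>\<open>L\<close> stands for one of the two coordinates, which has constant partial
  derivatives and modulus at most 1; each order of differentiation adds one more copy of
  \<open>c\<close>. Such factors come from the chain rule for mu = r mu2.\<close>

lemma CB_mult_coordinate:
  assumes L: "bounded_linear L" "\<And>v. L v = fst v * a + snd v * b" "\<bar>a\<bar> \<le> 1" "\<bar>b\<bar> \<le> 1"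
    and L1: "\<And>p. p \<in> S \<Longrightarrow> \<bar>L p\<bar> \<le> 1" and c: "0 \<le> c"
  shows "CB k c S f \<Longrightarrow> CB k (real (Suc k) * c) S (\<lambda>p. L p * f p)"
proof (induction k arbitrary: f)
  case 0
  have "\<bar>L p * f p\<bar> \<le> 1 * c" if "p \<in> S" for p
    unfolding abs_mult using CB_bound [OF 0 that] L1 [OF that] by (intro mult_mono) auto
  then show ?case using 0 linear_continuous_on [OF L(1)] by (auto intro!: continuous_intros)
next
  case (Suc k)
  have scale: "CB k c S (\<lambda>p. a * g p)" if "CB k c S g" "\<bar>a\<bar> \<le> 1" for g a k
    using that(1)
  proof (induction k arbitrary: g)
    case 0
    have "\<bar>a * g p\<bar> \<le> 1 * c" if "p \<in> S" for p
      unfolding abs_mult using CB_bound [OF 0 that] \<open>\<bar>a\<bar> \<le> 1\<close> by (intro mult_mono) auto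
    then show ?case using 0 by (auto intro!: continuous_intros)
  next
    case (Suc k)
    from Suc.prems show ?case
    proof (rule CB_SucE)
      fix f1 f2
      assume f: "\<And>p. p \<in> S \<Longrightarrow> \<bar>g p\<bar> \<le> c"
        "\<And>p. p \<in> S \<Longrightarrow> has_partials g (f1 p) (f2 p) p S"
        "CB k c S f1" "CB k c S f2"
      show ?thesis
      proof (rule CB_SucI)
        show "\<bar>a * g p\<bar> \<le> c" if "p \<in> S" for p
          using mult_mono [OF \<open>\<bar>a\<bar> \<le> 1\<close> f(1) [OF that]] by (simp add: abs_mult)
        show "has_partials (\<lambda>p. a * g p) (a * f1 p) (a * f2 p) p S" if "p \<in> S" for p
          using has_derivative_mult_right [OF f(2) [OF that], of a] by (simp add: algebra_simps)
      qed (intro Suc.IH f)+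
    qed
  qed
  from Suc.prems show ?case
  proof (rule CB_SucE)
    fix f1 f2
    assume f: "\<And>p. p \<in> S \<Longrightarrow> \<bar>f p\<bar> \<le> c"
      "\<And>p. p \<in> S \<Longrightarrow> has_partials f (f1 p) (f2 p) p S"
      "CB k c S f1" "CB k c S f2"
    have eq: "real (Suc (Suc k)) * c = c + real (Suc k) * c" by (simp add: algebra_simps)
    show ?thesis
    proof (rule CB_SucI)
      fix p assume p: "p \<in> S"
      have "\<bar>L p * f p\<bar> \<le> 1 * c"
        unfolding abs_mult using f(1) [OF p] L1 [OF p] by (intro mult_mono) auto
      also have "\<dots> \<le> real (Suc (Suc k)) * c" using c by (intro mult_right_mono) auto
      finally show "\<bar>L p * f p\<bar> \<le> real (Suc (Suc k)) * c" .
      show "has_partials (\<lambda>p. L p * f p) (a * f p + L p * f1 p) (b * f p + L p * f2 p) p S"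
        using has_derivative_mult [OF bounded_linear_imp_has_derivative [OF L(1)] f(2) [OF p]] L(2)
        by (simp add: algebra_simps)
    next
      show "CB k (real (Suc (Suc k)) * c) S (\<lambda>p. a * f p + L p * f1 p)" "CB k (real (Suc (Suc k)) * c) S (\<lambda>p. b * f p + L p * f2 p)"
        unfolding eq by (intro CB_add scale CB_Suc_imp [OF Suc.prems] Suc.IH f L)+
    qed
  qed
qed

text \<open>Schwarz's theorem on a closed rectangle, boundary included. The second difference over a
  small rectangle near \<open>p\<close> equals its area times \<open>f12\<close> at one point and
  times \<open>f21\<close> at another, by the mean value theorem in the two orders; continuity
  forces equality at \<open>p\<close>.\<close>

lemma mixed_partials_eq:
  fixes f :: "real \<times> real \<Rightarrow> real"
  assumes S: "S = {a..b} \<times> {c..d}" "a < b" "c < d"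
    and f: "\<And>p. p \<in> S \<Longrightarrow> has_partials f (f1 p) (f2 p) p S"
    and f1: "\<And>p. p \<in> S \<Longrightarrow> has_partials f1 (f11 p) (f12 p) p S"
    and f2: "\<And>p. p \<in> S \<Longrightarrow> has_partials f2 (f21 p) (f22 p) p S"
    and cont: "continuous_on S f12" "continuous_on S f21" and p: "p \<in> S"
  shows "f12 p = f21 p"
proof (rule ccontr)
  assume ne: "f12 p \<noteq> f21 p"
  define e where "e = \<bar>f12 p - f21 p\<bar> / 2"
  have "0 < e" using ne by (simp add: e_def)
  obtain \<delta>1 where \<delta>1: "0 < \<delta>1" "\<And>q. q \<in> S \<Longrightarrow> dist q p < \<delta>1 \<Longrightarrow> dist (f12 q) (f12 p) < e"
    using cont(1) p \<open>0 < e\<close> unfolding continuous_on_iff by blast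
  obtain \<delta>2 where \<delta>2: "0 < \<delta>2" "\<And>q. q \<in> S \<Longrightarrow> dist q p < \<delta>2 \<Longrightarrow> dist (f21 q) (f21 p) < e"
    using cont(2) p \<open>0 < e\<close> unfolding continuous_on_iff by blast
  define \<delta> where "\<delta> = min \<delta>1 \<delta>2"
  have "0 < \<delta>" using \<delta>1 \<delta>2 by (simp add: \<delta>_def)
  obtain r s where rs: "p = (r, s)" "a \<le> r" "r \<le> b" "c \<le> s" "s \<le> d"
    using p S by (cases p) auto
  \<comment> \<open>At an endpoint the short interval is placed on the inner side, so the small
    rectangle stays within \<open>S\<close> even when \<open>p\<close> lies on its boundary.\<close>
  have sub: "\<exists>u v. l \<le> u \<and> u < v \<and> v \<le> m \<and> \<bar>u - t\<bar> < \<delta> / 2 \<and> \<bar>v - t\<bar> < \<delta> / 2" if "l < m" "l \<le> t" "t \<le> m" for l m t :: real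
  proof (cases "t < m")
    case True
    define h where "h = min (m - t) (\<delta> / 4)"
    have "0 < h" "h \<le> m - t" "h < \<delta> / 2" using True \<open>0 < \<delta>\<close> unfolding h_def by linarith+
    then show ?thesis using that \<open>0 < \<delta>\<close> by (intro exI [of _ t] exI [of _ "t + h"]) simp
  next
    case False
    define h where "h = min (m - l) (\<delta> / 4)"
    have "0 < h" "h \<le> m - l" "h < \<delta> / 2" using that \<open>0 < \<delta>\<close> unfolding h_def by linarith+
    then show ?thesis using that False \<open>0 < \<delta>\<close> by (intro exI [of _ "t - h"] exI [of _ t]) simp
  qed
  obtain r1 r2 where r12: "a \<le> r1" "r1 < r2" "r2 \<le> b" "\<bar>r1 - r\<bar> < \<delta> / 2" "\<bar>r2 - r\<bar> < \<delta> / 2"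
    using sub [OF S(2) rs(2,3)] by blast
  obtain s1 s2 where s12: "c \<le> s1" "s1 < s2" "s2 \<le> d" "\<bar>s1 - s\<bar> < \<delta> / 2" "\<bar>s2 - s\<bar> < \<delta> / 2"
    using sub [OF S(3) rs(4,5)] by blast
  have near: "(x, y) \<in> S \<and> dist (x, y) p < \<delta>" if "x \<in> {r1..r2}" "y \<in> {s1..s2}" for x y
  proof -
    have "\<bar>x - r\<bar> < \<delta> / 2" "\<bar>y - s\<bar> < \<delta> / 2" using that r12 s12 unfolding atLeastAtMost_iff by linarith+
    moreover have "dist (x, y) p \<le> \<bar>x - r\<bar> + \<bar>y - s\<bar>"
      unfolding rs dist_norm diff_Pair using norm_Pair_le [of "x - r" "y - s"] by simp
    ultimately show ?thesis using that r12 s12 S by auto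
  qed
  have part1: "((\<lambda>x. g (x, y)) has_derivative (\<lambda>h. h * g1 (x, y))) (at x within {r1..r2})"
    if g: "\<And>p. p \<in> S \<Longrightarrow> has_partials g (g1 p) (g2 p) p S" and xy: "x \<in> {r1..r2}" "y \<in> {s1..s2}"
    for g g1 g2 :: "real \<times> real \<Rightarrow> real" and x y
  proof -
    have "((\<lambda>x. g (x, y)) has_derivative (\<lambda>h. fst (h, 0::real) * g1 (x, y) + snd (h, 0) * g2 (x, y))) (at x within {r1..r2})"
    proof (rule has_derivative_in_compose [where f = "\<lambda>x. (x, y)" and g = g])
      show "((\<lambda>x. (x, y)) has_derivative (\<lambda>h. (h, 0))) (at x within {r1..r2})"
        by (auto intro!: derivative_eq_intros)
      show "(g has_derivative (\<lambda>v. fst v * g1 (x, y) + snd v * g2 (x, y))) (at (x, y) within (\<lambda>x. (x, y)) ` {r1..r2})"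
        by (rule has_derivative_subset [OF g]) (use near xy in auto)
    qed
    then show ?thesis by simp
  qed
  have part2: "((\<lambda>y. g (x, y)) has_derivative (\<lambda>h. h * g2 (x, y))) (at y within {s1..s2})"
    if g: "\<And>p. p \<in> S \<Longrightarrow> has_partials g (g1 p) (g2 p) p S" and xy: "x \<in> {r1..r2}" "y \<in> {s1..s2}"
    for g g1 g2 :: "real \<times> real \<Rightarrow> real" and x y
  proof -
    have "((\<lambda>y. g (x, y)) has_derivative (\<lambda>h. fst (0::real, h) * g1 (x, y) + snd (0::real, h) * g2 (x, y))) (at y within {s1..s2})"
    proof (rule has_derivative_in_compose [where f = "\<lambda>y. (x, y)" and g = g])
      show "((\<lambda>y. (x, y)) has_derivative (\<lambda>h. (0, h))) (at y within {s1..s2})"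
        by (auto intro!: derivative_eq_intros)
      show "(g has_derivative (\<lambda>v. fst v * g1 (x, y) + snd v * g2 (x, y))) (at (x, y) within (\<lambda>y. (x, y)) ` {s1..s2})"
        by (rule has_derivative_subset [OF g]) (use near xy in auto)
    qed
    then show ?thesis by simp
  qed
  define \<Delta> where "\<Delta> = f (r2, s2) - f (r2, s1) - (f (r1, s2) - f (r1, s1))"
  have s: "s1 \<in> {s1..s2}" "s2 \<in> {s1..s2}" and r: "r1 \<in> {r1..r2}" "r2 \<in> {r1..r2}" using s12 r12 by auto
  obtain \<xi> where \<xi>: "\<xi> \<in> {r1<..<r2}" "\<Delta> = (r2 - r1) * f1 (\<xi>, s2) - (r2 - r1) * f1 (\<xi>, s1)"
  proof -
    have "\<exists>x\<in>{r1<..<r2}. (f (r2, s2) - f (r2, s1)) - (f (r1, s2) - f (r1, s1)) = (r2 - r1) * f1 (x, s2) - (r2 - r1) * f1 (x, s1)"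
      by (rule mvt_simple [OF r12(2), where f = "\<lambda>x. f (x, s2) - f (x, s1)" and f' = "\<lambda>x h. h * f1 (x, s2) - h * f1 (x, s1)"])
         (intro has_derivative_diff part1 [OF f _ s(2)] part1 [OF f _ s(1)]; simp)
    then show ?thesis using that unfolding \<Delta>_def by blast
  qed
  obtain \<eta> where \<eta>: "\<eta> \<in> {s1<..<s2}" "f1 (\<xi>, s2) - f1 (\<xi>, s1) = (s2 - s1) * f12 (\<xi>, \<eta>)"
    using mvt_simple [OF s12(2), of "\<lambda>y. f1 (\<xi>, y)" "\<lambda>y h. h * f12 (\<xi>, y)"] part2 [OF f1] \<xi>(1) by auto
  obtain \<eta>' where \<eta>': "\<eta>' \<in> {s1<..<s2}" "\<Delta> = (s2 - s1) * f2 (r2, \<eta>') - (s2 - s1) * f2 (r1, \<eta>')"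
  proof -
    have "\<exists>y\<in>{s1<..<s2}. (f (r2, s2) - f (r1, s2)) - (f (r2, s1) - f (r1, s1)) = (s2 - s1) * f2 (r2, y) - (s2 - s1) * f2 (r1, y)"
      by (rule mvt_simple [OF s12(2), where f = "\<lambda>y. f (r2, y) - f (r1, y)" and f' = "\<lambda>y h. h * f2 (r2, y) - h * f2 (r1, y)"])
         (intro has_derivative_diff part2 [OF f r(2)] part2 [OF f r(1)]; simp)
    moreover have "\<Delta> = (f (r2, s2) - f (r1, s2)) - (f (r2, s1) - f (r1, s1))" by (simp add: \<Delta>_def)
    ultimately show ?thesis using that by metis
  qed
  obtain \<xi>' where \<xi>': "\<xi>' \<in> {r1<..<r2}" "f2 (r2, \<eta>') - f2 (r1, \<eta>') = (r2 - r1) * f21 (\<xi>', \<eta>')"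
    using mvt_simple [OF r12(2), of "\<lambda>x. f2 (x, \<eta>')" "\<lambda>x h. h * f21 (x, \<eta>')"] part1 [OF f2] \<eta>'(1) by auto
  have "\<Delta> = (r2 - r1) * ((s2 - s1) * f12 (\<xi>, \<eta>))"
    unfolding \<xi>(2) right_diff_distrib [symmetric] \<eta>(2) ..
  moreover have "\<Delta> = (s2 - s1) * ((r2 - r1) * f21 (\<xi>', \<eta>'))"
    unfolding \<eta>'(2) right_diff_distrib [symmetric] \<xi>'(2) ..
  ultimately have eq: "f12 (\<xi>, \<eta>) = f21 (\<xi>', \<eta>')" using r12(2) s12(2) by simp
  have "dist (f12 (\<xi>, \<eta>)) (f12 p) < e" "dist (f21 (\<xi>', \<eta>')) (f21 p) < e"
    using near [of \<xi> \<eta>] near [of \<xi>' \<eta>'] \<xi>(1) \<eta>(1) \<xi>'(1) \<eta>'(1) by (auto intro!: \<delta>1(2) \<delta>2(2) simp: \<delta>_def)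
  then have "dist (f12 p) (f21 p) < e + e"
    unfolding eq by (metis dist_triangle_less_add dist_commute)
  then show False by (simp add: e_def dist_real_def)
qed

definition derivative_family :: "nat \<Rightarrow> real \<Rightarrow> (real \<times> real) set \<Rightarrow> (nat \<Rightarrow> nat \<Rightarrow> real \<times> real \<Rightarrow> real) \<Rightarrow> bool" where
  "derivative_family k c S N \<longleftrightarrow>
     (\<forall>i j. i + j \<le> k \<longrightarrow> continuous_on S (N i j)) \<and>
     (\<forall>i j. \<forall>p\<in>S. i + j \<le> k \<longrightarrow> \<bar>N i j p\<bar> \<le> c) \<and>
     (\<forall>i j. \<forall>p\<in>S. i + j < k \<longrightarrow> has_partials (N i j) (N (Suc i) j p) (N i (Suc j) p) p S)"

lemma derivative_family_cont: "derivative_family k c S N \<Longrightarrow> i + j \<le> k \<Longrightarrow> continuous_on S (N i j)"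
  unfolding derivative_family_def by blast

lemma derivative_family_bound: "derivative_family k c S N \<Longrightarrow> i + j \<le> k \<Longrightarrow> p \<in> S \<Longrightarrow> \<bar>N i j p\<bar> \<le> c"
  unfolding derivative_family_def by blast

lemma derivative_family_deriv: "derivative_family k c S N \<Longrightarrow> i + j < k \<Longrightarrow> p \<in> S \<Longrightarrow> has_partials (N i j) (N (Suc i) j p) (N i (Suc j) p) p S"
  unfolding derivative_family_def by blast

text \<open>\<open>CB\<close> provides a binary tree of derivatives in which the order of
  differentiation matters. The family uses the branch of \<open>f1\<close> for \<open>i > 0\<close>
  and that of \<open>f2\<close> for \<open>i = 0\<close>. The branches must agree where an entry
  with \<open>i = 0\<close> is differentiated in the first variable; \<open>sym\<close> proves this
  by moving that derivative past one second-variable derivative at a time.\<close>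

lemma CB_imp_derivative_family:
  assumes S: "S = {a..b} \<times> {c..d}" "a < b" "c < d"
  shows "CB k C S f \<Longrightarrow> \<exists>N. N 0 0 = f \<and> derivative_family k C S N"
proof (induction k arbitrary: f)
  case 0
  then show ?case by (intro exI [of _ "\<lambda>i j. f"]) (auto simp: derivative_family_def)
next
  case (Suc k)
  from Suc.prems show ?case
  proof (rule CB_SucE)
    fix f1 f2
    assume f: "\<And>p. p \<in> S \<Longrightarrow> \<bar>f p\<bar> \<le> C"
      "\<And>p. p \<in> S \<Longrightarrow> has_partials f (f1 p) (f2 p) p S"
      "CB k C S f1" "CB k C S f2"
    obtain A where A: "A 0 0 = f1" "derivative_family k C S A" using Suc.IH [OF f(3)] by blast
    obtain B where B: "B 0 0 = f2" "derivative_family k C S B" using Suc.IH [OF f(4)] by blast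
    define N where "N i j = (case i of 0 \<Rightarrow> (case j of 0 \<Rightarrow> f | Suc j' \<Rightarrow> B 0 j') | Suc i' \<Rightarrow> A i' j)" for i j
    have N: "N 0 0 = f" "\<And>j. N 0 (Suc j) = B 0 j" "\<And>i j. N (Suc i) j = A i j" by (simp_all add: N_def)
    have sym: "Suc j \<le> k \<Longrightarrow> p \<in> S \<Longrightarrow> A 0 (Suc j) p = B 1 j p" for j p
    proof (induction j arbitrary: p)
      case 0
      show ?case
      proof (rule mixed_partials_eq [OF S f(2) _ _ _ _ 0(2)])
        show "has_partials f1 (A 1 0 p) (A 0 (Suc 0) p) p S" if "p \<in> S" for p
          using derivative_family_deriv [OF A(2), of 0 0 p] 0 that by (simp add: A(1))
        show "has_partials f2 (B 1 0 p) (B 0 1 p) p S" if "p \<in> S" for p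
          using derivative_family_deriv [OF B(2), of 0 0 p] 0 that by (simp add: B(1))
      qed (use 0 in \<open>auto intro!: derivative_family_cont [OF A(2)] derivative_family_cont [OF B(2)]\<close>)
    next
      case (Suc j)
      have d: "has_partials (B 0 j) (A 0 (Suc j) p) (B 0 (Suc j) p) p S" if "p \<in> S" for p
        using derivative_family_deriv [OF B(2), of 0 j p] Suc.IH [of p] Suc.prems that by simp
      show ?case
      proof (rule mixed_partials_eq [OF S d _ _ _ _ Suc.prems(2)])
        show "has_partials (A 0 (Suc j)) (A 1 (Suc j) p) (A 0 (Suc (Suc j)) p) p S" if "p \<in> S" for p
          using derivative_family_deriv [OF A(2), of 0 "Suc j" p] Suc.prems that by simp
        show "has_partials (B 0 (Suc j)) (B 1 (Suc j) p) (B 0 (Suc (Suc j)) p) p S" if "p \<in> S" for p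
          using derivative_family_deriv [OF B(2), of 0 "Suc j" p] Suc.prems that by simp
      qed (use Suc.prems in \<open>auto intro!: derivative_family_cont [OF A(2)] derivative_family_cont [OF B(2)]\<close>)
    qed
    have "derivative_family (Suc k) C S N"
      unfolding derivative_family_def
    proof (intro conjI allI impI ballI)
      fix i j assume ij: "i + j \<le> Suc k"
      show "continuous_on S (N i j)"
      proof (cases i)
        case 0
        then show ?thesis using ij CB_cont [OF Suc.prems] derivative_family_cont [OF B(2)] by (cases j) (auto simp: N)
      next
        case (Suc i')
        then show ?thesis using ij derivative_family_cont [OF A(2)] by (simp add: N)
      qed
      fix p assume p: "p \<in> S"
      show "\<bar>N i j p\<bar> \<le> C"
      proof (cases i)
        case 0
        then show ?thesis using ij f(1) [OF p] derivative_family_bound [OF B(2) _ p] by (cases j) (auto simp: N)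
      next
        case (Suc i')
        then show ?thesis using ij derivative_family_bound [OF A(2) _ p] by (simp add: N)
      qed
    next
      fix i j p assume p: "p \<in> S" and ij: "i + j < Suc k"
      show "has_partials (N i j) (N (Suc i) j p) (N i (Suc j) p) p S"
      proof (cases i)
        case 0
        show ?thesis
        proof (cases j)
          case 0
          then show ?thesis using f(2) [OF p] A(1) B(1) \<open>i = 0\<close> by (simp add: N)
        next
          case (Suc j')
          then show ?thesis using derivative_family_deriv [OF B(2), of 0 j' p] ij p sym [of j' p] \<open>i = 0\<close> by (simp add: N)
        qed
      next
        case (Suc i')
        then show ?thesis using derivative_family_deriv [OF A(2), of i' j p] ij p by (simp add: N)
      qed
    qed
    then show ?thesis using N(1) by blast
  qed
qed

lemma CB_imp_jetfam:
  assumes S: "S = {a..b} \<times> {c..d}" "a < b" "c < d" and f: "CB k C S f"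
  shows "\<exists>J. J 0 0 = f \<and> jetfam k C S J"
proof -
  obtain N where N: "N 0 0 = f" "derivative_family k C S N" using CB_imp_derivative_family [OF S f] by blast
  define J where "J i j p = N i j p / (fact i * fact j)" for i j p
  have "jetfam k C S J"
    unfolding jetfam_def
  proof (intro conjI allI impI ballI)
    fix i j assume ij: "i + j \<le> k"
    show "continuous_on S (J i j)"
      unfolding J_def [abs_def] by (intro continuous_intros derivative_family_cont [OF N(2) ij]) auto
    fix p assume p: "p \<in> S"
    have "1 * 1 \<le> fact i * (fact j :: real)" by (intro mult_mono) auto
    then have "\<bar>J i j p\<bar> \<le> \<bar>N i j p\<bar> / 1"
      unfolding J_def abs_divide by (intro divide_left_mono) (auto simp: abs_mult)
    then show "\<bar>J i j p\<bar> \<le> C" using derivative_family_bound [OF N(2) ij p] by simp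
  next
    fix i j p assume p: "p \<in> S" and ij: "i + j < k"
    have "((\<lambda>p. 1 / (fact i * fact j) * N i j p) has_derivative
       (\<lambda>v. 1 / (fact i * fact j) * (fst v * N (Suc i) j p + snd v * N i (Suc j) p))) (at p within S)"
      by (intro has_derivative_mult_right derivative_family_deriv [OF N(2) ij p])
    moreover have "1 / (fact i * fact j) * (fst v * N (Suc i) j p + snd v * N i (Suc j) p) =
      fst v * (real (Suc i) * J (Suc i) j p) + snd v * (real (Suc j) * J i (Suc j) p)" for v :: "real \<times> real"
    proof -
      have "real (Suc n) * (x / (real (Suc n) * y)) = x / y" for x y n by simp
      then show ?thesis
        by (simp add: J_def fact_Suc add_divide_distrib mult.assoc mult.left_commute [of "fact i" "real (Suc j)"] del: of_nat_Suc)
    qed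
    ultimately show "has_partials (J i j) (real (Suc i) * J (Suc i) j p) (real (Suc j) * J i (Suc j) p) p S"
      by (simp add: J_def [abs_def])
  qed
  moreover have "J 0 0 = f" by (simp add: J_def [abs_def] N(1))
  ultimately show ?thesis by blast
qed

section \<open>Taylor expansion of the nonlinearities\<close>

definition circ :: "real \<Rightarrow> complex" where "circ t = exp (2 * of_real pi * \<i> * of_real t)"

lemma norm_circ [simp]: "norm (circ t) = 1"
  by (simp add: circ_def norm_exp_eq_Re)

lemma circ_nonzero [simp]: "circ t \<noteq> 0"
  by (simp add: circ_def)

lemma continuous_on_circ [continuous_intros]: "continuous_on A f \<Longrightarrow> continuous_on A (\<lambda>x. circ (f x))"
  unfolding circ_def by (intro continuous_intros)

abbreviation cube :: "(real \<times> real \<times> real) set" where "cube \<equiv> cbox (0, 0, 0) (1, 1, 1)"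

text \<open>A point of the torus of radius \<open>Q\<close>, the distinguished boundary of a
  polydisc, together with the parameters r and mu = r mu2.\<close>

definition PT :: "real \<Rightarrow> real \<times> real \<times> real \<Rightarrow> real \<times> real \<Rightarrow> complex \<times> complex \<times> complex \<times> real \<times> real" where
  "PT Q \<theta> p = (of_real Q * circ (fst \<theta>), of_real Q * circ (fst (snd \<theta>)), of_real Q * circ (snd (snd \<theta>)), fst p, fst p * snd p)"

abbreviation SR :: "real \<Rightarrow> (real \<times> real) set" where "SR R \<equiv> {0..R} \<times> {-1..1}"

lemma PT_in_box:
  assumes "0 < Q" "Q < \<rho>" "R < \<rho>" "p \<in> SR R"
  shows "PT Q \<theta> p \<in> complex_box \<rho>"
proof -
  have "\<bar>fst p * snd p\<bar> \<le> R * 1"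
    unfolding abs_mult using assms by (intro mult_mono) (auto simp: mem_Times_iff)
  then show ?thesis
    using assms by (simp add: PT_def complex_box_def norm_mult mem_Times_iff)
qed

definition adm :: "(real \<times> real \<times> real \<Rightarrow> complex) \<Rightarrow> bool" where
  "adm e \<longleftrightarrow> continuous_on cube e \<and> (\<forall>\<theta>\<in>cube. norm (e \<theta>) \<le> 1)"

text \<open>With the weight \<open>mono_e i\<close> this is the real part of a Taylor coefficient
  times \<open>Q ^ tdeg i\<close>. The weight does not involve the parameters, so differentiation in
  them reproduces an integral of the same kind.\<close>

definition IE where
  "IE Q \<Psi> e p = integral cube (\<lambda>\<theta>. Re (\<Psi> (PT Q \<theta> p) * e \<theta>))"

lemma continuous_on_slice:
  assumes "continuous_on (A \<times> B) f" "p \<in> A" shows "continuous_on B (\<lambda>y. f (p, y))"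
  by (rule continuous_on_compose2 [OF assms(1)]) (use assms(2) in \<open>auto intro!: continuous_intros\<close>)

lemma Ck_on_imp_continuous: "Ck_on k f S \<Longrightarrow> continuous_on S f"
proof (cases k)
  case (Suc m)
  assume "Ck_on k f S"
  then obtain D where "\<forall>p\<in>S. (f has_derivative D p) (at p within S)" unfolding Suc Ck_on.simps by blast
  then show ?thesis by (intro has_derivative_continuous_on) blast
qed simp

context
  fixes Q \<rho> R :: real
  assumes QR: "0 < Q" "Q < \<rho>" "0 < R" "R < \<rho>" "R \<le> 1"
begin

lemma continuous_PT:
  assumes "continuous_on (complex_box \<rho>) \<Psi>" "A \<subseteq> SR R \<times> UNIV"
  shows "continuous_on A (\<lambda>x. \<Psi> (PT Q (snd x) (fst x)))"
proof (rule continuous_on_compose2 [OF assms(1)])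
  show "continuous_on A (\<lambda>x. PT Q (snd x) (fst x))"
    unfolding PT_def by (intro continuous_intros)
  show "(\<lambda>x. PT Q (snd x) (fst x)) ` A \<subseteq> complex_box \<rho>"
  proof (rule image_subsetI)
    fix x assume "x \<in> A"
    then have "x \<in> SR R \<times> UNIV" by (rule subsetD [OF assms(2)])
    then have "fst x \<in> SR R" unfolding mem_Times_iff [of x] by (rule conjunct1)
    then show "PT Q (snd x) (fst x) \<in> complex_box \<rho>" using PT_in_box QR by simp
  qed
qed

lemma continuous_IE_integrand:
  assumes "continuous_on (complex_box \<rho>) \<Psi>" "adm e"
  shows "continuous_on (SR R \<times> cube) (\<lambda>x. Re (\<Psi> (PT Q (snd x) (fst x)) * e (snd x)))"
proof -
  have "continuous_on (SR R \<times> cube) (\<lambda>x. e (snd x))"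
    by (rule continuous_on_compose2 [of cube e]) (use assms(2) in \<open>auto simp: adm_def intro!: continuous_intros\<close>)
  then show ?thesis by (intro continuous_intros continuous_PT assms(1)) auto
qed

lemma IE_integrable:
  assumes "continuous_on (complex_box \<rho>) \<Psi>" "adm e" "p \<in> SR R"
  shows "(\<lambda>\<theta>. Re (\<Psi> (PT Q \<theta> p) * e \<theta>)) integrable_on cube"
proof (rule integrable_continuous)
  show "continuous_on cube (\<lambda>\<theta>. Re (\<Psi> (PT Q \<theta> p) * e \<theta>))"
    using continuous_on_slice [OF continuous_IE_integrand [OF assms(1,2)] assms(3)] unfolding fst_conv snd_conv .
qed

lemma IE_continuous:
  assumes "continuous_on (complex_box \<rho>) \<Psi>" "adm e"
  shows "continuous_on (SR R) (IE Q \<Psi> e)"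
  unfolding IE_def [abs_def]
  by (rule integral_continuous_on_param) (use continuous_IE_integrand [OF assms] in \<open>simp add: case_prod_unfold\<close>)

lemma IE_bound:
  assumes "continuous_on (complex_box \<rho>) \<Psi>"
  shows "\<exists>c\<ge>0. \<forall>e. adm e \<longrightarrow> (\<forall>p\<in>SR R. \<bar>IE Q \<Psi> e p\<bar> \<le> c)"
proof -
  have "compact ((\<lambda>x. \<Psi> (PT Q (snd x) (fst x))) ` (SR R \<times> cube))"
    by (intro compact_continuous_image continuous_PT assms compact_Times compact_Icc compact_cbox) auto
  then obtain B where B: "\<And>x. x \<in> SR R \<times> cube \<Longrightarrow> norm (\<Psi> (PT Q (snd x) (fst x))) \<le> B"
    by (meson bounded_iff compact_imp_bounded imageI)
  have "0 \<le> B" using order_trans [OF norm_ge_zero B [of "((0,0),(0,0,0))"]] QR by auto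
  have "\<bar>IE Q \<Psi> e p\<bar> \<le> B" if e: "adm e" and p: "p \<in> SR R" for e p
  proof -
    have "norm (IE Q \<Psi> e p) \<le> B * measure lborel cube"
    proof (rule has_integral_bound [OF \<open>0 \<le> B\<close>])
      show "((\<lambda>\<theta>. Re (\<Psi> (PT Q \<theta> p) * e \<theta>)) has_integral IE Q \<Psi> e p) cube"
        unfolding IE_def by (rule integrable_integral [OF IE_integrable [OF assms e p]])
      fix \<theta> assume \<theta>: "\<theta> \<in> cube"
      have "norm (Re (\<Psi> (PT Q \<theta> p) * e \<theta>)) \<le> norm (\<Psi> (PT Q \<theta> p)) * norm (e \<theta>)"
        using abs_Re_le_cmod [of "\<Psi> (PT Q \<theta> p) * e \<theta>"] by (simp add: norm_mult)
      also have "\<dots> \<le> B * 1"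
        using B [of "(p, \<theta>)"] p \<theta> e \<open>0 \<le> B\<close> by (intro mult_mono) (auto simp: adm_def)
      finally show "norm (Re (\<Psi> (PT Q \<theta> p) * e \<theta>)) \<le> B" by simp
    qed
    also have "measure lborel cube = 1" by (simp add: content_Pair)
    finally show ?thesis by simp
  qed
  then show ?thesis using \<open>0 \<le> B\<close> by blast
qed

lemma PT_deriv:
  "((\<lambda>p. PT Q \<theta> p) has_derivative (\<lambda>v. (0, 0, 0, fst v, fst p * snd v + fst v * snd p))) (at p within S)"
  unfolding PT_def by (auto intro!: derivative_eq_intros)

text \<open>Differentiation under the integral, with the chain rule through (r, r mu2): the
  derivative in r is D4 + mu2 D5 and that in mu2 is r D5, where D4 and D5 are the partial
  derivatives in r and mu.\<close>

lemma IE_deriv: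
  assumes D: "\<And>p. p \<in> complex_box \<rho> \<Longrightarrow> (\<Psi> has_derivative D p) (at p within complex_box \<rho>)"
    and cD: "\<And>v. continuous_on (complex_box \<rho>) (\<lambda>p. D p v)" and e: "adm e" and p: "p \<in> SR R"
  defines "\<Psi>4 \<equiv> \<lambda>p. D p (0, 0, 0, 1, 0)" and "\<Psi>5 \<equiv> \<lambda>p. D p (0, 0, 0, 0, 1)"
  shows "(IE Q \<Psi> e has_derivative (\<lambda>v. fst v * (IE Q \<Psi>4 e p + snd p * IE Q \<Psi>5 e p) + snd v * (fst p * IE Q \<Psi>5 e p))) (at p within SR R)"
proof -
  define A4 where "A4 p \<theta> = Re (\<Psi>4 (PT Q \<theta> p) * e \<theta>)" for p \<theta>
  define A5 where "A5 p \<theta> = Re (\<Psi>5 (PT Q \<theta> p) * e \<theta>)" for p \<theta>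
  \<comment> \<open>The Leibniz rule takes the derivative as a continuous family of bounded linear
    maps, hence a combination of the two projections with continuous coefficients.\<close>
  define fx where "fx p \<theta> = (A4 p \<theta> + snd p * A5 p \<theta>) *\<^sub>R (fst_blinfun :: (real \<times> real) \<Rightarrow>\<^sub>L real) + (fst p * A5 p \<theta>) *\<^sub>R snd_blinfun" for p \<theta>
  have app: "blinfun_apply (fx p \<theta>) v = (A4 p \<theta> + snd p * A5 p \<theta>) * fst v + (fst p * A5 p \<theta>) * snd v" for p \<theta> v
    by (simp add: fx_def blinfun.add_left blinfun.scaleR_left)
  have c45: "continuous_on (complex_box \<rho>) \<Psi>4" "continuous_on (complex_box \<rho>) \<Psi>5"
    unfolding \<Psi>4_def \<Psi>5_def by (rule cD)+
  have cont: "continuous_on (SR R \<times> cube) (\<lambda>x. A4 (fst x) (snd x))" "continuous_on (SR R \<times> cube) (\<lambda>x. A5 (fst x) (snd x))"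
    unfolding A4_def A5_def by (intro continuous_IE_integrand c45 e)+
  have int: "A4 q integrable_on cube" "A5 q integrable_on cube" if "q \<in> SR R" for q
    unfolding A4_def A5_def by (intro IE_integrable c45 e that)+
  have cfx: "continuous_on (SR R \<times> cube) (\<lambda>(p, \<theta>). fx p \<theta>)"
    unfolding fx_def case_prod_unfold by (intro continuous_intros cont)
  have c\<Psi>: "continuous_on (complex_box \<rho>) \<Psi>" using has_derivative_continuous_on [OF D] .
  have lr: "(IE Q \<Psi> e has_derivative integral cube (fx p)) (at p within SR R)"
    unfolding IE_def [abs_def]
  proof (rule leibniz_rule [OF _ _ cfx p])
    show "convex (SR R)" by (intro convex_Times convex_real_interval)
    show "(\<lambda>\<theta>. Re (\<Psi> (PT Q \<theta> q) * e \<theta>)) integrable_on cube" if "q \<in> SR R" for q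
      by (rule IE_integrable [OF c\<Psi> e that])
    fix q \<theta> assume q: "q \<in> SR R" and \<theta>: "\<theta> \<in> cube"
    have inb: "PT Q \<theta> q' \<in> complex_box \<rho>" if "q' \<in> SR R" for q' using PT_in_box that QR by simp
    have "((\<lambda>q. \<Psi> (PT Q \<theta> q)) has_derivative (\<lambda>v. D (PT Q \<theta> q) (0, 0, 0, fst v, fst q * snd v + fst v * snd q))) (at q within SR R)"
      by (rule has_derivative_in_compose [OF PT_deriv has_derivative_subset [OF D]]) (use inb q in auto)
    from has_derivative_Re [OF has_derivative_mult_left [OF this, of "e \<theta>"]]
    have 1: "((\<lambda>q. Re (\<Psi> (PT Q \<theta> q) * e \<theta>)) has_derivative (\<lambda>v. Re (D (PT Q \<theta> q) (0, 0, 0, fst v, fst q * snd v + fst v * snd q) * e \<theta>))) (at q within SR R)" .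
    have "Re (D (PT Q \<theta> q) (0, 0, 0, fst v, fst q * snd v + fst v * snd q) * e \<theta>) = blinfun_apply (fx q \<theta>) v" for v
    proof -
      interpret L: bounded_linear "D (PT Q \<theta> q)" using D [OF inb [OF q]] by (rule has_derivative_bounded_linear)
      have "D (PT Q \<theta> q) (0, 0, 0, a, b) = a *\<^sub>R D (PT Q \<theta> q) (0, 0, 0, 1, 0) + b *\<^sub>R D (PT Q \<theta> q) (0, 0, 0, 0, 1)" for a b :: real
        unfolding L.add [symmetric] L.scaleR [symmetric] by simp
      from this [of "fst v" "fst q * snd v + fst v * snd q"] show ?thesis
        unfolding app by (simp add: A4_def A5_def \<Psi>4_def \<Psi>5_def algebra_simps)
    qed
    then show "((\<lambda>q. Re (\<Psi> (PT Q \<theta> q) * e \<theta>)) has_derivative blinfun_apply (fx q \<theta>)) (at q within SR R)"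
      using 1 by simp
  qed
  have app_int: "blinfun_apply (integral cube (fx p)) v = fst v * (IE Q \<Psi>4 e p + snd p * IE Q \<Psi>5 e p) + snd v * (fst p * IE Q \<Psi>5 e p)" for v
  proof -
    have ifx: "fx p integrable_on cube"
    proof (rule integrable_continuous)
      show "continuous_on cube (fx p)"
        using continuous_on_slice [OF cfx p] by simp
    qed
    have "blinfun_apply (integral cube (fx p)) v = integral cube (\<lambda>\<theta>. fst v * A4 p \<theta> + (fst v * snd p + snd v * fst p) * A5 p \<theta>)"
      unfolding blinfun_apply_integral [OF ifx]
      by (simp add: app algebra_simps)
    also have "\<dots> = fst v * integral cube (A4 p) + (fst v * snd p + snd v * fst p) * integral cube (A5 p)"
      by (intro integral_unique has_integral_add has_integral_mult_right integrable_integral int p)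
    also have "integral cube (A4 p) = IE Q \<Psi>4 e p" unfolding IE_def A4_def ..
    also have "integral cube (A5 p) = IE Q \<Psi>5 e p" unfolding IE_def A5_def ..
    finally show ?thesis by (simp add: algebra_simps)
  qed
  show ?thesis by (rule has_derivative_eq_rhs [OF lr ext [OF app_int]])
qed

text \<open>The bound does not depend on the weight \<open>e\<close>; for \<open>e = mono_e i\<close> this makes it uniform in the
  Taylor coefficients.\<close>

lemma IE_CB:
  "Ck_on k \<Psi> (complex_box \<rho>) \<Longrightarrow> \<exists>c\<ge>0. \<forall>e. adm e \<longrightarrow> CB k c (SR R) (IE Q \<Psi> e)"
proof (induction k arbitrary: \<Psi>)
  case 0
  then have "continuous_on (complex_box \<rho>) \<Psi>" by simp
  then show ?case using IE_bound IE_continuous unfolding CB.simps by blast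
next
  case (Suc k)
  obtain c0 where c0: "0 \<le> c0" "\<And>e p. adm e \<Longrightarrow> p \<in> SR R \<Longrightarrow> \<bar>IE Q \<Psi> e p\<bar> \<le> c0"
    using IE_bound [OF Ck_on_imp_continuous [OF Suc.prems]] by blast
  obtain D where D: "\<And>p. p \<in> complex_box \<rho> \<Longrightarrow> (\<Psi> has_derivative D p) (at p within complex_box \<rho>)"
    and CkD: "\<And>v. Ck_on k (\<lambda>p. D p v) (complex_box \<rho>)" using Suc.prems unfolding Ck_on.simps by blast
  have cD: "continuous_on (complex_box \<rho>) (\<lambda>p. D p v)" for v by (rule Ck_on_imp_continuous [OF CkD])
  let ?P4 = "\<lambda>p. D p (0, 0, 0, 1, 0)" and ?P5 = "\<lambda>p. D p (0, 0, 0, 0, 1)"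
  obtain c4 where c4: "0 \<le> c4" "\<And>e. adm e \<Longrightarrow> CB k c4 (SR R) (IE Q ?P4 e)"
    using Suc.IH [OF CkD] by blast
  obtain c5 where c5: "0 \<le> c5" "\<And>e. adm e \<Longrightarrow> CB k c5 (SR R) (IE Q ?P5 e)"
    using Suc.IH [OF CkD] by blast
  let ?c = "c0 + c4 + real (Suc k) * c5"
  have "CB (Suc k) ?c (SR R) (IE Q \<Psi> e)" if e: "adm e" for e
  proof (rule CB_SucI [OF _ IE_deriv [OF D cD e]])
    show "\<bar>IE Q \<Psi> e p\<bar> \<le> ?c" if "p \<in> SR R" for p
      using c0(2) [OF e that] c4(1) c5(1) mult_nonneg_nonneg [of "real (Suc k)" c5] by linarith
    have s: "CB k (real (Suc k) * c5) (SR R) (\<lambda>p. snd p * IE Q ?P5 e p)"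
      by (rule CB_mult_coordinate [OF bounded_linear_snd _ _ _ _ c5(1) c5(2) [OF e], of 0 1]) (auto simp: mem_Times_iff)
    have r: "CB k (real (Suc k) * c5) (SR R) (\<lambda>p. fst p * IE Q ?P5 e p)"
      by (rule CB_mult_coordinate [OF bounded_linear_fst _ _ _ _ c5(1) c5(2) [OF e], of 1 0]) (use QR in \<open>auto simp: mem_Times_iff\<close>)
    show "CB k ?c (SR R) (\<lambda>p. IE Q ?P4 e p + snd p * IE Q ?P5 e p)"
      by (rule CB_mono [OF CB_add [OF c4(2) [OF e] s]]) (use c0 in simp)
    show "CB k ?c (SR R) (\<lambda>p. fst p * IE Q ?P5 e p)"
      by (rule CB_mono [OF r]) (use c0 c4 in simp)
  qed
  then show ?case using c0 c4 c5 by (intro exI [of _ ?c]) auto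
qed

end

section \<open>Cauchy's formula on the torus and the resulting Taylor series\<close>

lemma cauchy_unit_interval:
  assumes hol: "g holomorphic_on ball 0 \<rho>" and Q: "0 < Q" "Q < \<rho>" and w: "norm w < Q"
  shows "((\<lambda>t. g (of_real Q * circ t) * (1 / (1 - w / of_real Q * inverse (circ t)))) has_integral g w) {0..1}"
proof -
  have "g holomorphic_on cball 0 Q" using hol by (rule holomorphic_on_subset) (use Q in auto)
  then have "((\<lambda>u. g u / (u - w)) has_contour_integral (2 * of_real pi * \<i> * g w)) (circlepath 0 Q)"
    by (rule Cauchy_integral_circlepath_simple) (use w in simp)
  then have "((\<lambda>t. g (of_real Q * circ t) / (of_real Q * circ t - w) * (2 * pi * \<i> * Q * circ t)) has_integral (2 * of_real pi * \<i> * g w)) {0..1}"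
    unfolding has_contour_integral vector_derivative_circlepath by (simp add: circlepath circ_def)
  from has_integral_mult_right [OF this, of "1 / (2 * of_real pi * \<i>)"]
  have "((\<lambda>t. 1 / (2 * of_real pi * \<i>) * (g (of_real Q * circ t) / (of_real Q * circ t - w) * (2 * pi * \<i> * Q * circ t))) has_integral g w) {0..1}"
    by simp
  moreover have "1 / (2 * of_real pi * \<i>) * (g (of_real Q * circ t) / (of_real Q * circ t - w) * (2 * pi * \<i> * Q * circ t)) =
      g (of_real Q * circ t) * (1 / (1 - w / of_real Q * inverse (circ t)))" for t
  proof -
    have ne: "of_real Q * circ t - w \<noteq> 0" using w Q by (metis abs_of_pos eq_iff_diff_eq_0 less_irrefl mult.right_neutral norm_circ norm_mult norm_of_real)
    have "1 - w / of_real Q * inverse (circ t) = (of_real Q * circ t - w) / (of_real Q * circ t)"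
      using Q by (simp add: field_simps)
    then show ?thesis using ne Q by (simp add: field_simps)
  qed
  ultimately show ?thesis by simp
qed


definition mono_e :: "nat \<Rightarrow> real \<times> real \<times> real \<Rightarrow> complex" where
  "mono_e i \<theta> = inverse (circ (fst \<theta>)) ^ ta i * inverse (circ (fst (snd \<theta>))) ^ tb i * inverse (circ (snd (snd \<theta>))) ^ tc i"

lemma adm_mono_e: "adm (mono_e i)"
  unfolding adm_def mono_e_def
  by (auto intro!: continuous_intros simp: norm_mult norm_power norm_inverse)

text \<open>The Cauchy kernel on the circle u = Q exp(2 pi i t): the differential du/(2 pi i) equals
  u dt, so 1/(u - w) becomes 1/(1 - w/u), a geometric series in w/u.\<close>

definition ker :: "real \<Rightarrow> complex \<Rightarrow> real \<Rightarrow> complex" where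
  "ker Q w t = 1 / (1 - w / of_real Q * inverse (circ t))"

lemma continuous_ker:
  assumes "norm w < Q" "continuous_on A f" shows "continuous_on A (\<lambda>x. ker Q w (f x))"
proof -
  have "1 - w / of_real Q * inverse (circ t) \<noteq> 0" for t
  proof
    assume "1 - w / of_real Q * inverse (circ t) = 0"
    then have "w / of_real Q * inverse (circ t) = 1" by simp
    then have "norm (w / of_real Q * inverse (circ t)) = 1" by simp
    moreover have "0 < Q" using assms(1) norm_ge_zero [of w] by linarith
    ultimately show False using assms(1) by (simp add: norm_mult norm_divide norm_inverse)
  qed
  then show ?thesis unfolding ker_def by (intro continuous_intros assms(2)) auto
qed

definition sep_hol :: "real \<Rightarrow> (complex \<times> complex \<times> complex \<times> real \<times> real \<Rightarrow> complex) \<Rightarrow> bool" where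
  "sep_hol \<rho> \<Phi> \<longleftrightarrow> (\<forall>x y z r \<mu>. (x, y, z, r, \<mu>) \<in> complex_box \<rho> \<longrightarrow>
           (\<lambda>\<zeta>. \<Phi> (\<zeta>, y, z, r, \<mu>)) holomorphic_on ball 0 \<rho> \<and>
           (\<lambda>\<zeta>. \<Phi> (x, \<zeta>, z, r, \<mu>)) holomorphic_on ball 0 \<rho> \<and>
           (\<lambda>\<zeta>. \<Phi> (x, y, \<zeta>, r, \<mu>)) holomorphic_on ball 0 \<rho>)"

text \<open>Holomorphy in each variable gives the one-dimensional formula three times, from the
  innermost variable outwards; joint continuity lets the integral over the cube be iterated.\<close>

lemma cauchy_cube:
  assumes hol: "sep_hol \<rho> \<Phi>" and cont: "continuous_on (complex_box \<rho>) \<Phi>"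
    and QR: "0 < Q" "Q < \<rho>" "0 < R" "R < \<rho>" "R \<le> 1" and p: "p \<in> SR R"
    and w: "norm x < Q" "norm y < Q" "norm z < Q"
  shows "((\<lambda>\<theta>. \<Phi> (PT Q \<theta> p) * (ker Q x (fst \<theta>) * ker Q y (fst (snd \<theta>)) * ker Q z (snd (snd \<theta>))))
     has_integral \<Phi> (x, y, z, fst p, fst p * snd p)) cube"
proof -
  define r \<mu> where "r = fst p" and "\<mu> = fst p * snd p"
  have box: "(a, b, c, r, \<mu>) \<in> complex_box \<rho>" if "norm a < \<rho>" "norm b < \<rho>" "norm c < \<rho>" for a b c
    using PT_in_box [of Q \<rho> R p "(0,0,0)"] QR p that by (simp add: PT_def complex_box_def r_def \<mu>_def)
  have wr: "norm x < \<rho>" "norm y < \<rho>" "norm z < \<rho>" using w QR by auto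
  have u: "norm (of_real Q * circ t) < \<rho>" for t using QR by (simp add: norm_mult)
  let ?u = "\<lambda>t. of_real Q * circ t"
  let ?f = "\<lambda>\<theta>. \<Phi> (PT Q \<theta> p) * (ker Q x (fst \<theta>) * ker Q y (fst (snd \<theta>)) * ker Q z (snd (snd \<theta>)))"
  have c\<Phi>: "continuous_on cube (\<lambda>\<theta>. \<Phi> (PT Q \<theta> p))"
  proof -
    have "SR R \<times> cube \<subseteq> SR R \<times> UNIV" by blast
    from continuous_on_slice [OF continuous_PT [OF QR cont this] p] show ?thesis unfolding fst_conv snd_conv .
  qed
  have cf: "continuous_on cube ?f"
    by (intro continuous_intros c\<Phi> continuous_ker w)
  have 3: "integral {0..1} (\<lambda>t3. ?f (t1, t2, t3)) = \<Phi> (?u t1, ?u t2, z, r, \<mu>) * (ker Q x t1 * ker Q y t2)" for t1 t2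
  proof -
    have "(\<lambda>\<zeta>. \<Phi> (?u t1, ?u t2, \<zeta>, r, \<mu>)) holomorphic_on ball 0 \<rho>"
      using hol box [OF u [of t1] u [of t2] wr(3)] unfolding sep_hol_def by blast
    from has_integral_mult_left [OF cauchy_unit_interval [OF this QR(1,2) w(3), folded ker_def], of "ker Q x t1 * ker Q y t2"]
    show ?thesis by (intro integral_unique) (simp only: PT_def fst_conv snd_conv r_def \<mu>_def mult_ac)
  qed
  have 2: "integral {0..1} (\<lambda>t2. \<Phi> (?u t1, ?u t2, z, r, \<mu>) * (ker Q x t1 * ker Q y t2)) = \<Phi> (?u t1, y, z, r, \<mu>) * ker Q x t1" for t1
  proof -
    have "(\<lambda>\<zeta>. \<Phi> (?u t1, \<zeta>, z, r, \<mu>)) holomorphic_on ball 0 \<rho>"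
      using hol box [OF u [of t1] wr(2) wr(3)] unfolding sep_hol_def by blast
    from has_integral_mult_left [OF cauchy_unit_interval [OF this QR(1,2) w(2), folded ker_def], of "ker Q x t1"]
    show ?thesis by (intro integral_unique) (simp only: mult_ac)
  qed
  have 1: "integral {0..1} (\<lambda>t1. \<Phi> (?u t1, y, z, r, \<mu>) * ker Q x t1) = \<Phi> (x, y, z, r, \<mu>)"
  proof -
    have "(\<lambda>\<zeta>. \<Phi> (\<zeta>, y, z, r, \<mu>)) holomorphic_on ball 0 \<rho>"
      using hol box [OF wr] unfolding sep_hol_def by blast
    from cauchy_unit_interval [OF this QR(1,2) w(1), folded ker_def]
    show ?thesis by (rule integral_unique)
  qed
  have "integral cube ?f = integral (cbox 0 1) (\<lambda>t1. integral (cbox (0, 0) (1, 1)) (\<lambda>\<theta>. ?f (t1, \<theta>)))"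
    by (rule integral_prod_continuous [OF cf])
  also have "\<dots> = integral (cbox 0 1) (\<lambda>t1. \<Phi> (?u t1, y, z, r, \<mu>) * ker Q x t1)"
  proof (rule integral_cong)
    fix t1 :: real assume "t1 \<in> cbox 0 1"
    have "continuous_on (cbox (0,0) (1,1)) (\<lambda>\<theta>. ?f (t1, \<theta>))"
      by (rule continuous_on_slice [of "cbox 0 1"]) (use cf \<open>t1 \<in> cbox 0 1\<close> in \<open>simp_all add: cbox_Pair_eq\<close>)
    from integral_prod_continuous [OF this]
    show "integral (cbox (0, 0) (1, 1)) (\<lambda>\<theta>. ?f (t1, \<theta>)) = \<Phi> (?u t1, y, z, r, \<mu>) * ker Q x t1"
      unfolding cbox_interval 3 2 .
  qed
  also have "\<dots> = \<Phi> (x, y, z, r, \<mu>)" unfolding cbox_interval by (rule 1)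
  finally have "integral cube ?f = \<Phi> (x, y, z, fst p, fst p * snd p)" by (simp add: r_def \<mu>_def)
  then show ?thesis using integrable_integral [OF integrable_continuous [OF cf]] by simp
qed

text \<open>Each kernel is a geometric series with ratio at most 1/4 in modulus, so the product of
  the three converges uniformly on the torus and Cauchy's formula may be integrated
  termwise.\<close>

lemma expansion_sums:
  assumes hol: "sep_hol \<rho> \<Phi>" and cont: "continuous_on (complex_box \<rho>) \<Phi>"
    and QR: "0 < Q" "Q < \<rho>" "0 < R" "R < \<rho>" "R \<le> 1" "4 * R \<le> Q" and p: "p \<in> SR R"
    and w: "\<bar>x\<bar> \<le> R" "\<bar>y\<bar> \<le> R" "\<bar>z\<bar> \<le> R"
  shows "(\<lambda>i. IE Q \<Phi> (mono_e i) p * ((x / Q) ^ ta i * (y / Q) ^ tb i * (z / Q) ^ tc i)) sums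
     Re (\<Phi> (of_real x, of_real y, of_real z, fst p, fst p * snd p))"
proof -
  let ?x = "complex_of_real x" and ?y = "complex_of_real y" and ?z = "complex_of_real z"
  let ?k = "\<lambda>\<theta>. ker Q ?x (fst \<theta>) * ker Q ?y (fst (snd \<theta>)) * ker Q ?z (snd (snd \<theta>))"
  define m where "m i = (x / Q) ^ ta i * (y / Q) ^ tb i * (z / Q) ^ tc i" for i
  have q: "\<bar>x / Q\<bar> \<le> 1/4" "\<bar>y / Q\<bar> \<le> 1/4" "\<bar>z / Q\<bar> \<le> 1/4" using w QR by (auto simp: field_simps)
  have n: "norm (of_real s / of_real Q * inverse (circ t)) \<le> 1/4" if "\<bar>s / Q\<bar> \<le> 1/4" for s t
    using that by (simp add: norm_mult norm_inverse norm_divide)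
  have q2: "\<bar>x / Q\<bar> \<le> 1/2" "\<bar>y / Q\<bar> \<le> 1/2" "\<bar>z / Q\<bar> \<le> 1/2" using q by linarith+
  have mb: "\<bar>m i\<bar> \<le> (1/2) ^ tdeg i" for i
  proof -
    have "\<bar>m i\<bar> \<le> (1/2) ^ ta i * (1/2) ^ tb i * (1/2) ^ tc i"
      unfolding m_def abs_mult power_abs by (intro mult_mono power_mono mult_nonneg_nonneg zero_le_power q2) simp_all
    then show ?thesis by (simp add: tdeg_def power_add)
  qed
  have ks: "(\<lambda>i. mono_e i \<theta> * of_real (m i)) sums ?k \<theta>" for \<theta>
  proof -
    have "(\<lambda>i. (?x / of_real Q * inverse (circ (fst \<theta>))) ^ ta i * (?y / of_real Q * inverse (circ (fst (snd \<theta>)))) ^ tb i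
        * (?z / of_real Q * inverse (circ (snd (snd \<theta>)))) ^ tc i) sums
       (1 / ((1 - ?x / of_real Q * inverse (circ (fst \<theta>))) * (1 - ?y / of_real Q * inverse (circ (fst (snd \<theta>)))) * (1 - ?z / of_real Q * inverse (circ (snd (snd \<theta>))))))"
      by (intro triple_geometric_sums order_trans [OF n]) (use q in auto)
    then show ?thesis
      by (simp add: ker_def mono_e_def m_def power_mult_distrib power_divide mult_ac)
  qed
  have c\<Phi>: "continuous_on cube (\<lambda>\<theta>. \<Phi> (PT Q \<theta> p))"
  proof -
    have "SR R \<times> cube \<subseteq> SR R \<times> UNIV" by blast
    from continuous_on_slice [OF continuous_PT [OF QR(1-5) cont this] p] show ?thesis unfolding fst_conv snd_conv .
  qed
  have "compact ((\<lambda>\<theta>. \<Phi> (PT Q \<theta> p)) ` cube)" by (intro compact_continuous_image c\<Phi> compact_cbox)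
  then obtain B where B: "\<And>\<theta>. \<theta> \<in> cube \<Longrightarrow> norm (\<Phi> (PT Q \<theta> p)) \<le> B"
    by (meson bounded_iff compact_imp_bounded imageI)
  have "0 \<le> B" using order_trans [OF norm_ge_zero B [of "(0,0,0)"]] by simp
  let ?t = "\<lambda>i \<theta>. Re (\<Phi> (PT Q \<theta> p) * mono_e i \<theta>) * m i"
  have ul: "uniform_limit cube (\<lambda>n \<theta>. \<Sum>i<n. ?t i \<theta>) (\<lambda>\<theta>. \<Sum>i. ?t i \<theta>) sequentially"
  proof (rule Weierstrass_m_test)
    show "summable (\<lambda>i. B * (1/2) ^ tdeg i)" by (intro summable_mult summable_tri)
    fix i \<theta> assume \<theta>: "\<theta> \<in> cube"
    have "\<bar>Re (\<Phi> (PT Q \<theta> p) * mono_e i \<theta>)\<bar> \<le> norm (\<Phi> (PT Q \<theta> p)) * norm (mono_e i \<theta>)"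
      using abs_Re_le_cmod [of "\<Phi> (PT Q \<theta> p) * mono_e i \<theta>"] by (simp only: norm_mult)
    also have "\<dots> \<le> B * 1"
      using B [OF \<theta>] adm_mono_e [of i] \<theta> \<open>0 \<le> B\<close> by (intro mult_mono) (auto simp: adm_def)
    finally have "\<bar>Re (\<Phi> (PT Q \<theta> p) * mono_e i \<theta>)\<bar> * \<bar>m i\<bar> \<le> B * (1/2) ^ tdeg i"
      using mb \<open>0 \<le> B\<close> by (intro mult_mono) auto
    then show "norm (?t i \<theta>) \<le> B * (1/2) ^ tdeg i" by (simp only: real_norm_def abs_mult)
  qed
  have lim: "(\<Sum>i. ?t i \<theta>) = Re (\<Phi> (PT Q \<theta> p) * ?k \<theta>)" for \<theta>
  proof -
    have "(\<lambda>i. \<Phi> (PT Q \<theta> p) * (mono_e i \<theta> * of_real (m i))) sums (\<Phi> (PT Q \<theta> p) * ?k \<theta>)"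
      by (intro sums_mult ks)
    moreover have "Re (\<Phi> (PT Q \<theta> p) * (mono_e i \<theta> * of_real (m i))) = ?t i \<theta>" for i
      by (simp add: algebra_simps)
    ultimately have "(\<lambda>i. ?t i \<theta>) sums Re (\<Phi> (PT Q \<theta> p) * ?k \<theta>)"
      using sums_Re by fastforce
    then show ?thesis by (rule sums_unique [symmetric])
  qed
  have ti: "(?t i has_integral IE Q \<Phi> (mono_e i) p * m i) cube" for i
    unfolding IE_def
    by (intro has_integral_mult_left integrable_integral IE_integrable [OF QR(1-5) cont adm_mono_e p])
  have tc: "continuous_on cube (?t i)" for i
    by (rule continuous_on_mult [OF continuous_on_slice [OF continuous_IE_integrand [OF QR(1-5) cont adm_mono_e] p, unfolded fst_conv snd_conv] continuous_on_const])
  obtain I J where IJ: "\<And>n. ((\<lambda>\<theta>. \<Sum>i<n. ?t i \<theta>) has_integral I n) cube" "((\<lambda>\<theta>. \<Sum>i. ?t i \<theta>) has_integral J) cube" "I \<longlonglongrightarrow> J"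
    by (rule uniform_limit_integral_cbox [OF ul continuous_on_sum [OF tc] trivial_limit_sequentially]) blast
  have In: "I n = (\<Sum>i<n. IE Q \<Phi> (mono_e i) p * m i)" for n
    by (rule has_integral_unique [OF IJ(1)]) (intro has_integral_sum ti, simp)
  have "(\<lambda>i. IE Q \<Phi> (mono_e i) p * m i) sums J"
    unfolding sums_def In [symmetric] by (rule IJ(3))
  moreover have "J = Re (\<Phi> (?x, ?y, ?z, fst p, fst p * snd p))"
  proof (rule has_integral_unique [OF IJ(2)])
    have "norm ?x < Q" "norm ?y < Q" "norm ?z < Q" using w QR by auto
    from has_integral_Re [OF cauchy_cube [OF hol cont QR(1-5) p this]]
    show "((\<lambda>\<theta>. \<Sum>i. ?t i \<theta>) has_integral Re (\<Phi> (?x, ?y, ?z, fst p, fst p * snd p))) cube"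
      unfolding lim .
  qed
  ultimately show ?thesis by (simp only: m_def)
qed

definition expansion where
  "expansion k R C F J \<longleftrightarrow> 0 \<le> C \<and> (\<forall>i. jetfam k (C * (1/4) ^ tdeg i) (SR R) (J i)) \<and>
     (\<forall>x y z. \<forall>p\<in>SR R. \<bar>x\<bar> \<le> R \<and> \<bar>y\<bar> \<le> R \<and> \<bar>z\<bar> \<le> R \<longrightarrow>
        F x y z (fst p) (fst p * snd p) = psum (\<lambda>i. J i 0 0 p) (x / R) (y / R) (z / R))"

text \<open>The radius is left free below a threshold so that several functions can be expanded with
  a common one.\<close>

lemma smooth_analytic_expansion:
  assumes "smooth_analytic F"
  shows "\<exists>R0>0. \<forall>R. 0 < R \<and> R \<le> R0 \<longrightarrow> (\<exists>C J. expansion k R C F J)"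
proof -
  obtain \<rho> \<Phi> where "0 < \<rho>" and sm: "smooth_on \<Phi> (complex_box \<rho>)"
    and hol: "sep_hol \<rho> \<Phi>"
    and real: "\<And>x y z r \<mu>. (of_real x, of_real y, of_real z, r, \<mu>) \<in> complex_box \<rho> \<Longrightarrow>
           \<Phi> (of_real x, of_real y, of_real z, r, \<mu>) = of_real (F x y z r \<mu>)"
    using assms unfolding smooth_analytic_def sep_hol_def by blast
  define Q where "Q = \<rho> / 2"
  \<comment> \<open>Integration runs over a torus strictly inside the polydisc. Passing from radius
    \<open>Q\<close> to \<open>R \<le> Q / 4\<close> multiplies a coefficient of degree d by (R/Q)^d
    <= (1/4)^d, the decay used for \<open>psum\<close>; the 1 keeps |r| at most 1.\<close>
  define R0 where "R0 = min (Q / 4) 1"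
  have "0 < R0" using \<open>0 < \<rho>\<close> by (simp add: R0_def Q_def)
  have Ck: "Ck_on k \<Phi> (complex_box \<rho>)" using sm by (simp add: smooth_on_def)
  have main: "\<exists>C J. expansion k R C F J"
    if R: "0 < R" "R \<le> R0" for R
  proof -
    have QR: "0 < Q" "Q < \<rho>" "0 < R" "R < \<rho>" "R \<le> 1" "4 * R \<le> Q"
      using R \<open>0 < \<rho>\<close> by (auto simp: R0_def Q_def)
    obtain c where c: "0 \<le> c" "\<And>e. adm e \<Longrightarrow> CB k c (SR R) (IE Q \<Phi> e)"
      using IE_CB [OF QR(1-5) Ck] by blast
    have "\<exists>J. J 0 0 = IE Q \<Phi> (mono_e i) \<and> jetfam k c (SR R) J" for i
      by (rule CB_imp_jetfam [OF refl QR(3) _ c(2) [OF adm_mono_e]]) simp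
    then obtain N where N: "\<And>i. N i 0 0 = IE Q \<Phi> (mono_e i)" "\<And>i. jetfam k c (SR R) (N i)" by metis
    define J where "J i a b p = (R / Q) ^ tdeg i * N i a b p" for i a b p
    have RQ: "0 \<le> R / Q" "R / Q \<le> 1/4" using QR by (auto simp: field_simps)
    have "jetfam k (c * (1/4) ^ tdeg i) (SR R) (J i)" for i
      unfolding jetfam_def
    proof (intro conjI allI impI ballI)
      fix a b assume ab: "a + b \<le> k"
      show "continuous_on (SR R) (J i a b)"
        unfolding J_def [abs_def] using N(2) [of i] ab by (intro continuous_intros) (simp add: jetfam_def)
      fix p assume p: "p \<in> SR R"
      have "\<bar>N i a b p\<bar> \<le> c" using N(2) [of i] ab p unfolding jetfam_def by blast
      then have "(R / Q) ^ tdeg i * \<bar>N i a b p\<bar> \<le> (1/4) ^ tdeg i * c"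
        using RQ by (intro mult_mono power_mono) auto
      then show "\<bar>J i a b p\<bar> \<le> c * (1/4) ^ tdeg i" using RQ by (simp add: J_def abs_mult mult.commute)
    next
      fix a b p assume p: "p \<in> SR R" and ab: "a + b < k"
      have "has_partials (N i a b) (real (Suc a) * N i (Suc a) b p) (real (Suc b) * N i a (Suc b) p) p (SR R)"
        using N(2) [of i] ab p unfolding jetfam_def by blast
      from has_derivative_mult_right [OF this, of "(R / Q) ^ tdeg i"]
      show "has_partials (J i a b) (real (Suc a) * J i (Suc a) b p) (real (Suc b) * J i a (Suc b) p) p (SR R)"
        by (simp add: J_def [abs_def] distrib_left mult.left_commute del: of_nat_Suc)
    qed
    moreover have "F x y z (fst p) (fst p * snd p) = psum (\<lambda>i. J i 0 0 p) (x / R) (y / R) (z / R)"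
      if p: "p \<in> SR R" and xyz: "\<bar>x\<bar> \<le> R" "\<bar>y\<bar> \<le> R" "\<bar>z\<bar> \<le> R" for x y z p
    proof -
      have "(of_real x, of_real y, of_real z, fst p, fst p * snd p) \<in> complex_box \<rho>"
        using PT_in_box [of Q \<rho> R p "(0,0,0)"] QR p xyz by (simp add: PT_def complex_box_def)
      then have "F x y z (fst p) (fst p * snd p) = Re (\<Phi> (of_real x, of_real y, of_real z, fst p, fst p * snd p))"
        by (simp add: real)
      also have "\<dots> = (\<Sum>i. IE Q \<Phi> (mono_e i) p * ((x / Q) ^ ta i * (y / Q) ^ tb i * (z / Q) ^ tc i))"
        by (rule sums_unique [OF expansion_sums [OF hol Ck_on_imp_continuous [OF Ck] QR p xyz]])
      also have "\<dots> = psum (\<lambda>i. J i 0 0 p) (x / R) (y / R) (z / R)"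
        unfolding psum_def
      proof (intro arg_cong [where f = suminf] ext)
        fix i
        have pq: "(s / Q) ^ n = (R / Q) ^ n * (s / R) ^ n" for s n
          using QR by (simp add: power_mult_distrib [symmetric])
        show "IE Q \<Phi> (mono_e i) p * ((x / Q) ^ ta i * (y / Q) ^ tb i * (z / Q) ^ tc i) = J i 0 0 p * ((x / R) ^ ta i * (y / R) ^ tb i * (z / R) ^ tc i)"
          unfolding pq [of x] pq [of y] pq [of z] J_def N(1) tdeg_def power_add by (simp only: mult_ac)
      qed
      finally show ?thesis .
    qed
    ultimately show ?thesis using c(1) unfolding expansion_def by blast
  qed
  show ?thesis using \<open>0 < R0\<close> main by blast
qed

section \<open>The invariant manifold\<close>

text \<open>Written with axis vectors, so that continuity and derivatives of vector-valued
  coefficients follow from the rules for scaling and addition.\<close>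

definition V2 :: "real \<Rightarrow> real \<Rightarrow> real ^ 2" where "V2 a b = a *\<^sub>R axis 1 1 + b *\<^sub>R axis 2 1"

lemma V2_nth [simp]: "V2 a b $ 1 = a" "V2 a b $ 2 = b"
  by (simp_all add: V2_def axis_def)

lemma V2_eq_vector: "V2 a b = vector [a, b]"
  by (simp add: vec_eq_iff forall_2)

lemma norm_V2_le: "norm (V2 a b) \<le> \<bar>a\<bar> + \<bar>b\<bar>"
  unfolding V2_def by (rule order_trans [OF norm_triangle_ineq]) (simp add: norm_axis_1)

lemma jetfam_mono: "jetfam k c S J \<Longrightarrow> c \<le> c' \<Longrightarrow> jetfam k c' S J"
  unfolding jetfam_def using order_trans by blast

lemma jetfam_subset:
  assumes "jetfam k c S J" "S' \<subseteq> S" shows "jetfam k c S' J"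
  unfolding jetfam_def
proof (intro conjI allI impI ballI)
  fix i j assume ij: "i + j \<le> k"
  show "continuous_on S' (J i j)"
    using assms ij unfolding jetfam_def by (blast intro: continuous_on_subset)
  fix p assume "p \<in> S'"
  then show "\<bar>J i j p\<bar> \<le> c" using assms ij unfolding jetfam_def by blast
next
  fix i j p assume "i + j < k" "p \<in> S'"
  then have "has_partials (J i j) (real (Suc i) * J (Suc i) j p) (real (Suc j) * J i (Suc j) p) p S"
    using assms unfolding jetfam_def by blast
  then show "has_partials (J i j) (real (Suc i) * J (Suc i) j p) (real (Suc j) * J i (Suc j) p) p S'"
    by (rule has_derivative_subset) (rule assms(2))
qed

lemma CG_add_const:
  assumes f: "CG k \<tau> f S" and b: "\<And>n. norm (b n) \<le> c * \<tau> ^ n"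
  shows "CG k \<tau> (\<lambda>p n. b n + f p n) S"
proof (cases k)
  case 0
  obtain c' where c': "\<And>p n. p \<in> S \<Longrightarrow> norm (f p n) \<le> c' * \<tau> ^ n" using CG_bound [OF f] by blast
  have "norm (b n + f p n) \<le> (c + c') * \<tau> ^ n" if "p \<in> S" for p n
    unfolding distrib_right by (rule order_trans [OF norm_triangle_ineq add_mono [OF b c' [OF that]]])
  moreover have "continuous_on S (\<lambda>p. b n + f p n)" for n
    using f 0 by (intro continuous_on_add continuous_on_const) simp
  ultimately show ?thesis unfolding 0 CG.simps by blast
next
  case (Suc k')
  obtain c' where c': "\<And>p n. p \<in> S \<Longrightarrow> norm (f p n) \<le> c' * \<tau> ^ n" using CG_bound [OF f] by blast
  have "norm (b n + f p n) \<le> (c + c') * \<tau> ^ n" if "p \<in> S" for p n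
    unfolding distrib_right by (rule order_trans [OF norm_triangle_ineq add_mono [OF b c' [OF that]]])
  then have bd: "\<exists>c. \<forall>p\<in>S. \<forall>n. norm (b n + f p n) \<le> c * \<tau> ^ n" by blast
  obtain g1 g2 where g: "\<And>n p. p \<in> S \<Longrightarrow> ((\<lambda>p. f p n) has_derivative (\<lambda>v. fst v *\<^sub>R g1 p n + snd v *\<^sub>R g2 p n)) (at p within S)"
    "CG k' \<tau> g1 S" "CG k' \<tau> g2 S" using f unfolding Suc CG.simps by blast
  have "((\<lambda>p. b n + f p n) has_derivative (\<lambda>v. fst v *\<^sub>R g1 p n + snd v *\<^sub>R g2 p n)) (at p within S)" if "p \<in> S" for p n
    using has_derivative_add [OF has_derivative_const g(1) [OF that], of "b n"] by simp
  then show ?thesis unfolding Suc CG.simps using bd g(2,3) by blast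
qed

context jet_system
begin

definition base :: "nat \<Rightarrow> real ^ 2" where
  "base n = V2 (if n = 2 then -1 else 0) (if n = 1 then 1 else 0)"

definition mm :: "real \<times> real \<Rightarrow> nat \<Rightarrow> real ^ 2" where
  "mm p n = base n + V2 (cf (XX p) n 0 0 / rho ^ n) (cf (ZZ p) n 0 0 / rho ^ n)"

text \<open>All scalings are undone: the factorials of the Taylor entries, the unit e, and rho^n
  from y = rho t. What remains are the partial derivatives of the power series coefficients in
  y.\<close>

definition mj :: "nat \<Rightarrow> nat \<Rightarrow> real \<times> real \<Rightarrow> nat \<Rightarrow> real ^ 2" where
  "mj i j p n = (fact i * fact j / (e ^ (i + j) * rho ^ n)) *\<^sub>R V2 (cf (XX p) n i j) (cf (ZZ p) n i j)"

lemma jc_sol: "jc k e S (\<lambda>p. co (XX p) n)" "jc k e S (\<lambda>p. co (ZZ p) n)"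
  using jcB_sol [THEN jcB_D] unfolding XX_def ZZ_def by blast+

text \<open>Removing the weight from an entry of order at most \<open>k\<close> costs at most
  (2^k)^n, and returning from t to y costs rho^(-n); together they give the rate 2^k/rho for all
  orders.\<close>

lemma CG_mj: "CG k (2 ^ k / rho) (mj 0 0) S"
proof (rule CG_jets [where J = mj and i = 0 and j = 0 and k = k and c = "\<lambda>i j. fact i * fact j / e ^ (i + j) * (2 * beta)"])
  fix i j n assume ij: "i + j \<le> k"
  show "continuous_on S (\<lambda>p. mj i j p n)"
    unfolding mj_def V2_def by (intro continuous_intros jc_cont [OF jc_sol(1) ij] jc_cont [OF jc_sol(2) ij])
  fix p assume p: "p \<in> S"
  have pw: "(2::real) ^ (n * (i + j)) \<le> (2 ^ k) ^ n"
    unfolding power_mult [symmetric] by (intro power_increasing) (use ij in \<open>auto simp: mult.commute\<close>)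
  have "\<bar>cf a n i j\<bar> \<le> beta * (2 ^ k) ^ n" if "norm a \<le> beta" for a
    by (rule order_trans [OF cf_le_norm mult_mono [OF that pw]]) (use small in auto)
  then have "norm (V2 (cf (XX p) n i j) (cf (ZZ p) n i j)) \<le> beta * (2 ^ k) ^ n + beta * (2 ^ k) ^ n"
    by (intro order_trans [OF norm_V2_le] add_mono) (auto intro: norm_XX norm_ZZ p)
  then have "norm (mj i j p n) \<le> fact i * fact j / (e ^ (i + j) * rho ^ n) * (2 * (beta * (2 ^ k) ^ n))"
    unfolding mj_def norm_scaleR using e(1) small by (intro mult_mono) (auto simp: abs_mult)
  also have "\<dots> = fact i * fact j / e ^ (i + j) * (2 * beta) * (2 ^ k / rho) ^ n"
    by (simp add: power_divide)
  finally show "norm (mj i j p n) \<le> fact i * fact j / e ^ (i + j) * (2 * beta) * (2 ^ k / rho) ^ n" .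
next
  fix i j n p assume ij: "i + j < k" and p: "p \<in> S"
  let ?s = "fact i * fact j / (e ^ (i + j) * rho ^ n)"
  let ?D = "\<lambda>a v. (fst v * jco (d1 (co a n)) i j + snd v * jco (d2 (co a n)) i j) / e"
  have "((\<lambda>p. mj i j p n) has_derivative (\<lambda>v. ?s *\<^sub>R (?D (XX p) v *\<^sub>R axis 1 1 + ?D (ZZ p) v *\<^sub>R axis 2 1))) (at p within S)"
    unfolding mj_def V2_def
    by (intro has_derivative_scaleR_right has_derivative_add has_derivative_scaleR_left jc_deriv [OF jc_sol(1) ij p] jc_deriv [OF jc_sol(2) ij p])
  moreover have "?s *\<^sub>R (?D (XX p) v *\<^sub>R axis 1 1 + ?D (ZZ p) v *\<^sub>R axis 2 1) = fst v *\<^sub>R mj (Suc i) j p n + snd v *\<^sub>R mj i (Suc j) p n" for v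
    using e(1) small
    by (simp add: mj_def V2_def vec_eq_iff forall_2 axis_def jco_d1 jco_d2 field_simps del: of_nat_Suc)
  ultimately show "((\<lambda>p. mj i j p n) has_derivative (\<lambda>v. fst v *\<^sub>R mj (Suc i) j p n + snd v *\<^sub>R mj i (Suc j) p n)) (at p within S)"
    by simp
qed simp

lemma Ck_Omega_mm:
  assumes "0 \<le> \<nu>" "2 ^ k / rho * \<nu> < 1" shows "Ck_Omega_on k \<nu> mm S"
proof (rule CG_imp_Ck_Omega [OF _ assms convS])
  show "0 \<le> 2 ^ k / rho" using small by simp
  have "mm = (\<lambda>p n. base n + mj 0 0 p n)"
    by (auto simp: fun_eq_iff mm_def mj_def vec_eq_iff forall_2)
  moreover have "CG k (2 ^ k / rho) (\<lambda>p n. base n + mj 0 0 p n) S"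
  proof (rule CG_add_const [OF CG_mj, where c = 2])
    fix n
    have "(1::real) \<le> 2 ^ k" by simp
    then have "rho \<le> 2 ^ k" using small by linarith
    then have "1 \<le> 2 ^ k / rho" using small by (simp add: le_divide_eq)
    then have "1 \<le> (2 ^ k / rho) ^ n" by (rule one_le_power)
    moreover have "norm (base n) \<le> 2" unfolding base_def by (rule order_trans [OF norm_V2_le]) auto
    ultimately show "norm (base n) \<le> 2 * (2 ^ k / rho) ^ n" by linarith
  qed
  ultimately show "CG k (2 ^ k / rho) mm S" by simp
qed

lemma Omega_fun_mm:
  assumes y: "\<bar>y\<bar> \<le> rho"
  shows "Omega_fun (mm p) y = V2 (hx p y) (hz p y)"
proof -
  have t: "\<bar>y / rho\<bar> \<le> 1" using y small by simp
  have sev: "(\<lambda>n. cf a n 0 0 / rho ^ n * y ^ n) sums ev (y / rho) a" for a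
    using summable_sums [OF summable_ev [OF t, of a]] by (simp add: ev_def power_divide)
  have "(\<lambda>n. (if n = 2 then - (y ^ n) else 0) + cf (XX p) n 0 0 / rho ^ n * y ^ n) sums (- (y ^ 2) + ev (y / rho) (XX p))"
    by (intro sums_add sev) (rule sums_single)
  then have 1: "(\<Sum>n. of_real (mm p n $ 1) * y ^ n) = hx p y"
    unfolding hx_def by (intro sums_unique [symmetric]) (simp add: mm_def base_def distrib_right if_distrib [of "\<lambda>x. x * _"] cong: if_cong)
  have "(\<lambda>n. (if n = 1 then y ^ n else 0) + cf (ZZ p) n 0 0 / rho ^ n * y ^ n) sums (y ^ 1 + ev (y / rho) (ZZ p))"
    by (intro sums_add sev) (rule sums_single)
  then have 2: "(\<Sum>n. of_real (mm p n $ 2) * y ^ n) = hz p y"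
    unfolding hz_def by (intro sums_unique [symmetric]) (simp add: mm_def base_def distrib_right if_distrib [of "\<lambda>x. x * _"] cong: if_cong)
  show ?thesis
    unfolding Omega_fun_def vec_eq_iff forall_2 using 1 2 by simp
qed

lemma Omega_fun_mm_zero:
  fixes \<zeta> :: complex
  assumes p: "p \<in> S" "fst p = 0"
  shows "Omega_fun (mm p) \<zeta> = vector [- (\<zeta>\<^sup>2), \<zeta>]"
proof -
  have "(\<lambda>n. of_real (mm p n $ 1) * \<zeta> ^ n) = (\<lambda>n. if n = 2 then - (\<zeta> ^ n) else 0)"
    "(\<lambda>n. of_real (mm p n $ 2) * \<zeta> ^ n) = (\<lambda>n. if n = 1 then \<zeta> ^ n else 0)"
    by (auto simp: fun_eq_iff mm_def base_def sol_zero [OF p])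
  moreover have "(\<Sum>n. if n = 2 then - (\<zeta> ^ n) else 0) = - (\<zeta>\<^sup>2)" "(\<Sum>n. if n = 1 then \<zeta> ^ n else 0) = \<zeta> ^ 1"
    by (rule sums_unique [symmetric], rule sums_single)+
  ultimately show ?thesis
    unfolding Omega_fun_def vec_eq_iff forall_2 by simp
qed

lemma pr_bounds:
  assumes J: "\<And>i. jetfam k (C * (1/4) ^ tdeg i) S (J i)" and p: "p \<in> S"
    and b: "\<bar>x\<bar> \<le> R" "\<bar>y\<bar> \<le> R" "\<bar>z\<bar> \<le> R" "\<bar>x'\<bar> \<le> R" "\<bar>z'\<bar> \<le> R"
  shows "\<bar>pr J p x y z\<bar> \<le> 8 * C" "\<bar>pr J p x y z - pr J p x' y z'\<bar> \<le> 8 * C / R * (\<bar>x - x'\<bar> + \<bar>z - z'\<bar>)"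
proof -
  have g: "norm (J i 0 0 p) \<le> C * (1/4) ^ tdeg i" for i
    using J [of i] p unfolding jetfam_def by simp
  have n: "norm (s / R) \<le> 1" if "\<bar>s\<bar> \<le> R" for s using that R0 by simp
  show "\<bar>pr J p x y z\<bar> \<le> 8 * C"
    unfolding pr_def using norm_psum_le [OF g n [OF b(1)] n [OF b(2)] n [OF b(3)]] by simp
  have d: "norm (s / R - s' / R) = \<bar>s - s'\<bar> / R" for s s' using R0 by (simp add: diff_divide_distrib [symmetric])
  have "\<bar>pr J p x y z - pr J p x' y z'\<bar> \<le> 8 * C * (\<bar>x - x'\<bar> / R + \<bar>y - y\<bar> / R + \<bar>z - z'\<bar> / R)"
    unfolding pr_def using psum_diff_le [OF g n [OF b(1)] n [OF b(2)] n [OF b(3)] n [OF b(4)] n [OF b(2)] n [OF b(5)]]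
    unfolding d by simp
  then show "\<bar>pr J p x y z - pr J p x' y z'\<bar> \<le> 8 * C / R * (\<bar>x - x'\<bar> + \<bar>z - z'\<bar>)"
    by (simp add: distrib_left)
qed

text \<open>The tangency defect vanishes on the graph by \<open>invariance_equation\<close>. At a
  nearby point it is compared with the graph point having the same y, where the slopes coincide, so
  the Lipschitz constants of the field in x and z bound it by the deviation.\<close>

lemma locally_invariant_mm:
  fixes F G H :: "real \<Rightarrow> real \<Rightarrow> real \<Rightarrow> real \<Rightarrow> real \<Rightarrow> real"
  assumes p: "p \<in> S" and \<nu>: "0 < \<nu>" "\<nu> \<le> rho / 2" and l: "l = a1 + a2"
    and F: "\<And>x y z. \<bar>x\<bar> \<le> R \<Longrightarrow> \<bar>y\<bar> \<le> R \<Longrightarrow> \<bar>z\<bar> \<le> R \<Longrightarrow> F x y z (fst p) (fst p * snd p) = pr JF p x y z"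
    and G: "\<And>x y z. \<bar>x\<bar> \<le> R \<Longrightarrow> \<bar>y\<bar> \<le> R \<Longrightarrow> \<bar>z\<bar> \<le> R \<Longrightarrow> G x y z (fst p) (fst p * snd p) = pr JG p x y z"
    and H: "\<And>x y z. \<bar>x\<bar> \<le> R \<Longrightarrow> \<bar>y\<bar> \<le> R \<Longrightarrow> \<bar>z\<bar> \<le> R \<Longrightarrow> H x y z (fst p) (fst p * snd p) = pr JH p x y z"
  shows "locally_invariant (system_field a1 a2 F G H (fst p) (snd p)) (graph_manifold \<nu> (mm p))"
proof -
  define r where "r = fst p"
  define s where "s = snd p"
  define V where "V = {-R<..<R} \<times> {-\<nu><..<\<nu>} \<times> {-R<..<R}"
  define k1 where "k1 y = - 2 * y + dev (y / rho) (XX p) / rho" for y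
  define k2 where "k2 y = 1 + dev (y / rho) (ZZ p) / rho" for y
  define Lp where "Lp = 8 * C / R"
  \<comment> \<open>\<open>B\<close> bounds both slopes: 2 |y| or 1 from the unperturbed curve, plus
    beta/rho from the correction. \<open>L\<close> in the next line exceeds the Lipschitz constants
    of both defects.\<close>
  define B where "B = 3 + beta / rho"
  define L where "L = 3 + 2 * R + (1 + R) * Lp + 8 * C + B * (\<bar>a2\<bar> + Lp)"
  define fx where "fx x y z = y - (r * s + 1) * z + r * pr JF p x y z" for x y z
  define fy where "fy x y z = r * (l * y + s / 2 + a2 * (z - y) + r * pr JG p x y z)" for x y z
  define fz where "fz x y z = x + z\<^sup>2 + r * z * pr JH p x y z" for x y z
  have nn: "0 \<le> Lp" "0 \<le> B" "0 \<le> L"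
    using M R0 small by (auto simp: Lp_def B_def L_def intro!: add_nonneg_nonneg mult_nonneg_nonneg)
  have rs: "\<bar>r\<bar> \<le> 1" "\<bar>s\<bar> \<le> 1" using pS [OF p] e small by (auto simp: r_def s_def)
  have \<nu>R: "\<nu> \<le> rho" "\<nu> < R" using \<nu> small by linarith+
  have sf: "system_field a1 a2 F G H (fst p) (snd p) (x, y, z) = (fx x y z, fy x y z, fz x y z)"
    if "\<bar>x\<bar> \<le> R" "\<bar>y\<bar> \<le> R" "\<bar>z\<bar> \<le> R" for x y z
    using F [OF that] G [OF that] H [OF that]
    by (simp add: system_field_def fx_def fy_def fz_def r_def s_def l Let_def algebra_simps power2_eq_square)
  have h: "\<bar>hx p y\<bar> \<le> R" "\<bar>hz p y\<bar> \<le> R" if "\<bar>y\<bar> < \<nu>" for y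
    using abs_hx [OF p, of y] abs_hz [OF p, of y] that \<nu>R by auto
  have inv: "fx (hx p y) y (hz p y) = k1 y * fy (hx p y) y (hz p y)" "fz (hx p y) y (hz p y) = k2 y * fy (hx p y) y (hz p y)"
    if "\<bar>y\<bar> < \<nu>" for y
    using invariance_equation [OF p, of y] that \<nu> by (simp_all add: fx_def fy_def fz_def k1_def k2_def r_def s_def)
  have k12: "\<bar>k1 y\<bar> \<le> B" "\<bar>k2 y\<bar> \<le> B" if "\<bar>y\<bar> < \<nu>" for y
  proof -
    have "\<bar>y / rho\<bar> \<le> 1/2" using that \<nu> small by (simp add: field_simps)
    then have "\<bar>dev (y / rho) (XX p)\<bar> \<le> beta" "\<bar>dev (y / rho) (ZZ p)\<bar> \<le> beta"
      using abs_dev_le norm_XX [OF p] norm_ZZ [OF p] order_trans by blast+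
    then have "\<bar>dev (y / rho) (XX p) / rho\<bar> \<le> beta / rho" "\<bar>dev (y / rho) (ZZ p) / rho\<bar> \<le> beta / rho"
      using small by (simp_all add: divide_right_mono)
    then show "\<bar>k1 y\<bar> \<le> B" "\<bar>k2 y\<bar> \<le> B" unfolding k1_def k2_def B_def using that \<nu>R small by linarith+
  qed
  have lip: "\<bar>fx x y z - fx x' y z'\<bar> \<le> (2 + Lp) * (\<bar>x - x'\<bar> + \<bar>z - z'\<bar>)"
    "\<bar>fy x y z - fy x' y z'\<bar> \<le> (\<bar>a2\<bar> + Lp) * (\<bar>x - x'\<bar> + \<bar>z - z'\<bar>)"
    "\<bar>fz x y z - fz x' y z'\<bar> \<le> (1 + 2 * R + R * Lp + 8 * C) * (\<bar>x - x'\<bar> + \<bar>z - z'\<bar>)"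
    if b: "\<bar>x\<bar> \<le> R" "\<bar>y\<bar> \<le> R" "\<bar>z\<bar> \<le> R" "\<bar>x'\<bar> \<le> R" "\<bar>z'\<bar> \<le> R" for x y z x' z'
  proof -
    define d where "d = \<bar>x - x'\<bar> + \<bar>z - z'\<bar>"
    have d: "0 \<le> d" "\<bar>x - x'\<bar> \<le> d" "\<bar>z - z'\<bar> \<le> d" by (simp_all add: d_def)
    have rm: "\<bar>r * a\<bar> \<le> \<bar>a\<bar>" for a
      using mult_right_mono [OF rs(1), of "\<bar>a\<bar>"] by (simp add: abs_mult)
    note q = pr_bounds(2) [OF _ p b, folded Lp_def d_def]
    have "\<bar>r * s + 1\<bar> \<le> 2"
      using rm [of s] rs by linarith
    then have 1: "\<bar>(r * s + 1) * (z - z')\<bar> \<le> 2 * d"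
      unfolding abs_mult using d by (intro mult_mono) auto
    have "fx x y z - fx x' y z' = r * (pr JF p x y z - pr JF p x' y z') - (r * s + 1) * (z - z')"
      by (simp add: fx_def algebra_simps)
    then show "\<bar>fx x y z - fx x' y z'\<bar> \<le> (2 + Lp) * d"
      using 1 rm [of "pr JF p x y z - pr JF p x' y z'"] q [OF J(1)] unfolding distrib_right by linarith
    have 2: "\<bar>a2 * (z - z')\<bar> \<le> \<bar>a2\<bar> * d" unfolding abs_mult using d by (intro mult_left_mono) auto
    have "fy x y z - fy x' y z' = r * (a2 * (z - z') + r * (pr JG p x y z - pr JG p x' y z'))"
      by (simp add: fy_def algebra_simps)
    then show "\<bar>fy x y z - fy x' y z'\<bar> \<le> (\<bar>a2\<bar> + Lp) * d"
      using 2 rm [of "a2 * (z - z') + r * (pr JG p x y z - pr JG p x' y z')"] rm [of "pr JG p x y z - pr JG p x' y z'"] q [OF J(2)]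
      unfolding distrib_right by linarith
    have 3: "\<bar>(z + z') * (z - z')\<bar> \<le> 2 * R * d"
      unfolding abs_mult using b d by (intro mult_mono) auto
    have 4: "\<bar>z * (pr JH p x y z - pr JH p x' y z')\<bar> \<le> R * (Lp * d)"
      unfolding abs_mult using b q [OF J(3)] by (intro mult_mono) auto
    have 5: "\<bar>(z - z') * pr JH p x' y z'\<bar> \<le> d * (8 * C)"
      unfolding abs_mult using d pr_bounds(1) [OF J(3) p b(4) b(2) b(5) b(4) b(5)] by (intro mult_mono) auto
    have "fz x y z - fz x' y z' = (x - x') + (z + z') * (z - z') + r * (z * (pr JH p x y z - pr JH p x' y z') + (z - z') * pr JH p x' y z')"
      by (simp add: fz_def algebra_simps power2_eq_square)
    moreover have "(1 + 2 * R + R * Lp + 8 * C) * d = d + 2 * R * d + R * (Lp * d) + d * (8 * C)" by (simp add: algebra_simps)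
    ultimately show "\<bar>fz x y z - fz x' y z'\<bar> \<le> (1 + 2 * R + R * Lp + 8 * C) * d"
      using d 3 4 5 rm [of "z * (pr JH p x y z - pr JH p x' y z') + (z - z') * pr JH p x' y z'"] by linarith
  qed
  show ?thesis
  proof (rule graph_locally_invariant [where V = V and \<nu> = \<nu> and ?h1.0 = "hx p" and ?h2.0 = "hz p" and ?k1.0 = k1 and ?k2.0 = k2 and L = L])
    show "open V" unfolding V_def by (intro open_Times open_greaterThanLessThan)
    show Mg: "(x, y, z) \<in> graph_manifold \<nu> (mm p) \<longleftrightarrow> \<bar>y\<bar> < \<nu> \<and> x = hx p y \<and> z = hz p y" for x y z
    proof -
      have "vector [x, z] = Omega_fun (mm p) y \<longleftrightarrow> x = hx p y \<and> z = hz p y" if "\<bar>y\<bar> < \<nu>"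
        using Omega_fun_mm [of y p] that \<nu>R by (simp add: vec_eq_iff forall_2)
      then show ?thesis unfolding graph_manifold_def by auto
    qed
    show "\<bar>y\<bar> < \<nu>" if "(x, y, z) \<in> V" for x y z using that by (auto simp: V_def)
    show "graph_manifold \<nu> (mm p) \<subseteq> V"
    proof
      fix w assume w: "w \<in> graph_manifold \<nu> (mm p)"
      obtain x y z where xyz: "w = (x, y, z)" by (cases w) auto
      then have "\<bar>y\<bar> < \<nu>" "x = hx p y" "z = hz p y" using w Mg by auto
      moreover have "\<bar>hx p y\<bar> < R" "\<bar>hz p y\<bar> < R"
        using abs_hx [OF p, of y] abs_hz [OF p, of y] \<open>\<bar>y\<bar> < \<nu>\<close> \<nu>R by auto
      ultimately show "w \<in> V" by (auto simp: V_def xyz abs_less_iff)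
    qed
    show "(hx p has_field_derivative k1 y) (at y)" "(hz p has_field_derivative k2 y) (at y)" if "\<bar>y\<bar> < \<nu>" for y
      using DERIV_hx [of y p] DERIV_hz [of y p] that \<nu>R by (simp_all add: k1_def k2_def)
    fix x y z assume "(x, y, z) \<in> V"
    then have v: "\<bar>x\<bar> \<le> R" "\<bar>y\<bar> < \<nu>" "\<bar>y\<bar> \<le> R" "\<bar>z\<bar> \<le> R" using \<nu>R by (auto simp: V_def)
    define d where "d = \<bar>x - hx p y\<bar> + \<bar>z - hz p y\<bar>"
    have d: "0 \<le> d" by (simp add: d_def)
    note lp = lip [OF v(1,3,4) h [OF v(2)], folded d_def]
    have kb: "\<bar>a * (fy x y z - fy (hx p y) y (hz p y))\<bar> \<le> B * ((\<bar>a2\<bar> + Lp) * d)" if "\<bar>a\<bar> \<le> B" for a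
      unfolding abs_mult using that lp(2) nn by (intro mult_mono) auto
    have "fx x y z - k1 y * fy x y z = (fx x y z - fx (hx p y) y (hz p y)) - k1 y * (fy x y z - fy (hx p y) y (hz p y))"
      using inv(1) [OF v(2)] by (simp add: algebra_simps)
    then have "\<bar>fx x y z - k1 y * fy x y z\<bar> \<le> (2 + Lp) * d + B * ((\<bar>a2\<bar> + Lp) * d)"
      using lp(1) kb [OF k12(1) [OF v(2)]] by linarith
    also have "\<dots> = (2 + Lp + B * (\<bar>a2\<bar> + Lp)) * d" by (simp add: algebra_simps)
    also have "\<dots> \<le> L * d" unfolding L_def using nn R0 M(6) d by (intro mult_right_mono) (auto simp: distrib_right)
    finally show "\<bar>fst (system_field a1 a2 F G H (fst p) (snd p) (x, y, z)) - k1 y * fst (snd (system_field a1 a2 F G H (fst p) (snd p) (x, y, z)))\<bar>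
        \<le> L * (\<bar>x - hx p y\<bar> + \<bar>z - hz p y\<bar>)"
      unfolding sf [OF v(1,3,4)] d_def by simp
    have "fz x y z - k2 y * fy x y z = (fz x y z - fz (hx p y) y (hz p y)) - k2 y * (fy x y z - fy (hx p y) y (hz p y))"
      using inv(2) [OF v(2)] by (simp add: algebra_simps)
    then have "\<bar>fz x y z - k2 y * fy x y z\<bar> \<le> (1 + 2 * R + R * Lp + 8 * C) * d + B * ((\<bar>a2\<bar> + Lp) * d)"
      using lp(3) kb [OF k12(2) [OF v(2)]] by linarith
    also have "\<dots> = (1 + 2 * R + R * Lp + 8 * C + B * (\<bar>a2\<bar> + Lp)) * d" by (simp add: algebra_simps)
    also have "\<dots> \<le> L * d" unfolding L_def using nn R0 M(6) d by (intro mult_right_mono) (auto simp: distrib_right)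
    finally show "\<bar>snd (snd (system_field a1 a2 F G H (fst p) (snd p) (x, y, z))) - k2 y * fst (snd (system_field a1 a2 F G H (fst p) (snd p) (x, y, z)))\<bar>
        \<le> L * (\<bar>x - hx p y\<bar> + \<bar>z - hz p y\<bar>)"
      unfolding sf [OF v(1,3,4)] d_def by simp
  qed (rule nn(3))
qed

end

text \<open>The denominators 96 and 64 bring the derivative terms to 4/64 + 6/96 = 1/8, half of the
  allowed 1/4, after division by \<open>\<rho>\<close>. The other half covers the remaining terms,
  where \<open>M * \<rho> \<le> 1/64\<close>. The 68 = 4 * 17 yields the self-map condition.\<close>

lemma small_parameters:
  fixes M R \<epsilon> :: real
  assumes M: "1 \<le> M" and R: "0 < R" and \<epsilon>: "0 < \<epsilon>"
  obtains \<rho> \<beta> \<kappa> where "0 < \<rho>" "\<rho> \<le> 1" "\<rho> \<le> \<epsilon>" "0 < \<beta>" "\<beta> \<le> 1" "0 < \<kappa>" "\<kappa> \<le> 1"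
    "\<rho> * \<rho> + \<beta> \<le> R" "\<rho> + \<beta> \<le> R"
    "M * (6 * M * \<kappa>) + M * (2 * \<rho> + 2 * \<beta> + 5 * M * \<kappa>) + 2 * ((1 / \<rho>) * (M * (2 * M\<^sup>2 * \<kappa> + 3 * M\<^sup>2 * \<beta>))) \<le> 1/4"
    "17 * M\<^sup>2 * \<kappa> \<le> \<beta> / 4"
proof -
  define \<rho> where "\<rho> = min (1 / (64 * M)) (min (R / 2) \<epsilon>)"
  define \<beta> where "\<beta> = min (\<rho> / (96 * M ^ 3)) (R / 2)"
  define \<kappa> where "\<kappa> = min (\<beta> / (68 * M\<^sup>2)) (\<rho> / (64 * M ^ 3))"
  have \<rho>: "0 < \<rho>" "\<rho> \<le> R / 2" "\<rho> \<le> \<epsilon>" using M R \<epsilon> by (auto simp: \<rho>_def)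
  have "\<rho> \<le> 1 / (64 * M)" by (simp add: \<rho>_def)
  then have M\<rho>: "M * \<rho> \<le> 1 / 64" using M by (simp add: field_simps)
  have le: "a \<le> M * a" if "0 \<le> a" for a using mult_right_mono [OF M that] by simp
  have \<rho>1: "\<rho> \<le> 1 / 64" using le [of \<rho>] \<rho>(1) M\<rho> by linarith
  have M3: "0 < M ^ 3" "0 < M\<^sup>2" "1 \<le> M ^ 3" "1 \<le> M\<^sup>2" using M one_le_power [OF M] by auto
  have \<beta>: "0 < \<beta>" "\<beta> \<le> R / 2" using \<rho> M3 R by (auto simp: \<beta>_def)
  have "\<beta> \<le> \<rho> / (96 * M ^ 3)" by (simp add: \<beta>_def)
  then have b: "M ^ 3 * \<beta> \<le> \<rho> / 96" using M3(1) by (simp add: field_simps)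
  have \<kappa>: "0 < \<kappa>" using \<beta> \<rho> M3 by (auto simp: \<kappa>_def)
  have "\<kappa> \<le> \<beta> / (68 * M\<^sup>2)" by (simp add: \<kappa>_def)
  then have k1: "M\<^sup>2 * \<kappa> \<le> \<beta> / 68" using M3 by (simp add: field_simps)
  have "\<kappa> \<le> \<rho> / (64 * M ^ 3)" by (simp add: \<kappa>_def)
  then have k2: "M ^ 3 * \<kappa> \<le> \<rho> / 64" using M3 by (simp add: field_simps)
  have "M * 1 \<le> M * M\<^sup>2" using M M3 by (intro mult_left_mono) auto
  then have MM3: "M \<le> M ^ 3" by (simp add: power3_eq_cube power2_eq_square)
  then have "M * \<beta> \<le> M ^ 3 * \<beta>" using \<beta>(1) by (intro mult_right_mono) auto
  then have M\<beta>: "M * \<beta> \<le> 1 / 96" using b \<rho>1 by linarith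
  then have \<beta>1: "\<beta> \<le> 1 / 96" using le [of \<beta>] \<beta>(1) by linarith
  have "1 * \<kappa> \<le> M\<^sup>2 * \<kappa>" using \<kappa> M3 by (intro mult_right_mono) auto
  then have \<kappa>1: "\<kappa> \<le> 1" using k1 \<beta>1 by linarith
  have "\<rho> * \<rho> \<le> \<rho> * 1" using \<rho>(1) \<rho>1 by (intro mult_left_mono) auto
  have "2 * ((1 / \<rho>) * (M * (2 * M\<^sup>2 * \<kappa> + 3 * M\<^sup>2 * \<beta>))) = (4 * (M ^ 3 * \<kappa>) + 6 * (M ^ 3 * \<beta>)) / \<rho>"
    by (simp add: power3_eq_cube power2_eq_square algebra_simps add_divide_distrib)
  also have "\<dots> \<le> (4 * (\<rho> / 64) + 6 * (\<rho> / 96)) / \<rho>"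
    using b k2 \<rho>(1) by (intro divide_right_mono add_mono mult_left_mono) auto
  also have "\<dots> = 1 / 8" using \<rho>(1) by (simp add: field_simps)
  finally have 1: "2 * ((1 / \<rho>) * (M * (2 * M\<^sup>2 * \<kappa> + 3 * M\<^sup>2 * \<beta>))) \<le> 1 / 8" .
  have 2: "M * (6 * M * \<kappa>) + M * (2 * \<rho> + 2 * \<beta> + 5 * M * \<kappa>) = 11 * (M\<^sup>2 * \<kappa>) + 2 * (M * \<rho>) + 2 * (M * \<beta>)"
    by (simp add: power2_eq_square algebra_simps)
  show ?thesis
  proof (rule that [of \<rho> \<beta> \<kappa>])
    show "M * (6 * M * \<kappa>) + M * (2 * \<rho> + 2 * \<beta> + 5 * M * \<kappa>) + 2 * ((1 / \<rho>) * (M * (2 * M\<^sup>2 * \<kappa> + 3 * M\<^sup>2 * \<beta>))) \<le> 1/4"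
      using 1 k1 M\<rho> M\<beta> \<beta>1 unfolding 2 by linarith
    show "17 * M\<^sup>2 * \<kappa> \<le> \<beta> / 4" using k1 by simp
    show "\<rho> * \<rho> + \<beta> \<le> R" "\<rho> + \<beta> \<le> R" using \<open>\<rho> * \<rho> \<le> \<rho> * 1\<close> \<rho> \<beta> by linarith+
  qed (use \<rho> \<rho>1 \<beta> \<beta>1 \<kappa> \<kappa>1 in auto)
qed

theorem proposition2p3:
  fixes a1 a2 :: real
    and F2 G2 H2 :: "real \<Rightarrow> real \<Rightarrow> real \<Rightarrow> real \<Rightarrow> real \<Rightarrow> real"
    and k :: nat
  assumes "a1 + a2 \<noteq> 0"
    and "smooth_analytic F2" and "smooth_analytic G2" and "smooth_analytic H2"
  shows "\<forall>\<epsilon>>0. \<exists>\<delta> \<nu>. 0 < \<delta> \<and> \<delta> < \<epsilon> \<and> 0 < \<nu> \<and> \<nu> < \<epsilon> \<and>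
    (\<exists>r0>0. \<exists>m :: real \<Rightarrow> real \<Rightarrow> nat \<Rightarrow> real ^ 2.
       Ck_Omega_on k \<nu> (\<lambda>(r2, \<mu>2). m r2 \<mu>2) ({0..r0} \<times> {-\<delta>..\<delta>}) \<and>
       (\<forall>r2\<in>{0..r0}. \<forall>\<mu>2\<in>{-\<delta>..\<delta>}.
          locally_invariant (system_field a1 a2 F2 G2 H2 r2 \<mu>2) (graph_manifold \<nu> (m r2 \<mu>2))) \<and>
       (\<forall>\<mu>2\<in>{-\<delta>..\<delta>}.
          (\<forall>\<zeta>::complex. norm \<zeta> \<le> \<nu> \<longrightarrow> Omega_fun (m 0 \<mu>2) \<zeta> = vector [- (\<zeta>\<^sup>2), \<zeta>]) \<and>
          graph_manifold \<nu> (m 0 \<mu>2) \<subseteq> C2))"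
proof (intro allI impI)
  fix \<epsilon> :: real assume "0 < \<epsilon>"
  define l where "l = a1 + a2"
  obtain RF where RF: "0 < RF" "\<And>R. 0 < R \<and> R \<le> RF \<longrightarrow> (\<exists>C J. expansion k R C F2 J)"
    using smooth_analytic_expansion [OF assms(2), of k] by blast
  obtain RG where RG: "0 < RG" "\<And>R. 0 < R \<and> R \<le> RG \<longrightarrow> (\<exists>C J. expansion k R C G2 J)"
    using smooth_analytic_expansion [OF assms(3), of k] by blast
  obtain RH where RH: "0 < RH" "\<And>R. 0 < R \<and> R \<le> RH \<longrightarrow> (\<exists>C J. expansion k R C H2 J)"
    using smooth_analytic_expansion [OF assms(4), of k] by blast
  define R where "R = min RF (min RG RH)"
  have R: "0 < R" "0 < R \<and> R \<le> RF" "0 < R \<and> R \<le> RG" "0 < R \<and> R \<le> RH" using RF RG RH by (auto simp: R_def)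
  obtain CF JF where CF: "0 \<le> CF" "\<And>i. jetfam k (CF * (1/4) ^ tdeg i) (SR R) (JF i)"
    and eF: "\<And>x y z p. p \<in> SR R \<Longrightarrow> \<bar>x\<bar> \<le> R \<and> \<bar>y\<bar> \<le> R \<and> \<bar>z\<bar> \<le> R \<Longrightarrow>
        F2 x y z (fst p) (fst p * snd p) = psum (\<lambda>i. JF i 0 0 p) (x / R) (y / R) (z / R)"
    using RF(2) [rule_format, OF R(2)] unfolding expansion_def by blast
  obtain CG JG where CG: "0 \<le> CG" "\<And>i. jetfam k (CG * (1/4) ^ tdeg i) (SR R) (JG i)"
    and eG: "\<And>x y z p. p \<in> SR R \<Longrightarrow> \<bar>x\<bar> \<le> R \<and> \<bar>y\<bar> \<le> R \<and> \<bar>z\<bar> \<le> R \<Longrightarrow>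
        G2 x y z (fst p) (fst p * snd p) = psum (\<lambda>i. JG i 0 0 p) (x / R) (y / R) (z / R)"
    using RG(2) [rule_format, OF R(3)] unfolding expansion_def by blast
  obtain CH JH where CH: "0 \<le> CH" "\<And>i. jetfam k (CH * (1/4) ^ tdeg i) (SR R) (JH i)"
    and eH: "\<And>x y z p. p \<in> SR R \<Longrightarrow> \<bar>x\<bar> \<le> R \<and> \<bar>y\<bar> \<le> R \<and> \<bar>z\<bar> \<le> R \<Longrightarrow>
        H2 x y z (fst p) (fst p * snd p) = psum (\<lambda>i. JH i 0 0 p) (x / R) (y / R) (z / R)"
    using RH(2) [rule_format, OF R(4)] unfolding expansion_def by blast
  define C where "C = CF + CG + CH"
  define A where "A = 8 * ((real (Suc k))\<^sup>2 * C)"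
  \<comment> \<open>A sum of nonnegative quantities, so that each constant of the locale is bounded
    by it.\<close>
  define M where "M = 1 + \<bar>l\<bar> + \<bar>a2\<bar> + (2 + 6 / \<bar>l\<bar>) + 2 ^ k + A + A * (2 / R)"
  have C: "0 \<le> C" "CF \<le> C" "CG \<le> C" "CH \<le> C" using CF(1) CG(1) CH(1) by (simp_all add: C_def)
  have "0 \<le> A" using C by (simp add: A_def)
  then have nn: "0 \<le> A * (2 / R)" using R by (intro mult_nonneg_nonneg) auto
  have p2: "0 \<le> (2::real) ^ k" "0 \<le> 6 / \<bar>l\<bar>" by simp_all
  have M: "1 \<le> M" "\<bar>l\<bar> \<le> M" "\<bar>a2\<bar> \<le> M" "2 + 6 / \<bar>l\<bar> \<le> M" "2 ^ k \<le> M" "A \<le> M" "A * (2 / R) \<le> M"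
    unfolding M_def using \<open>0 \<le> A\<close> nn p2 by linarith+
  obtain \<rho> \<beta> \<kappa> where par: "0 < \<rho>" "\<rho> \<le> 1" "\<rho> \<le> \<epsilon>" "0 < \<beta>" "\<beta> \<le> 1" "0 < \<kappa>" "\<kappa> \<le> 1"
    "\<rho> * \<rho> + \<beta> \<le> R" "\<rho> + \<beta> \<le> R"
    "M * (6 * M * \<kappa>) + M * (2 * \<rho> + 2 * \<beta> + 5 * M * \<kappa>) + 2 * ((1 / \<rho>) * (M * (2 * M\<^sup>2 * \<kappa> + 3 * M\<^sup>2 * \<beta>))) \<le> 1/4"
    "17 * M\<^sup>2 * \<kappa> \<le> \<beta> / 4"
    using small_parameters [OF M(1) R(1) \<open>0 < \<epsilon>\<close>] by blast
  \<comment> \<open>Half of \<open>\<kappa>\<close> is reserved for the unit e and the other half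
    for r and mu2, so that value plus first-order entry of each parameter jet stays below
    \<open>\<kappa>\<close>. The second bound gives |l| e <= 1/2.\<close>
  define e where "e = min (\<kappa> / 2) (1 / (2 * \<bar>l\<bar>))"
  define r0 where "r0 = min (\<kappa> / 2) R"
  define \<delta> where "\<delta> = min (\<kappa> / 2) (\<epsilon> / 2)"
  \<comment> \<open>The coefficients grow at rate at most 2^k/rho, so this radius gives the ratio
    1/2. It is also at most rho/2, where the invariance equation holds.\<close>
  define \<nu> where "\<nu> = \<rho> / 2 ^ Suc k"
  define S where "S = {0..r0} \<times> {-\<delta>..\<delta>}"
  have l0: "l \<noteq> 0" using assms(1) by (simp add: l_def)
  have e: "0 < e" "e \<le> \<kappa> / 2" "e \<le> 1 / (2 * \<bar>l\<bar>)" using par l0 by (simp_all add: e_def)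
  then have e': "e \<le> 1" "\<bar>l\<bar> * e \<le> 1 / 2" using par l0 by (simp, simp add: field_simps)
  have r0: "0 < r0" "r0 \<le> \<kappa> / 2" "r0 \<le> R" using par R by (simp_all add: r0_def)
  have \<delta>: "0 < \<delta>" "\<delta> \<le> \<kappa> / 2" "\<delta> < \<epsilon>" "\<delta> \<le> 1" using par \<open>0 < \<epsilon>\<close> by (auto simp: \<delta>_def)
  have SSR: "S \<subseteq> SR R" using r0 \<delta> by (auto simp: S_def)
  have jet: "jetfam k (C * (1/4) ^ tdeg i) S (J i)" if "jetfam k (c * (1/4) ^ tdeg i) (SR R) (J i)" "c \<le> C"
    for c i and J :: "nat \<Rightarrow> nat \<Rightarrow> nat \<Rightarrow> real \<times> real \<Rightarrow> real"
    by (rule jetfam_subset [OF jetfam_mono [OF that(1)] SSR]) (use that(2) in \<open>simp add: mult_right_mono\<close>)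
  interpret jet_system l a2 R C M e \<rho> \<beta> \<kappa> k JF JG JH S
  proof
    show "convex S" unfolding S_def by (intro convex_Times convex_real_interval)
    show "\<bar>fst p\<bar> + e \<le> \<kappa>" "\<bar>snd p\<bar> + e \<le> \<kappa>" if "p \<in> S" for p
      using that r0 \<delta> e by (auto simp: S_def)
    show "8 * ((real (Suc k))\<^sup>2 * C) \<le> M" "8 * ((real (Suc k))\<^sup>2 * C) * (2 / R) \<le> M"
      using M by (simp_all only: A_def)
  qed (use l0 R e e' par M C in \<open>auto intro: jet CF(2) CG(2) CH(2)\<close>)
  have pow: "(1::real) \<le> 2 ^ k" by (rule one_le_power) simp
  have \<nu>: "0 < \<nu>" "\<nu> \<le> \<rho> / 2" "2 ^ k / \<rho> * \<nu> < 1"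
    using par pow by (auto simp: \<nu>_def field_simps)
  then have "\<nu> < \<epsilon>" using par by linarith
  have inv: "locally_invariant (system_field a1 a2 F2 G2 H2 r s) (graph_manifold \<nu> (mm (r, s)))" if "(r, s) \<in> S" for r s
    using locally_invariant_mm [OF that \<nu>(1,2) l_def, of F2 G2 H2]
      eF [OF subsetD [OF SSR that]] eG [OF subsetD [OF SSR that]] eH [OF subsetD [OF SSR that]]
    by (simp add: pr_def)
  have zero: "Omega_fun (mm (0, s)) (\<zeta>::complex) = vector [- (\<zeta>\<^sup>2), \<zeta>]" if "s \<in> {-\<delta>..\<delta>}" for s \<zeta>
    by (rule Omega_fun_mm_zero) (use that r0 in \<open>auto simp: S_def\<close>)
  have sub: "graph_manifold \<nu> (mm (0, s)) \<subseteq> C2" if s: "s \<in> {-\<delta>..\<delta>}" for s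
  proof
    fix w assume w: "w \<in> graph_manifold \<nu> (mm (0, s))"
    obtain x y z where xyz: "w = (x, y, z)" by (cases w) auto
    have p: "(0, s) \<in> S" "fst (0::real, s) = 0" using s r0 by (auto simp: S_def)
    have y: "\<bar>y\<bar> \<le> \<rho>" and v: "vector [x, z] = Omega_fun (mm (0, s)) y"
      using w \<nu> par by (auto simp: graph_manifold_def xyz)
    have "ev t (XX (0, s)) = 0" "ev t (ZZ (0, s)) = 0" for t
      by (simp_all add: ev_def sol_zero [OF p])
    then have "V2 x z = V2 (- (y\<^sup>2)) y"
      using v Omega_fun_mm [OF y, of "(0, s)"] by (simp add: V2_eq_vector hx_def hz_def)
    then have "x = - (y\<^sup>2)" "z = y" by (metis V2_nth(1), metis V2_nth(2))
    then show "w \<in> C2" by (simp add: C2_def xyz)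
  qed
  show "\<exists>\<delta> \<nu>. 0 < \<delta> \<and> \<delta> < \<epsilon> \<and> 0 < \<nu> \<and> \<nu> < \<epsilon> \<and>
    (\<exists>r0>0. \<exists>m :: real \<Rightarrow> real \<Rightarrow> nat \<Rightarrow> real ^ 2.
       Ck_Omega_on k \<nu> (\<lambda>(r2, \<mu>2). m r2 \<mu>2) ({0..r0} \<times> {-\<delta>..\<delta>}) \<and>
       (\<forall>r2\<in>{0..r0}. \<forall>\<mu>2\<in>{-\<delta>..\<delta>}.
          locally_invariant (system_field a1 a2 F2 G2 H2 r2 \<mu>2) (graph_manifold \<nu> (m r2 \<mu>2))) \<and>
       (\<forall>\<mu>2\<in>{-\<delta>..\<delta>}.
          (\<forall>\<zeta>::complex. norm \<zeta> \<le> \<nu> \<longrightarrow> Omega_fun (m 0 \<mu>2) \<zeta> = vector [- (\<zeta>\<^sup>2), \<zeta>]) \<and>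
          graph_manifold \<nu> (m 0 \<mu>2) \<subseteq> C2))"
  proof (intro exI conjI ballI allI impI)
    show "Ck_Omega_on k \<nu> (\<lambda>(r2, \<mu>2). mm (r2, \<mu>2)) ({0..r0} \<times> {-\<delta>..\<delta>})"
      using Ck_Omega_mm [OF less_imp_le [OF \<nu>(1)] \<nu>(3)] by (simp add: S_def)
    show "locally_invariant (system_field a1 a2 F2 G2 H2 r2 \<mu>2) (graph_manifold \<nu> (mm (r2, \<mu>2)))"
      if "r2 \<in> {0..r0}" "\<mu>2 \<in> {-\<delta>..\<delta>}" for r2 \<mu>2
      by (rule inv) (use that in \<open>simp add: S_def\<close>)
  qed (rule \<delta> \<nu> r0 \<open>\<nu> < \<epsilon>\<close> zero sub; assumption?)+
qed

end
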